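(* Let $\alpha>1$ and let $\mathcal{C}_\alpha$ be a random variable with the $\alpha$-Cauchy distribution. For $\varepsilon\in\{1,-1\}$, the random variable $|\mathcal{C}_\alpha|^{\varepsilon p}$ is infinitely divisible if $$ p\geq \begin{cases} (\alpha+1)/3, & \varepsilon=1,\ 1<\alpha\leq 2,\\ \alpha/2, & \varepsilon=1,\ \alpha>2,\\ \alpha/2, & \varepsilon=-1,\ 1<\alpha\leq 2,\\ (2\alpha-1)/3, & \varepsilon=-1,\ \alpha>2.\end{cases}$$
   Context: For $\alpha>1$, the $\alpha$-Cauchy distribution is the probability distribution on $\mathbb{R}$ with density $f_{\mathcal{C}_\alpha}(t)=\frac{\sin(\pi/\alpha)}{2\pi/\alpha}\,\frac{1}{1+|t|^\alpha}$, $t\in\mathbb{R}$. A random variable is infinitely divisible if for every integer $n\geq 1$ its law is the $n$-fold convolution of some probability measure on $\mathbb{R}$. *)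

theory Defs
  imports "HOL-Probability.Probability"
begin

definition alpha_cauchy_density :: "real \<Rightarrow> real \<Rightarrow> real" where
  "alpha_cauchy_density \<alpha> t =
     sin (pi / \<alpha>) / (2 * pi / \<alpha>) * (1 / (1 + \<bar>t\<bar> powr \<alpha>))"

primrec convolution_power :: "real measure \<Rightarrow> nat \<Rightarrow> real measure" where
  "convolution_power \<nu> 0 = return borel 0"
| "convolution_power \<nu> (Suc n) = convolution \<nu> (convolution_power \<nu> n)"

lemma convolution_power_1:
  assumes "real_distribution \<nu>"
  shows "convolution_power \<nu> 1 = \<nu>"
proof -
  interpret real_distribution \<nu> by fact
  interpret R: prob_space "return borel (0::real)" by (rule prob_space_return) simp
  show ?thesis
    by (rule measure_eqI)
       (auto simp: convolution_emeasure' finite_measure_axioms R.finite_measure_axioms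
          nn_integral_return)
qed

definition infinitely_divisible_law :: "real measure \<Rightarrow> bool" where
  "infinitely_divisible_law \<mu> \<longleftrightarrow>
     (\<forall>n\<ge>1. \<exists>\<nu>. real_distribution \<nu> \<and> \<mu> = convolution_power \<nu> n)"

definition infinitely_divisible :: "'a measure \<Rightarrow> ('a \<Rightarrow> real) \<Rightarrow> bool" where
  "infinitely_divisible M X \<longleftrightarrow>
     X \<in> borel_measurable M \<and> infinitely_divisible_law (distr M borel X)"

end

theory Submission
  imports Defs "HOL-Complex_Analysis.Complex_Analysis"
    "HOL-Computational_Algebra.Fundamental_Theorem_Algebra" "HOL-Computational_Algebra.Polynomial_FPS"
begin

text \<open>
  A power of \<open>\<bar>C\<bar>\<close> with exponent \<open>\<epsilon> * p\<close> has a density proportional to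
  \<open>x powr (b - 1) / (1 + x powr r)\<close> on the positive half line, where \<open>r = \<alpha> / p\<close> and \<open>b\<close> is
  \<open>1 / p\<close> or \<open>(\<alpha> - 1) / p\<close>. The four lower bounds on \<open>p\<close> amount to the two inequalities \<open>r \<le> 2\<close>
  and \<open>b + r \<le> 3\<close>. Write the density as \<open>x * g x\<close>. There are two things to show: \<open>g\<close> is completely
  monotone, that is, a mixture of exponentials \<open>exp (- (l * x))\<close>; and every probability density
  \<open>x * g x\<close> with \<open>g\<close> completely monotone, that is, every mixture of Gamma distributions of shape
  two, is infinitely divisible. The second statement is a theorem of Kristiansen.

  Infinite divisibility (\<open>infinitely_divisible_gamma2_mixture\<close>). Sampling the density on a grid of
  mesh \<open>h\<close> gives a lattice law whose generating function has the coefficients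
  \<open>(k + 1) * g ((k + 1) * h)\<close>, up to a factor. A power series with positive constant term has an
  \<open>n\<close>-th root with nonnegative coefficients, for all \<open>n\<close>, as soon as its logarithmic derivative
  has nonnegative coefficients. Each of them depends continuously on finitely many values of \<open>g\<close>,
  so \<open>g\<close> may be taken to be a finite sum of exponentials. Then the generating function is the
  rational function \<open>\<Sum>i\<in>I. c i / (1 - q i * z)\<^sup>2\<close>, and if \<open>w j\<close> are the reciprocals of its zeros,
  the coefficients in question are \<open>2 * (\<Sum>i\<in>I. q i ^ m) - (\<Sum>j\<in>J. w j ^ m)\<close>. They are nonnegative
  because \<open>\<Sum>j\<in>J. cmod (w j) ^ m \<le> 2 * (\<Sum>i\<in>I. q i ^ m)\<close>, which follows from the product inequality
  \<open>prod_max_roots_le\<close>, applied at all scales: that one is a consequence of the maximum modulus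
  principle once the poles inside the unit disc have been reflected in the unit circle. As the
  mesh tends to 0, Helly's selection theorem and Levy's theorems carry the roots over to the
  limit.

  Complete monotonicity (\<open>comp_mono_powr_div_one_plus_powr\<close>). Products, limits and composition
  with \<open>x powr k\<close>, \<open>k \<le> 1\<close>, reduce the claim to \<open>x powr (1 - r) / (1 + x powr r)\<close> with
  \<open>3/2 < r < 2\<close>. The residue theorem writes this function as the Stieltjes transform of a
  nonnegative weight, which comes from the cut along the negative real axis, plus the contribution
  of the two poles \<open>cis (pi / r)\<close> and \<open>cis (- (pi / r))\<close>. It is therefore the Laplace transform of
  a completely monotone function plus a damped oscillation. That this sum is nonnegative is shown
  separately while the phase of the oscillation is at most \<open>3 * pi / 2\<close>, where two moments of the
  weight suffice, then up to \<open>5 * pi / 2\<close>, where the cosine is nonnegative, and beyond that, where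
  the monotone part dominates.
\<close>

(* The infix dollar sign denotes coefficients of power series, not components of vectors. *)
unbundle no vec_syntax

section \<open>Sums of double poles and their zeros\<close>

text \<open>
  The function \<open>z / (1 - q * z)\<^sup>2\<close> is a rescaled Koebe function. On the unit circle its imaginary
  part has the sign of \<open>Im z\<close> if \<open>q < 1\<close> and the opposite sign if \<open>q > 1\<close>, so poles outside and
  inside the disc can be told apart by this sign.
\<close>

lemma Im_koebe:
  fixes z :: complex and q :: real
  shows "Im (z / (1 - of_real q * z)\<^sup>2)
           = Im z * (1 - q\<^sup>2 * (cmod z)\<^sup>2) / (cmod (1 - of_real q * z)) ^ 4"
proof -
  define u where "u = 1 - of_real q * z"
  have "Im (z / u\<^sup>2) = Im (z * cnj (u\<^sup>2)) / (cmod (u\<^sup>2))\<^sup>2"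
    by (simp only: complex_div_cnj[of z "u\<^sup>2"] Im_divide_of_real flip: of_real_power)
  also have "Im (z * cnj (u\<^sup>2)) = Im z * (1 - q\<^sup>2 * (cmod z)\<^sup>2)"
    unfolding cmod_power2 by (simp add: u_def power2_eq_square algebra_simps)
  also have "(cmod (u\<^sup>2))\<^sup>2 = cmod u ^ 4"
    by (simp add: norm_power flip: power_mult)
  finally show ?thesis by (simp add: u_def)
qed

text \<open>
  Conjugation on the unit circle moves the double pole \<open>1 / q\<close> to its mirror image \<open>q\<close> at the cost
  of a factor, and that factor is at most 1 for the poles that have to be moved.
\<close>

lemma cnj_koebe_on_circle:
  fixes z :: complex and q :: real
  assumes "cmod z = 1" "q \<noteq> 0"
  shows "cnj (z / (1 - of_real q * z)\<^sup>2) = of_real (1 / q\<^sup>2) * (z / (1 - of_real (1 / q) * z)\<^sup>2)"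
proof -
  have z0: "z \<noteq> 0" using assms by auto
  have cz: "cnj z = 1 / z"
    using assms by (metis complex_div_cnj div_by_1 mult_1 of_real_1 power_one)
  have "cnj (z / (1 - of_real q * z)\<^sup>2) = z / (z - of_real q)\<^sup>2"
    using z0 by (simp add: cz divide_simps power2_eq_square) (simp add: algebra_simps)?
  also have "\<dots> = of_real (1 / q\<^sup>2) * (z / (1 - of_real (1 / q) * z)\<^sup>2)"
    using assms by (simp add: divide_simps power2_eq_square) (simp add: algebra_simps)?
  finally show ?thesis .
qed

text \<open>
  Conjugating \<open>b\<close> moves it to the side of the real axis on which \<open>a\<close> lies.
\<close>

lemma cmod_add_le_add_cnj:
  assumes "Im a * Im b \<le> 0"
  shows "cmod (a + b) \<le> cmod (a + cnj b)"
proof (rule power2_le_imp_le)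
  have "(Im a + Im b)\<^sup>2 \<le> (Im a - Im b)\<^sup>2"
    using assms by (simp add: power2_eq_square algebra_simps)
  then show "(cmod (a + b))\<^sup>2 \<le> (cmod (a + cnj b))\<^sup>2"
    by (simp add: cmod_power2)
qed simp

lemma sum_prod_remove_eq:
  fixes c d :: "'i \<Rightarrow> 'a :: field"
  assumes "finite I" "\<And>i. i \<in> I \<Longrightarrow> d i \<noteq> 0"
  shows "(\<Sum>i\<in>I. c i * (\<Prod>l\<in>I-{i}. d l)) = (\<Sum>i\<in>I. c i / d i) * (\<Prod>l\<in>I. d l)"
  unfolding sum_distrib_right
proof (rule sum.cong[OF refl])
  fix i assume "i \<in> I"
  then show "c i * (\<Prod>l\<in>I-{i}. d l) = c i / d i * (\<Prod>l\<in>I. d l)"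
    using assms by (simp add: prod.remove[of I i])
qed

text \<open>
  The \<open>w j\<close> are the reciprocals of the zeros of \<open>P z = (\<Sum>i\<in>I. c i / (1 - q i * z)\<^sup>2)\<close>. Let \<open>Pt\<close>
  arise from \<open>P\<close> by reflecting all poles inside the unit disc in the unit circle. Then \<open>Pt\<close> has no
  zeros in the closed disc, because \<open>Im (z * Pt z)\<close> has the sign of \<open>Im z\<close>. On the circle \<open>P\<close> is
  dominated by \<open>Pt\<close>: the terms with \<open>q i < 1\<close> and those with \<open>q i > 1\<close> contribute to \<open>z * P z\<close> on
  opposite sides of the real axis, and reflection conjugates the latter. Now the maximum modulus
  principle, applied to the numerator of \<open>P\<close> with its zeros inside the disc reflected, divided by
  the numerator of \<open>Pt\<close>, bounds the value at 0, which is the product on the left up to a factor at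
  least 1.
\<close>

lemma prod_max_roots_le:
  fixes c q :: "'i \<Rightarrow> real" and w :: "'j \<Rightarrow> complex"
  assumes fin: "finite I" "finite J"
    and c: "\<And>i. i \<in> I \<Longrightarrow> 0 \<le> c i" and c_pos: "0 < (\<Sum>i\<in>I. c i)"
    and q: "\<And>i. i \<in> I \<Longrightarrow> 0 \<le> q i" "\<And>i. i \<in> I \<Longrightarrow> q i \<noteq> 1"
    and fact: "\<And>z. (\<Sum>i\<in>I. of_real (c i) * (\<Prod>l\<in>I-{i}. (1 - of_real (q l) * z)\<^sup>2))
                  = of_real (\<Sum>i\<in>I. c i) * (\<Prod>j\<in>J. 1 - w j * z)"
  shows "(\<Prod>j\<in>J. max 1 (cmod (w j))) \<le> (\<Prod>i\<in>I. max 1 (q i))\<^sup>2"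
proof -
  define qt where "qt i = (if q i < 1 then q i else 1 / q i)" for i
  define ct where "ct i = (if q i < 1 then c i else c i / (q i)\<^sup>2)" for i
  have qt: "0 \<le> qt i" "qt i < 1" if "i \<in> I" for i
    using q[OF that] by (auto simp: qt_def)
  have ct: "0 \<le> ct i" "ct i \<le> c i" "ct i = 0 \<longleftrightarrow> c i = 0" if "i \<in> I" for i
  proof -
    show "0 \<le> ct i" "ct i = 0 \<longleftrightarrow> c i = 0" using c[OF that] q[OF that] by (auto simp: ct_def)
    have "c i / (q i)\<^sup>2 \<le> c i" if "\<not> q i < 1"
      using c[OF \<open>i \<in> I\<close>] that by (simp add: divide_le_eq mult_le_cancel_left1)
    then show "ct i \<le> c i" by (auto simp: ct_def)
  qed
  have ct_pos: "0 < (\<Sum>i\<in>I. ct i)"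
  proof -
    obtain i where "i \<in> I" "c i \<noteq> 0" using c_pos by (metis less_irrefl sum.neutral)
    then show ?thesis using ct fin by (metis less_eq_real_def sum_pos2)
  qed
  define k where "k q z = z / (1 - of_real q * z)\<^sup>2" for q :: real and z :: complex
  define P where "P z = (\<Sum>i\<in>I. of_real (c i) / (1 - of_real (q i) * z)\<^sup>2)" for z :: complex
  define D where "D z = (\<Prod>i\<in>I. (1 - of_real (q i) * z)\<^sup>2)" for z :: complex
  define Pt where "Pt z = (\<Sum>i\<in>I. of_real (ct i) / (1 - of_real (qt i) * z)\<^sup>2)" for z :: complex
  define Dt where "Dt z = (\<Prod>i\<in>I. (1 - of_real (qt i) * z)\<^sup>2)" for z :: complex
  define Nt where "Nt z = (\<Sum>i\<in>I. of_real (ct i) * (\<Prod>l\<in>I-{i}. (1 - of_real (qt l) * z)\<^sup>2))"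
    for z :: complex
  have nzt: "1 - of_real (qt i) * z \<noteq> 0" if "cmod z \<le> 1" "i \<in> I" for z i
  proof
    assume "1 - of_real (qt i) * z = 0"
    then have "cmod (of_real (qt i) * z) = 1" by (metis eq_iff_diff_eq_0 norm_one)
    then have "qt i * cmod z = 1" using qt(1)[OF that(2)] by (simp add: norm_mult)
    moreover have "qt i * cmod z \<le> qt i * 1"
      using qt(1)[OF that(2)] that(1) by (intro mult_left_mono) auto
    ultimately show False using qt(2)[OF that(2)] by simp
  qed
  have nz: "1 - of_real (q i) * z \<noteq> 0" if "cmod z = 1" "i \<in> I" for z i
  proof
    assume "1 - of_real (q i) * z = 0"
    then have "cmod (of_real (q i) * z) = 1" by (metis eq_iff_diff_eq_0 norm_one)
    then show False using q[OF that(2)] that(1) by (simp add: norm_mult)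
  qed
  have Nt_eq: "Nt z = Pt z * Dt z" if "cmod z \<le> 1" for z
    unfolding Nt_def Pt_def Dt_def using fin nzt[OF that] by (intro sum_prod_remove_eq) auto
  have Dt_nz: "Dt z \<noteq> 0" if "cmod z \<le> 1" for z
    using nzt[OF that] fin by (simp add: Dt_def)
  have Pt_k: "z * Pt z = (\<Sum>i\<in>I. of_real (ct i) * k (qt i) z)" for z
    by (simp add: Pt_def k_def sum_distrib_left mult_ac)
  have Im_k: "Im (k q z) = Im z * (1 - q\<^sup>2 * (cmod z)\<^sup>2) / (cmod (1 - of_real q * z)) ^ 4" for q z
    unfolding k_def by (rule Im_koebe)
  have Pt_nz: "Pt z \<noteq> 0" if z: "cmod z \<le> 1" for z
  proof (cases "Im z = 0")
    case True
    then have zr: "z = of_real (Re z)" by (simp add: complex_eq_iff)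
    have "Pt z = of_real (\<Sum>i\<in>I. ct i / (1 - qt i * Re z)\<^sup>2)"
      unfolding Pt_def by (subst zr) simp
    moreover have "0 < (\<Sum>i\<in>I. ct i / (1 - qt i * Re z)\<^sup>2)"
    proof -
      obtain i where i: "i \<in> I" "ct i \<noteq> 0" using ct_pos by (metis less_irrefl sum.neutral)
      have "(1 - qt i * Re z)\<^sup>2 > 0"
        using nzt[OF z i(1)] zr by (metis of_real_1 of_real_diff of_real_eq_0_iff of_real_mult zero_less_power2)
      then show ?thesis using i ct fin
        by (intro sum_pos2[of _ i]) (auto simp: less_le)
    qed
    ultimately show ?thesis by (metis less_irrefl of_real_eq_0_iff)
  next
    case False
    have "Im (z * Pt z) = Im z * (\<Sum>i\<in>I. ct i * ((1 - (qt i)\<^sup>2 * (cmod z)\<^sup>2) / (cmod (1 - of_real (qt i) * z)) ^ 4))"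
      unfolding Pt_k by (simp add: Im_k sum_distrib_left mult_ac)
    moreover have "0 < (\<Sum>i\<in>I. ct i * ((1 - (qt i)\<^sup>2 * (cmod z)\<^sup>2) / (cmod (1 - of_real (qt i) * z)) ^ 4))"
    proof -
      obtain i where i: "i \<in> I" "ct i \<noteq> 0" using ct_pos by (metis less_irrefl sum.neutral)
      have pos: "0 < (1 - (qt i)\<^sup>2 * (cmod z)\<^sup>2) / (cmod (1 - of_real (qt i) * z)) ^ 4" if "i \<in> I" for i
      proof -
        have "(qt i)\<^sup>2 * (cmod z)\<^sup>2 \<le> (qt i)\<^sup>2 * 1"
          using z by (intro mult_left_mono) (auto simp: power_le_one)
        also have "\<dots> < 1" using qt[OF that] by (simp add: power_less_one_iff abs_square_less_1)
        finally show ?thesis using nzt[OF z that] by simp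
      qed
      have "0 < ct i * ((1 - (qt i)\<^sup>2 * (cmod z)\<^sup>2) / (cmod (1 - of_real (qt i) * z)) ^ 4)"
        using i ct(1,3)[OF i(1)] by (intro mult_pos_pos pos) auto
      then show ?thesis using i(1) fin(1) ct(1) pos
        by (intro sum_pos2[of _ i] mult_nonneg_nonneg) (auto intro: less_imp_le)
    qed
    ultimately have "Im (z * Pt z) \<noteq> 0" using False by simp
    then show ?thesis by auto
  qed
  have Nt_nz: "Nt z \<noteq> 0" if "cmod z \<le> 1" for z
    using that Nt_eq Pt_nz Dt_nz by simp
  \<comment> \<open>On the circle, reflecting the poles that lie inside the disc can only increase the modulus.\<close>
  have P_le: "cmod (P z) \<le> cmod (Pt z)" if z: "cmod z = 1" for z
  proof -
    define A where "A = {i\<in>I. q i < 1}"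
    define B where "B = {i\<in>I. \<not> q i < 1}"
    define a where "a = (\<Sum>i\<in>A. of_real (c i) * k (q i) z)"
    define b where "b = (\<Sum>i\<in>B. of_real (c i) * k (q i) z)"
    have split: "(\<Sum>i\<in>I. f i) = (\<Sum>i\<in>A. f i) + (\<Sum>i\<in>B. f i)" for f :: "'i \<Rightarrow> complex"
      using fin by (subst sum.union_disjoint[symmetric]) (auto simp: A_def B_def intro!: sum.cong)
    have zP: "z * P z = a + b"
      unfolding a_def b_def split[symmetric] by (simp add: P_def k_def sum_distrib_left mult_ac)
    have "cnj b = (\<Sum>i\<in>B. of_real (ct i) * k (qt i) z)"
      unfolding b_def cnj_sum
    proof (rule sum.cong[OF refl])
      fix i assume "i \<in> B"
      then have "q i \<noteq> 0" "\<not> q i < 1" by (auto simp: B_def)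
      then have "cnj (k (q i) z) = of_real (1 / (q i)\<^sup>2) * k (1 / q i) z"
        unfolding k_def by (intro cnj_koebe_on_circle z)
      then show "cnj (of_real (c i) * k (q i) z) = of_real (ct i) * k (qt i) z"
        using \<open>\<not> q i < 1\<close> by (simp add: ct_def qt_def)
    qed
    moreover have "a = (\<Sum>i\<in>A. of_real (ct i) * k (qt i) z)"
      unfolding a_def by (intro sum.cong) (auto simp: A_def ct_def qt_def)
    ultimately have zPt: "z * Pt z = a + cnj b"
      unfolding Pt_k split by simp
    have "Im a = Im z * (\<Sum>i\<in>A. c i * ((1 - (q i)\<^sup>2) / (cmod (1 - of_real (q i) * z)) ^ 4))"
      unfolding a_def by (simp add: Im_k z sum_distrib_left mult_ac)
    moreover have "Im b = Im z * (\<Sum>i\<in>B. c i * ((1 - (q i)\<^sup>2) / (cmod (1 - of_real (q i) * z)) ^ 4))"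
      unfolding b_def by (simp add: Im_k z sum_distrib_left mult_ac)
    moreover have "0 \<le> (\<Sum>i\<in>A. c i * ((1 - (q i)\<^sup>2) / (cmod (1 - of_real (q i) * z)) ^ 4))"
      using c q by (intro sum_nonneg mult_nonneg_nonneg divide_nonneg_nonneg)
        (auto simp: A_def power_le_one)
    moreover have "(\<Sum>i\<in>B. c i * ((1 - (q i)\<^sup>2) / (cmod (1 - of_real (q i) * z)) ^ 4)) \<le> 0"
      using c q by (intro sum_nonpos mult_nonneg_nonpos divide_nonpos_nonneg)
        (auto simp: B_def one_le_power)
    moreover have "(t * x) * (t * y) \<le> 0" if "0 \<le> x" "y \<le> 0" for t x y :: real
    proof -
      have eq: "(t * x) * (t * y) = (t * t) * (x * y)" by (simp only: mult_ac)
      show ?thesis unfolding eq using that by (intro mult_nonneg_nonpos) auto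
    qed
    ultimately have "Im a * Im b \<le> 0" by simp
    from cmod_add_le_add_cnj[OF this] have "cmod (z * P z) \<le> cmod (z * Pt z)"
      by (simp only: zP zPt)
    then show ?thesis using z by (simp add: norm_mult)
  qed
  have D_eq: "cmod (D z) = (\<Prod>i\<in>I. max 1 (q i))\<^sup>2 * cmod (Dt z)" if z: "cmod z = 1" for z
  proof -
    have "cmod (1 - of_real (q i) * z) = max 1 (q i) * cmod (1 - of_real (qt i) * z)" if "i \<in> I" for i
    proof (cases "q i < 1")
      case False
      then have q0: "q i > 1" using q[OF that] by auto
      have "z * cnj z = 1" using z by (simp add: complex_norm_square[symmetric])
      then have "1 - of_real (q i) * z = - (of_real (q i) * z) * cnj (1 - of_real (1 / q i) * z)"
        using q0 by (simp add: algebra_simps)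
      then have "cmod (1 - of_real (q i) * z)
          = cmod (of_real (q i)) * cmod z * cmod (1 - of_real (1 / q i) * z)"
        by (metis complex_mod_cnj norm_minus_cancel norm_mult mult_minus_left)
      then show ?thesis using z False q0 by (simp add: qt_def)
    qed (auto simp: qt_def)
    then show ?thesis
      by (simp add: D_def Dt_def norm_power prod_power_distrib power_mult_distrib
          flip: prod_norm prod.distrib)
  qed
  \<comment> \<open>The factor of a zero, reflected if the zero lies inside the disc: same modulus on the circle,
    and modulus \<open>max 1 (cmod (w j))\<close> at 0.\<close>
  define b where "b j z = (if cmod (w j) \<le> 1 then 1 - w j * z else cnj (w j) - z)" for j z
  have b_circle: "cmod (b j z) = cmod (1 - w j * z)" if z: "cmod z = 1" for j z
  proof -
    have "z * cnj z = 1" using z by (simp add: complex_norm_square[symmetric])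
    then have "1 - w j * z = - (z * cnj (cnj (w j) - z))" by (simp add: algebra_simps)
    then have "cmod (1 - w j * z) = cmod z * cmod (cnj (w j) - z)"
      by (metis complex_mod_cnj norm_minus_cancel norm_mult)
    then show ?thesis using z by (simp add: b_def)
  qed
  define h where "h z = of_real (\<Sum>i\<in>I. c i) * (\<Prod>j\<in>J. b j z) / Nt z" for z
  have b_hol: "b j holomorphic_on A" for j A
    unfolding b_def by (cases "cmod (w j) \<le> 1") (auto intro!: holomorphic_intros)
  have Nt_hol: "Nt holomorphic_on A" for A
    unfolding Nt_def by (intro holomorphic_intros)
  have h_hol: "h holomorphic_on cball 0 1"
    unfolding h_def using Nt_nz by (intro holomorphic_intros b_hol Nt_hol) auto
  have "cmod (h 0) \<le> (\<Prod>i\<in>I. max 1 (q i))\<^sup>2"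
  proof (rule maximum_modulus_frontier[of h "ball 0 1"])
    show "h holomorphic_on interior (ball 0 1)"
      using h_hol by (rule holomorphic_on_subset) auto
    show "continuous_on (closure (ball 0 1)) h"
      using h_hol by (simp add: holomorphic_on_imp_continuous_on)
    fix z :: complex assume "z \<in> frontier (ball 0 1)"
    then have z: "cmod z = 1" by simp
    have "cmod (\<Prod>j\<in>J. b j z) = cmod (\<Prod>j\<in>J. 1 - w j * z)"
      using b_circle[OF z] by (simp flip: prod_norm)
    then have "cmod (h z) = cmod (P z * D z) / cmod (Nt z)"
      unfolding h_def norm_divide norm_mult using fact[of z, symmetric]
      by (metis (no_types, lifting) norm_mult P_def D_def sum_prod_remove_eq[OF fin(1), of "\<lambda>l. (1 - of_real (q l) * z)\<^sup>2" "\<lambda>i. of_real (c i)"] nz[OF z] power_not_zero)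
    also have "\<dots> = cmod (P z) * ((\<Prod>i\<in>I. max 1 (q i))\<^sup>2 * cmod (Dt z)) / (cmod (Pt z) * cmod (Dt z))"
      using z by (simp add: norm_mult D_eq Nt_eq)
    also have "\<dots> = (\<Prod>i\<in>I. max 1 (q i))\<^sup>2 * (cmod (P z) / cmod (Pt z))"
      using Dt_nz[of z] z by simp
    also have "\<dots> \<le> (\<Prod>i\<in>I. max 1 (q i))\<^sup>2 * 1"
      using P_le[OF z] Pt_nz[of z] z by (intro mult_left_mono) (auto simp: divide_le_eq)
    finally show "cmod (h z) \<le> (\<Prod>i\<in>I. max 1 (q i))\<^sup>2" by simp
  qed auto
  moreover have "(\<Prod>j\<in>J. max 1 (cmod (w j))) \<le> cmod (h 0)"
  proof -
    have "cmod (b j 0) = max 1 (cmod (w j))" for j by (auto simp: b_def max_def)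
    then have "cmod (h 0) = (\<Sum>i\<in>I. c i) * (\<Prod>j\<in>J. max 1 (cmod (w j))) / (\<Sum>i\<in>I. ct i)"
      using c_pos ct_pos by (simp add: h_def norm_divide norm_mult Nt_def flip: prod_norm of_real_sum)
    moreover have "(\<Sum>i\<in>I. ct i) \<le> (\<Sum>i\<in>I. c i)" using ct by (intro sum_mono)
    moreover have "0 \<le> (\<Prod>j\<in>J. max 1 (cmod (w j)))" by (intro prod_nonneg) auto
    ultimately show ?thesis using ct_pos
      by (simp add: le_divide_eq mult.commute mult_right_mono)
  qed
  ultimately show ?thesis by linarith
qed

text \<open>
  A power of \<open>x\<close> is a superposition, with positive weights, of the functions \<open>ln (max 1 (R * x))\<close>
  over all scales \<open>R\<close>. Products of factors \<open>max 1 (R * x)\<close> that are comparable at every scale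
  therefore give comparable power sums.
\<close>

lemma nn_integral_ln_max_powr:
  fixes x :: real
  assumes "0 \<le> x" "0 < m"
  shows "(\<integral>\<^sup>+R. ennreal (real m ^ 2 * ln (max 1 (R * x)) / R ^ (m + 1)) * indicator {0<..} R \<partial>lborel)
           = ennreal (x ^ m)"
proof (cases "x = 0")
  case False
  with assms have x: "0 < x" by simp
  define F where "F R = - (real m * ln (R * x) + 1) / R ^ m" for R
  define f where "f R = real m ^ 2 * ln (R * x) / R ^ (m + 1)" for R
  have "(\<integral>\<^sup>+R. ennreal (real m ^ 2 * ln (max 1 (R * x)) / R ^ (m + 1)) * indicator {0<..} R \<partial>lborel)
      = (\<integral>\<^sup>+R. ennreal (f R) * indicator {1/x..} R \<partial>lborel)"
  proof (rule nn_integral_cong)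
    fix R :: real
    show "ennreal (real m ^ 2 * ln (max 1 (R * x)) / R ^ (m + 1)) * indicator {0<..} R
        = ennreal (f R) * indicator {1/x..} R"
    proof (cases "1 / x \<le> R")
      case True
      then have "1 \<le> R * x" using x by (simp add: divide_le_eq)
      moreover have "0 < R" using True x by (meson divide_pos_pos less_le_trans zero_less_one)
      ultimately show ?thesis using True by (simp add: f_def max_def)
    next
      case False
      then have "R * x < 1" using x by (simp add: divide_le_eq not_le)
      then show ?thesis using False by (simp add: max_def)
    qed
  qed
  also have "\<dots> = ennreal (0 - F (1 / x))"
  proof (rule nn_integral_FTC_atLeast)
    show "f \<in> borel_measurable borel" unfolding f_def by measurable
    fix R assume R: "1 / x \<le> R"
    then have R0: "0 < R" using x by (meson divide_pos_pos less_le_trans zero_less_one)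
    have "1 \<le> R * x" using R x by (simp add: divide_le_eq)
    then show "0 \<le> f R" using R0 by (simp add: f_def)
    obtain m' where m': "m = Suc m'" using assms(2) by (cases m) auto
    have "DERIV (\<lambda>R. real m * ln (R * x) + 1) R :> real m * (x / (R * x))"
      using R0 x by (auto intro!: derivative_eq_intros)
    moreover have "DERIV (\<lambda>R. R ^ m) R :> real m * R ^ m'"
      using DERIV_pow[of m R] by (simp add: m')
    ultimately have "DERIV F R :> (- (real m * (x / (R * x))) * R ^ m
        - - (real m * ln (R * x) + 1) * (real m * R ^ m')) / (R ^ m * R ^ m)"
      unfolding F_def using R0 by (intro DERIV_divide DERIV_minus) auto
    also have "(- (real m * (x / (R * x))) * R ^ m
        - - (real m * ln (R * x) + 1) * (real m * R ^ m')) / (R ^ m * R ^ m) = f R"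
      using R0 x unfolding f_def m' by (simp add: field_simps power2_eq_square)
    finally show "DERIV F R :> f R" .
  next
    have "((\<lambda>R. - (real m * ln (R * x) + 1) / R powr real m) \<longlongrightarrow> 0) at_top"
      using x assms(2) by real_asymp
    moreover have "\<forall>\<^sub>F R in at_top. - (real m * ln (R * x) + 1) / R powr real m = F R"
      using eventually_gt_at_top[of 0] by eventually_elim (simp add: F_def powr_realpow)
    ultimately show "(F \<longlongrightarrow> 0) at_top" by (rule Lim_transform_eventually)
  qed
  also have "0 - F (1 / x) = x ^ m" using x by (simp add: F_def power_one_over)
  finally show ?thesis .
qed (use assms in simp)

text \<open>
  The exceptional set \<open>B\<close> makes room for the scales at which a pole lies on the unit circle.
\<close>

lemma sum_power_le_of_prod_max_le:
  fixes x :: "'j \<Rightarrow> real" and y :: "'i \<Rightarrow> real"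
  assumes fin: "finite I" "finite J" "finite B"
    and x: "\<And>j. j \<in> J \<Longrightarrow> 0 \<le> x j" and y: "\<And>i. i \<in> I \<Longrightarrow> 0 \<le> y i"
    and le: "\<And>R. 0 < R \<Longrightarrow> R \<notin> B \<Longrightarrow>
               (\<Prod>j\<in>J. max 1 (R * x j)) \<le> (\<Prod>i\<in>I. max 1 (R * y i))\<^sup>2"
    and m: "0 < m"
  shows "(\<Sum>j\<in>J. x j ^ m) \<le> 2 * (\<Sum>i\<in>I. y i ^ m)"
proof -
  define L where "L t R = ennreal (real m ^ 2 * ln (max 1 (R * t)) / R ^ (m + 1)) * indicator {0<..} R"
    for t R :: real
  have L_meas: "L t \<in> borel_measurable borel" for t
    unfolding L_def by measurable
  have L: "(\<integral>\<^sup>+R. L t R \<partial>lborel) = ennreal (t ^ m)" if "0 \<le> t" for t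
    unfolding L_def using that m by (rule nn_integral_ln_max_powr)
  have L_sum: "(\<Sum>k\<in>K. L (t k) R)
      = ennreal (real m ^ 2 * ln (\<Prod>k\<in>K. max 1 (R * t k)) / R ^ (m + 1)) * indicator {0<..} R"
    if "finite K" for K :: "'k set" and t R
  proof (cases "0 < R")
    case True
    have "ln (\<Prod>k\<in>K. max 1 (R * t k)) = (\<Sum>k\<in>K. ln (max 1 (R * t k)))"
      by (rule ln_prod) (use that in \<open>auto simp: max_def\<close>)
    moreover have "(\<Sum>k\<in>K. L (t k) R) = ennreal (\<Sum>k\<in>K. real m ^ 2 * ln (max 1 (R * t k)) / R ^ (m + 1))"
      using True by (simp add: L_def sum_ennreal)
    ultimately show ?thesis using True by (simp add: sum_distrib_left sum_divide_distrib)
  qed (simp add: L_def)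
  have scale: "ennreal (real m ^ 2 * a / R ^ (m + 1)) \<le> 2 * ennreal (real m ^ 2 * b / R ^ (m + 1))"
    if "a \<le> 2 * b" "0 < R" for a b R :: real
  proof -
    have "real m ^ 2 * a / R ^ (m + 1) \<le> real m ^ 2 * (2 * b) / R ^ (m + 1)"
      by (rule divide_right_mono[OF mult_left_mono[OF that(1)]]) (use that(2) in auto)
    also have "\<dots> = 2 * (real m ^ 2 * b / R ^ (m + 1))" by simp
    finally have "ennreal (real m ^ 2 * a / R ^ (m + 1)) \<le> ennreal (2 * (real m ^ 2 * b / R ^ (m + 1)))"
      by (rule ennreal_leI)
    also have "\<dots> = ennreal 2 * ennreal (real m ^ 2 * b / R ^ (m + 1))"
      by (rule ennreal_mult') simp
    finally show ?thesis by simp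
  qed
  have "ennreal (\<Sum>j\<in>J. x j ^ m) = (\<integral>\<^sup>+R. (\<Sum>j\<in>J. L (x j) R) \<partial>lborel)"
  proof -
    have "ennreal (\<Sum>j\<in>J. x j ^ m) = (\<Sum>j\<in>J. ennreal (x j ^ m))"
      by (rule sum_ennreal[symmetric]) (use x in auto)
    also have "\<dots> = (\<Sum>j\<in>J. \<integral>\<^sup>+R. L (x j) R \<partial>lborel)"
      using x by (intro sum.cong) (simp_all add: L)
    finally show ?thesis by (subst nn_integral_sum) (auto intro: L_meas)
  qed
  also have "\<dots> \<le> (\<integral>\<^sup>+R. 2 * (\<Sum>i\<in>I. L (y i) R) \<partial>lborel)"
  proof (rule nn_integral_mono_AE)
    have "AE R in lborel. R \<notin> B"
      using finite_imp_null_set_lborel[OF fin(3)] by (simp add: AE_not_in)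
    then show "AE R in lborel. (\<Sum>j\<in>J. L (x j) R) \<le> 2 * (\<Sum>i\<in>I. L (y i) R)"
    proof eventually_elim
      case (elim R)
      show ?case
      proof (cases "0 < R")
        case True
        have posx: "1 \<le> (\<Prod>j\<in>J. max 1 (R * x j))" by (intro prod_ge_1) auto
        have posy: "1 \<le> (\<Prod>i\<in>I. max 1 (R * y i))" by (intro prod_ge_1) auto
        have "ln (\<Prod>j\<in>J. max 1 (R * x j)) \<le> ln ((\<Prod>i\<in>I. max 1 (R * y i))\<^sup>2)"
          by (rule ln_mono[OF le[OF True elim]]) (use posx in linarith)
        also have "\<dots> = 2 * ln (\<Prod>i\<in>I. max 1 (R * y i))"
          using posy by (subst ln_realpow) simp_all
        finally have "ennreal (real m ^ 2 * ln (\<Prod>j\<in>J. max 1 (R * x j)) / R ^ (m + 1))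
            \<le> 2 * ennreal (real m ^ 2 * ln (\<Prod>i\<in>I. max 1 (R * y i)) / R ^ (m + 1))"
          by (rule scale[OF _ True])
        moreover have "indicator {0<..} R = (1 :: ennreal)" using True by simp
        ultimately show ?thesis
          unfolding L_sum[OF fin(2)] L_sum[OF fin(1)] by (simp only: mult_1_right)
      qed (simp add: L_def)
    qed
  qed
  also have "\<dots> = 2 * ennreal (\<Sum>i\<in>I. y i ^ m)"
  proof -
    have "ennreal (\<Sum>i\<in>I. y i ^ m) = (\<Sum>i\<in>I. ennreal (y i ^ m))"
      by (rule sum_ennreal[symmetric]) (use y in auto)
    also have "\<dots> = (\<Sum>i\<in>I. \<integral>\<^sup>+R. L (y i) R \<partial>lborel)"
      using y by (intro sum.cong) (simp_all add: L)
    also have "\<dots> = (\<integral>\<^sup>+R. (\<Sum>i\<in>I. L (y i) R) \<partial>lborel)"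
      by (subst nn_integral_sum) (auto intro: L_meas)
    finally show ?thesis
      by (subst nn_integral_cmult) (auto intro!: borel_measurable_sum L_meas)
  qed
  also have "\<dots> = ennreal (2 * (\<Sum>i\<in>I. y i ^ m))"
    by (simp add: ennreal_mult')
  finally show ?thesis
    using y by (subst (asm) ennreal_le_iff) (auto intro!: sum_nonneg)
qed

section \<open>Logarithmic derivatives of power series\<close>

definition fps_log_deriv :: "'a :: field fps \<Rightarrow> 'a fps" where
  "fps_log_deriv F = fps_deriv F * inverse F"

lemma fps_log_deriv_eqI:
  fixes F :: "'a :: field fps"
  assumes "F $ 0 \<noteq> 0" "fps_deriv F = G * F"
  shows "fps_log_deriv F = G"
  using assms by (simp add: fps_log_deriv_def mult.assoc inverse_mult_eq_1')

lemma fps_log_deriv_mult_self: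
  fixes F :: "'a :: field fps"
  assumes "F $ 0 \<noteq> 0"
  shows "fps_log_deriv F * F = fps_deriv F"
  using assms by (simp add: fps_log_deriv_def mult.assoc inverse_mult_eq_1)

lemma fps_log_deriv_mult:
  fixes F G :: "'a :: field fps"
  assumes "F $ 0 \<noteq> 0" "G $ 0 \<noteq> 0"
  shows "fps_log_deriv (F * G) = fps_log_deriv F + fps_log_deriv G"
proof (rule fps_log_deriv_eqI)
  have "fps_deriv (F * G) = F * (fps_log_deriv G * G) + fps_log_deriv F * F * G"
    using assms by (simp add: fps_log_deriv_mult_self)
  also have "\<dots> = (fps_log_deriv F + fps_log_deriv G) * (F * G)"
    by (simp only: distrib_right distrib_left mult_ac add_ac)
  finally show "fps_deriv (F * G) = (fps_log_deriv F + fps_log_deriv G) * (F * G)" .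
qed (use assms in simp)

lemma fps_log_deriv_prod:
  fixes F :: "'i \<Rightarrow> 'a :: field fps"
  assumes "finite I" "\<And>i. i \<in> I \<Longrightarrow> F i $ 0 \<noteq> 0"
  shows "fps_log_deriv (\<Prod>i\<in>I. F i) = (\<Sum>i\<in>I. fps_log_deriv (F i))"
  using assms
proof (induction I)
  case empty
  show ?case by (simp add: fps_log_deriv_def)
next
  case (insert i I)
  have "(\<Prod>i\<in>I. F i) $ 0 \<noteq> 0"
    using insert by (simp add: fps_prod_nth' )
  then show ?case using insert by (simp add: fps_log_deriv_mult)
qed

lemma fps_log_deriv_const_mult:
  fixes F :: "'a :: field fps"
  assumes "F $ 0 \<noteq> 0" "c \<noteq> 0"
  shows "fps_log_deriv (fps_const c * F) = fps_log_deriv F"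
  using assms fps_log_deriv_mult[of "fps_const c" F] by (simp add: fps_log_deriv_def)

lemma fps_mult_one_minus_const_X_nth:
  fixes A :: "'a :: comm_ring_1 fps"
  shows "(A * (1 - fps_const w * fps_X)) $ k = A $ k - (if k = 0 then 0 else w * A $ (k - 1))"
proof -
  have "A * (1 - fps_const w * fps_X) = A - fps_const w * (A * fps_X)"
    by (simp add: right_diff_distrib mult.left_commute)
  then show ?thesis by simp
qed

lemma fps_log_deriv_linear:
  fixes w :: "'a :: field"
  shows "fps_log_deriv (1 - fps_const w * fps_X) = Abs_fps (\<lambda>k. - (w ^ (k + 1)))"
proof (rule fps_log_deriv_eqI)
  show "fps_deriv (1 - fps_const w * fps_X) = Abs_fps (\<lambda>k. - (w ^ (k + 1))) * (1 - fps_const w * fps_X)"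
  proof (rule fps_ext)
    fix k show "fps_deriv (1 - fps_const w * fps_X) $ k
        = (Abs_fps (\<lambda>k. - (w ^ (k + 1))) * (1 - fps_const w * fps_X)) $ k"
      unfolding fps_mult_one_minus_const_X_nth by (cases k) simp_all
  qed
qed simp

text \<open>
  Factors \<open>1 - w * z\<close> are preferred to \<open>z - a\<close> because the logarithmic derivative of such a
  product has the power sums of the \<open>w j\<close> as its coefficients.
\<close>

lemma poly_factor_reciprocal_roots:
  fixes p :: "complex poly"
  assumes "poly p 0 \<noteq> 0"
  obtains w where "p = smult (poly p 0) (\<Prod>j<degree p. [:1, - w j:])"
proof -
  obtain r where r: "smult (lead_coeff p) (\<Prod>i<degree p. [:- r i, 1:]) = p"
    by (metis complex_poly_decompose')
  have "p \<noteq> 0" using assms by auto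
  have r0: "r i \<noteq> 0" if "i < degree p" for i
  proof
    assume "r i = 0"
    then have "poly (\<Prod>i<degree p. [:- r i, 1:]) 0 = 0"
      using that by (auto simp: poly_prod)
    then show False using assms by (metis r mult_zero_right poly_smult)
  qed
  have "[:- r i, 1:] = smult (- r i) [:1, - (1 / r i):]" if "i < degree p" for i
    using r0[OF that] by simp
  then have "p = smult (lead_coeff p) (\<Prod>i<degree p. smult (- r i) [:1, - (1 / r i):])"
    by (subst r[symmetric]) (intro arg_cong[where f="smult _"] prod.cong, auto)
  then have p: "p = smult (lead_coeff p * (\<Prod>i<degree p. - r i)) (\<Prod>i<degree p. [:1, - (1 / r i):])"
    unfolding prod_smult smult_smult .
  then have "poly p 0 = lead_coeff p * (\<Prod>i<degree p. - r i) * poly (\<Prod>i<degree p. [:1, - (1 / r i):]) 0"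
    by (metis poly_smult)
  then have "poly p 0 = lead_coeff p * (\<Prod>i<degree p. - r i)"
    by (simp add: poly_prod)
  then show ?thesis using p that[of "\<lambda>i. 1 / r i"] by metis
qed

text \<open>
  The series is the expansion of \<open>\<Sum>i\<in>I. c i / (1 - q i * z)\<^sup>2\<close>, a mixture of generating functions
  of negative binomial laws of order two. As a quotient of products of linear factors it has a
  logarithmic derivative with coefficients \<open>2 * (\<Sum>i\<in>I. q i ^ (k + 1)) - (\<Sum>j\<in>J. w j ^ (k + 1))\<close>,
  and the two power sums are compared by rescaling \<open>prod_max_roots_le\<close>.
\<close>

lemma fps_log_deriv_nb2_mixture_nonneg:
  fixes c q :: "'i \<Rightarrow> real"
  assumes fin: "finite I"
    and c: "\<And>i. i \<in> I \<Longrightarrow> 0 \<le> c i" and c_pos: "0 < (\<Sum>i\<in>I. c i)"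
    and q: "\<And>i. i \<in> I \<Longrightarrow> 0 \<le> q i"
  shows "0 \<le> fps_log_deriv (Abs_fps (\<lambda>k. \<Sum>i\<in>I. c i * (real k + 1) * q i ^ k)) $ k"
proof -
  define d where "d i = [:1, - complex_of_real (q i):]^2" for i
  define N where "N = (\<Sum>i\<in>I. smult (complex_of_real (c i)) (\<Prod>l\<in>I-{i}. d l))"
  have d_eval: "poly (d i) z = (1 - complex_of_real (q i) * z)\<^sup>2" for i z
    by (simp add: d_def mult.commute)
  have N_eval: "poly N z = (\<Sum>i\<in>I. of_real (c i) * (\<Prod>l\<in>I-{i}. (1 - of_real (q l) * z)\<^sup>2))" for z
    by (simp add: N_def poly_sum poly_prod d_eval)
  have N0: "poly N 0 = of_real (\<Sum>i\<in>I. c i)" by (simp add: N_eval)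
  then have "poly N 0 \<noteq> 0" using c_pos by (metis less_irrefl of_real_eq_0_iff)
  then obtain w where w: "N = smult (poly N 0) (\<Prod>j<degree N. [:1, - w j:])"
    by (rule poly_factor_reciprocal_roots)
  define J where "J = {..<degree N}"
  have fact: "(\<Sum>i\<in>I. of_real (c i) * (\<Prod>l\<in>I-{i}. (1 - of_real (q l) * z)\<^sup>2))
                  = of_real (\<Sum>i\<in>I. c i) * (\<Prod>j\<in>J. 1 - w j * z)" for z
  proof -
    have "poly N z = poly N 0 * poly (\<Prod>j<degree N. [:1, - w j:]) z"
      using arg_cong[OF w, of "\<lambda>p. poly p z"] by (simp only: poly_smult)
    also have "\<dots> = of_real (\<Sum>i\<in>I. c i) * (\<Prod>j\<in>J. 1 - w j * z)"
      unfolding N0 by (simp add: poly_prod J_def mult.commute)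
    finally show ?thesis unfolding N_eval .
  qed
  have power_sums: "(\<Sum>j\<in>J. cmod (w j) ^ (k + 1)) \<le> 2 * (\<Sum>i\<in>I. q i ^ (k + 1))"
  proof (rule sum_power_le_of_prod_max_le[where B = "(\<lambda>i. 1 / q i) ` I"])
    fix R :: real assume R: "0 < R" "R \<notin> (\<lambda>i. 1 / q i) ` I"
    have "R * q i \<noteq> 1" if "i \<in> I" for i
    proof
      assume "R * q i = 1"
      then have "R = 1 / q i" by (cases "q i = 0") (simp_all add: eq_divide_eq)
      then show False using R(2) that by auto
    qed
    moreover have "(\<Sum>i\<in>I. of_real (c i) * (\<Prod>l\<in>I-{i}. (1 - of_real (R * q l) * z)\<^sup>2))
                  = of_real (\<Sum>i\<in>I. c i) * (\<Prod>j\<in>J. 1 - of_real R * w j * z)" for z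
      using fact[of "of_real R * z"] by (simp add: mult_ac)
    ultimately have "(\<Prod>j\<in>J. max 1 (cmod (of_real R * w j))) \<le> (\<Prod>i\<in>I. max 1 (R * q i))\<^sup>2"
      using fin c c_pos q R by (intro prod_max_roots_le[where c = c]) (auto simp: J_def)
    then show "(\<Prod>j\<in>J. max 1 (R * cmod (w j))) \<le> (\<Prod>i\<in>I. max 1 (R * q i))\<^sup>2"
      using R by (simp add: norm_mult)
  qed (use fin q in \<open>auto simp: J_def\<close>)
  define F where "F = Abs_fps (\<lambda>k. \<Sum>i\<in>I. c i * (real k + 1) * q i ^ k)"
  define Fc where "Fc = Abs_fps (\<lambda>k. complex_of_real (F $ k))"
  have F0: "F $ 0 = (\<Sum>i\<in>I. c i)" by (simp add: F_def)
  then have F0': "F $ 0 \<noteq> 0" "Fc $ 0 \<noteq> 0"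
    using c_pos by (auto simp: Fc_def simp flip: of_real_sum)
  define l where "l i = 1 - fps_const (complex_of_real (q i)) * fps_X" for i
  have l0: "l i $ 0 = 1" for i by (simp add: l_def)
  have geom: "Abs_fps (\<lambda>k. of_nat (k + 1) * complex_of_real (q i) ^ k) * (l i)\<^sup>2 = 1" for i
  proof -
    have 1: "Abs_fps (\<lambda>k. of_nat (k + 1) * complex_of_real (q i) ^ k) * l i
        = Abs_fps (\<lambda>k. complex_of_real (q i) ^ k)"
    proof (rule fps_ext)
      fix k show "(Abs_fps (\<lambda>k. of_nat (k + 1) * complex_of_real (q i) ^ k) * l i) $ k
        = Abs_fps (\<lambda>k. complex_of_real (q i) ^ k) $ k"
        unfolding l_def fps_mult_one_minus_const_X_nth by (cases k) (simp_all add: algebra_simps)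
    qed
    have 2: "Abs_fps (\<lambda>k. complex_of_real (q i) ^ k) * l i = 1"
    proof (rule fps_ext)
      fix k show "(Abs_fps (\<lambda>k. complex_of_real (q i) ^ k) * l i) $ k = 1 $ k"
        unfolding l_def fps_mult_one_minus_const_X_nth by (cases k) simp_all
    qed
    show ?thesis using 1 2 by (simp add: power2_eq_square flip: mult.assoc)
  qed
  define D where "D = (\<Prod>i\<in>I. l i * l i)"
  have D0: "D $ 0 \<noteq> 0"
    using fin by (simp add: D_def fps_prod_nth' l0)
  have d_fps: "fps_of_poly (d i) = l i * l i" for i
    by (simp add: d_def l_def fps_of_poly_power fps_of_poly_pCons power2_eq_square
        fps_const_neg[symmetric] del: fps_const_neg)
  have FD: "Fc * D = fps_of_poly N"
  proof -
    have "Fc = (\<Sum>i\<in>I. fps_const (of_real (c i)) * Abs_fps (\<lambda>k. of_nat (k + 1) * complex_of_real (q i) ^ k))"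
      by (simp add: fps_eq_iff Fc_def F_def fps_sum_nth algebra_simps)
    then have "Fc * D = (\<Sum>i\<in>I. fps_const (of_real (c i)) * Abs_fps (\<lambda>k. of_nat (k + 1) * complex_of_real (q i) ^ k) * D)"
      by (simp only: sum_distrib_right)
    also have "\<dots> = (\<Sum>i\<in>I. fps_const (of_real (c i)) * (\<Prod>l\<in>I-{i}. fps_of_poly (d l)))"
    proof (rule sum.cong[OF refl])
      fix i assume i: "i \<in> I"
      have "Abs_fps (\<lambda>k. of_nat (k + 1) * complex_of_real (q i) ^ k) * D
          = Abs_fps (\<lambda>k. of_nat (k + 1) * complex_of_real (q i) ^ k) * (l i)\<^sup>2 * (\<Prod>l\<in>I-{i}. fps_of_poly (d l))"
        unfolding D_def d_fps using fin i
        by (simp add: prod.remove[OF fin i] power2_eq_square mult.assoc)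
      then show "fps_const (of_real (c i)) * Abs_fps (\<lambda>k. of_nat (k + 1) * complex_of_real (q i) ^ k) * D
          = fps_const (of_real (c i)) * (\<Prod>l\<in>I-{i}. fps_of_poly (d l))"
        by (simp only: geom mult.assoc mult_1)
    qed
    also have "\<dots> = fps_of_poly N"
      by (simp add: N_def fps_of_poly_sum fps_of_poly_smult fps_of_poly_prod)
    finally show ?thesis .
  qed
  have N_fps: "fps_of_poly N = fps_const (poly N 0) * (\<Prod>j\<in>J. 1 - fps_const (w j) * fps_X)"
    by (subst w) (simp add: fps_of_poly_smult fps_of_poly_prod fps_of_poly_pCons J_def
        fps_const_neg[symmetric] del: fps_const_neg)
  have "fps_log_deriv Fc + fps_log_deriv D = fps_log_deriv (fps_of_poly N)"
    using fps_log_deriv_mult[OF F0'(2) D0] FD by simp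
  also have "\<dots> = (\<Sum>j\<in>J. Abs_fps (\<lambda>k. - (w j ^ (k + 1))))"
    unfolding N_fps using \<open>poly N 0 \<noteq> 0\<close>
    by (subst fps_log_deriv_const_mult)
      (auto simp: fps_prod_nth' J_def fps_log_deriv_prod fps_log_deriv_linear)
  finally have "fps_log_deriv Fc = (\<Sum>j\<in>J. Abs_fps (\<lambda>k. - (w j ^ (k + 1)))) - fps_log_deriv D"
    by (simp add: algebra_simps)
  also have "fps_log_deriv D = (\<Sum>i\<in>I. 2 * Abs_fps (\<lambda>k. - (complex_of_real (q i) ^ (k + 1))))"
    unfolding D_def using fin
    by (subst fps_log_deriv_prod)
      (auto simp: l0 fps_log_deriv_mult l_def fps_log_deriv_linear intro!: sum.cong)
  finally have Fc_k: "fps_log_deriv Fc $ k = 2 * (\<Sum>i\<in>I. complex_of_real (q i) ^ (k + 1)) - (\<Sum>j\<in>J. w j ^ (k + 1))"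
    by (simp add: fps_sum_nth sum_negf sum_distrib_left numeral_fps_const)
  have "Abs_fps (\<lambda>k. complex_of_real (fps_log_deriv F $ k)) * Fc = fps_deriv Fc"
  proof (rule fps_ext)
    fix k
    have "(\<Sum>i=0..k. fps_log_deriv F $ i * F $ (k - i)) = of_nat (k + 1) * F $ (k + 1)"
      using fps_log_deriv_mult_self[OF F0'(1)]
      by (metis fps_mult_nth fps_deriv_nth)
    from arg_cong[OF this, of complex_of_real]
    show "(Abs_fps (\<lambda>k. complex_of_real (fps_log_deriv F $ k)) * Fc) $ k = fps_deriv Fc $ k"
      by (simp add: fps_mult_nth Fc_def)
  qed
  then have "fps_log_deriv Fc = Abs_fps (\<lambda>k. complex_of_real (fps_log_deriv F $ k))"
    by (intro fps_log_deriv_eqI F0') simp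
  then have "fps_log_deriv F $ k = Re (fps_log_deriv Fc $ k)" by simp
  also have "\<dots> = 2 * (\<Sum>i\<in>I. q i ^ (k + 1)) - Re (\<Sum>j\<in>J. w j ^ (k + 1))"
    unfolding Fc_k by (simp flip: of_real_power of_real_sum)
  finally have "fps_log_deriv F $ k = 2 * (\<Sum>i\<in>I. q i ^ (k + 1)) - Re (\<Sum>j\<in>J. w j ^ (k + 1))" .
  moreover have "Re (\<Sum>j\<in>J. w j ^ (k + 1)) \<le> (\<Sum>j\<in>J. cmod (w j) ^ (k + 1))"
    by (rule order_trans[OF complex_Re_le_cmod order_trans[OF norm_sum]]) (simp add: norm_power norm_mult)
  ultimately have "0 \<le> fps_log_deriv F $ k" using power_sums by linarith
  then show ?thesis unfolding F_def .
qed

section \<open>A Stieltjes representation\<close>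

lemma has_contour_integral_linepath_same_Im_iff:
  assumes "a < b"
  shows "(f has_contour_integral I) (linepath (of_real a + of_real c * \<i>) (of_real b + of_real c * \<i>))
           \<longleftrightarrow> ((\<lambda>x. f (of_real x + of_real c * \<i>)) has_integral I) {a..b}"
proof -
  have "(f has_contour_integral I) (linepath (of_real a + of_real c * \<i>) (of_real b + of_real c * \<i>))
      \<longleftrightarrow> ((\<lambda>v. f (v + of_real c * \<i>)) has_contour_integral I) (linepath (of_real a) (of_real b))"
    unfolding has_contour_integral_linepath
    by (simp add: linepath_def algebra_simps)
  also have "\<dots> \<longleftrightarrow> ((\<lambda>x. f (of_real x + of_real c * \<i>)) has_integral I) {a..b}"
    using assms by (subst has_contour_integral_linepath_Reals_iff) auto
  finally show ?thesis .
qed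

text \<open>
  With \<open>f z = z powr (1 - r) / (1 + z powr r)\<close>, this is the jump
  \<open>f (- t - \<i> * 0) - f (- t + \<i> * 0)\<close> across the negative real axis, divided by \<open>2 * pi * \<i>\<close>.
\<close>

definition stieltjes_weight :: "real \<Rightarrow> real \<Rightarrow> real" where
  "stieltjes_weight r t = - sin (pi * r) / pi * t powr (1 - r) * (1 + 2 * cos (pi * r) * t powr r)
     / (1 + 2 * cos (pi * r) * t powr r + (t powr r)\<^sup>2)"

lemma
  assumes r: "3/2 < r" "r < 2"
  shows sin_pi_r_neg: "sin (pi * r) < 0" and cos_pi_r_pos: "0 < cos (pi * r)"
proof -
  have "0 < sin (pi * (2 - r))" "0 < cos (pi * (2 - r))"
    using r by (auto intro!: sin_gt_zero cos_gt_zero simp: algebra_simps)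
  moreover have "sin (pi * (2 - r)) = - sin (pi * r)" "cos (pi * (2 - r)) = cos (pi * r)"
    using sin_2pi_minus[of "pi * r"] cos_2pi_minus[of "pi * r"] by (simp_all add: algebra_simps)
  ultimately show "sin (pi * r) < 0" "0 < cos (pi * r)" by auto
qed

text \<open>
  It is the range \<open>3/2 < r < 2\<close> that makes \<open>sin (pi * r)\<close> negative and \<open>cos (pi * r)\<close> positive.
\<close>

lemma stieltjes_weight_nonneg:
  assumes "3/2 < r" "r < 2"
  shows "0 \<le> stieltjes_weight r t"
proof -
  have "0 \<le> cos (pi * r) * t powr r" "0 \<le> - sin (pi * r)"
    using sin_pi_r_neg[OF assms] cos_pi_r_pos[OF assms] by auto
  then show ?thesis
    unfolding stieltjes_weight_def using cos_pi_r_pos[OF assms]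
    by (intro divide_nonneg_nonneg mult_nonneg_nonneg add_nonneg_nonneg) auto
qed

text \<open>
  The differential \<open>f z / (z - x) dz\<close> in the coordinate \<open>v = ln z\<close>. The plane cut along the
  negative real axis becomes the strip \<open>\<bar>Im v\<bar> < pi\<close>, its two banks become the edges of the strip,
  and the integrand is meromorphic in the whole plane, so no branch of a power has to be
  discussed.
\<close>

definition strip_fun :: "real \<Rightarrow> real \<Rightarrow> complex \<Rightarrow> complex" where
  "strip_fun r x v = exp (of_real (2 - r) * v) / ((1 + exp (of_real r * v)) * (exp v - of_real x))"

lemma strip_fun_cnj: "strip_fun r x (cnj v) = cnj (strip_fun r x v)"
  by (simp only: strip_fun_def complex_cnj_divide complex_cnj_mult complex_cnj_add complex_cnj_diff
      complex_cnj_one complex_cnj_complex_of_real exp_cnj)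

lemma Im_strip_fun_edge:
  assumes r: "3/2 < r" "r < 2" and x: "0 < x"
  shows "Im (strip_fun r x (of_real u + of_real pi * \<i>))
           = - pi * (stieltjes_weight r (exp u) * exp u / (x + exp u))"
proof -
  define t where "t = exp u"
  define y where "y = t powr r"
  define S C where "S = sin (pi * r)" and "C = cos (pi * r)"
  have t: "0 < t" by (simp add: t_def)
  have y: "0 < y" using t by (simp add: y_def)
  have C: "0 < C" using cos_pi_r_pos[OF r] by (simp add: C_def)
  have SC: "S\<^sup>2 + C\<^sup>2 = 1" by (simp add: S_def C_def)
  have e1: "exp (of_real u + of_real pi * \<i>) = of_real (- t)"
    by (simp add: exp_add t_def mult.commute flip: exp_of_real)
  have yexp: "y = exp (r * u)" by (simp add: y_def t_def powr_def)
  have e2: "exp (of_real r * (of_real u + of_real pi * \<i>)) = of_real y * Complex C S"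
    unfolding distrib_left exp_add yexp C_def S_def
    by (simp add: cis_conv_exp[symmetric] cis.ctr[symmetric] mult_ac flip: exp_of_real)
       (simp add: complex_eq_iff exp_of_real[symmetric] exp_eq_polar)
  have e3: "exp (of_real (2 - r) * (of_real u + of_real pi * \<i>)) = of_real (t\<^sup>2 / y) * Complex C (- S)"
  proof -
    have "exp (of_real (2 - r) * (of_real u + of_real pi * \<i>))
        = (exp (of_real u + of_real pi * \<i>))\<^sup>2 / exp (of_real r * (of_real u + of_real pi * \<i>))"
      by (simp add: exp_diff[symmetric] exp_double[symmetric] algebra_simps)
    also have "\<dots> = of_real (t\<^sup>2) / (of_real y * Complex C S)" unfolding e1 e2 by simp
    also have "\<dots> = of_real (t\<^sup>2 / y) * (1 / Complex C S)" by simp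
    also have "1 / Complex C S = Complex C (- S)"
      using SC by (simp add: complex_eq_iff Re_divide Im_divide power2_eq_square)
         (simp add: add.commute)
    finally show ?thesis .
  qed
  have den: "1 + 2 * C * y + y\<^sup>2 > 0" using C y by (simp add: add_pos_pos)
  have "Im (Complex C (- S) / (1 + of_real y * Complex C S)) = - S * (1 + 2 * C * y) / (1 + 2 * C * y + y\<^sup>2)"
  proof -
    have *: "(1 + y * C)\<^sup>2 + (y * S)\<^sup>2 = 1 + 2 * C * y + y\<^sup>2"
    proof -
      have "(1 + y * C)\<^sup>2 + (y * S)\<^sup>2 = 1 + 2 * C * y + y\<^sup>2 * (S\<^sup>2 + C\<^sup>2)" by algebra
      then show ?thesis unfolding SC by simp
    qed
    have "Im (Complex C (- S) / (1 + of_real y * Complex C S))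
        = ((- S) * (1 + y * C) - C * (y * S)) / ((1 + y * C)\<^sup>2 + (y * S)\<^sup>2)"
      by (simp add: Im_divide)
    also have "(- S) * (1 + y * C) - C * (y * S) = - S * (1 + 2 * C * y)" by algebra
    finally show ?thesis unfolding * .
  qed
  then have ImC: "Im (of_real a * (Complex C (- S) / (1 + of_real y * Complex C S)))
      = a * (- S * (1 + 2 * C * y) / (1 + 2 * C * y + y\<^sup>2))" for a
  proof -
    assume "Im (Complex C (- S) / (1 + of_real y * Complex C S)) = - S * (1 + 2 * C * y) / (1 + 2 * C * y + y\<^sup>2)"
    moreover have "Im (of_real a * w) = a * Im w" for w by simp
    ultimately show ?thesis by (simp only:)
  qed
  have "strip_fun r x (of_real u + of_real pi * \<i>)
      = of_real (- (t\<^sup>2 / y) / (t + x)) * (Complex C (- S) / (1 + of_real y * Complex C S))"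
  proof -
    have "of_real (- t) - of_real x = (- of_real (t + x) :: complex)" by simp
    moreover have "a * b / (d * - e) = - a / e * (b / d)" for a b d e :: complex by simp
    ultimately show ?thesis unfolding strip_fun_def e1 e2 e3 by (simp only: of_real_divide of_real_minus)
  qed
  then have "Im (strip_fun r x (of_real u + of_real pi * \<i>))
      = - (t\<^sup>2 / y) / (t + x) * (- S * (1 + 2 * C * y) / (1 + 2 * C * y + y\<^sup>2))"
    by (simp only: ImC)
  also have "\<dots> = - pi * (- S / pi * (t / y) * (1 + 2 * C * y) / (1 + 2 * C * y + y\<^sup>2) * t / (x + t))"
  proof -
    have "- (t\<^sup>2 / y) / (t + x) * (- S * n / d) = - pi * (- S / pi * (t / y) * n / d * t / (x + t))" for n d
      by (simp add: power2_eq_square add.commute[of x t] mult_ac)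
    then show ?thesis .
  qed
  also have "t / y = t powr (1 - r)" using t by (simp add: y_def powr_diff)
  finally show ?thesis unfolding stieltjes_weight_def t_def[symmetric] y_def S_def C_def .
qed

text \<open>
  The bounds on \<open>Im v\<close> exceed \<open>pi\<close> because the poles have to be located in a neighbourhood of the
  closed strip.
\<close>

lemma strip_fun_zeros:
  assumes r: "3/2 < r" "r < 2" and x: "0 < x"
  shows "1 + exp (of_real r * v) = 0 \<Longrightarrow> \<bar>Im v\<bar> < 3 * pi / 2
           \<Longrightarrow> v = of_real (pi / r) * \<i> \<or> v = - (of_real (pi / r) * \<i>)"
    and "exp v = of_real x \<Longrightarrow> \<bar>Im v\<bar> < 2 * pi \<Longrightarrow> v = of_real (ln x)"
proof -
  assume v: "1 + exp (of_real r * v) = 0" "\<bar>Im v\<bar> < 3 * pi / 2"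
  then have "exp (of_real r * v) = exp (of_real pi * \<i>)"
    by (simp add: add_eq_0_iff)
  then obtain n :: int where "of_real r * v = of_real pi * \<i> + (of_int (2 * n) * pi) * \<i>"
    unfolding exp_eq by blast
  then have n: "r * Re v = 0" "r * Im v = (2 * of_int n + 1) * pi"
    by (auto simp: complex_eq_iff algebra_simps)
  have "\<bar>r * Im v\<bar> < 2 * (3 * pi / 2)"
    unfolding abs_mult using r v(2) by (intro mult_strict_mono) auto
  then have "\<bar>2 * of_int n + 1 :: real\<bar> * pi < 3 * pi"
    unfolding n by (simp add: abs_mult)
  then have "\<bar>2 * of_int n + 1 :: real\<bar> < 3" by simp
  then have "\<bar>2 * n + 1\<bar> < 3" by linarith
  then have "n = 0 \<or> n = -1" by linarith
  then show "v = of_real (pi / r) * \<i> \<or> v = - (of_real (pi / r) * \<i>)"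
    using n r by (auto simp: complex_eq_iff field_simps)
next
  assume v: "exp v = of_real x" "\<bar>Im v\<bar> < 2 * pi"
  then have "exp v = exp (of_real (ln x))" using x by (simp add: exp_of_real)
  then obtain n :: int where n: "v = of_real (ln x) + (of_int (2 * n) * pi) * \<i>"
    unfolding exp_eq by blast
  then have "\<bar>2 * of_int n * pi\<bar> < 2 * pi" using v(2) by simp
  then have "\<bar>of_int n :: real\<bar> < 1" by (simp add: abs_mult)
  then have "n = 0" by linarith
  then show "v = of_real (ln x)" using n by simp
qed

lemma open_convex_strip:
  "open ({v. Im v < b} \<inter> {v. a < Im v})" "convex ({v. Im v < b} \<inter> {v. a < Im v})"
  by (intro open_Int convex_Int open_halfspace_Im_lt open_halfspace_Im_gt
        convex_halfspace_Im_lt convex_halfspace_Im_gt)+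

lemma residue_strip_fun_ln:
  assumes r: "3/2 < r" "r < 2" and x: "0 < x"
  shows "residue (strip_fun r x) (of_real (ln x)) = of_real (x powr (1 - r) / (1 + x powr r))"
proof -
  define S where "S = {v. Im v < pi / 2} \<inter> {v. - (pi / 2) < Im v}"
  have nz: "1 + exp (of_real r * v) \<noteq> 0" if "v \<in> S" for v
  proof
    assume "1 + exp (of_real r * v) = 0"
    moreover have "\<bar>Im v\<bar> < pi / 2" using that by (auto simp: S_def)
    moreover have "\<bar>Im v\<bar> < 3 * pi / 2" using \<open>\<bar>Im v\<bar> < pi / 2\<close> pi_gt_zero by linarith
    ultimately have "v = of_real (pi / r) * \<i> \<or> v = - (of_real (pi / r) * \<i>)"
      by (intro strip_fun_zeros(1)[OF r x])
    then have "Im v = pi / r \<or> Im v = - (pi / r)" by auto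
    then have "\<bar>Im v\<bar> = pi / r" using r by auto
    moreover have "pi / 2 < pi / r" using r by (simp add: field_simps)
    ultimately show False using \<open>\<bar>Im v\<bar> < pi / 2\<close> by linarith
  qed
  have S: "open S" "connected S" "of_real (ln x) \<in> S"
    unfolding S_def by (rule open_convex_strip convex_connected)+ simp
  have "residue (\<lambda>v. exp (of_real (2 - r) * v) / (1 + exp (of_real r * v)) / (exp v - of_real x)) (of_real (ln x))
      = exp (of_real (2 - r) * of_real (ln x)) / (1 + exp (of_real r * of_real (ln x))) / of_real x"
  proof (rule residue_simple_pole_deriv[where s = S])
    show "((\<lambda>v. exp v - of_real x) has_field_derivative of_real x) (at (of_real (ln x)))"
      using x by (auto intro!: derivative_eq_intros simp: exp_of_real)
    show "exp (of_real (2 - r) * of_real (ln x)) / (1 + exp (of_real r * of_real (ln x))) \<noteq> (0::complex)"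
      using nz[OF S(3)] by simp
  qed (use S nz x in \<open>auto intro!: holomorphic_intros simp: exp_of_real\<close>)
  also have "\<dots> = of_real (exp ((2 - r) * ln x) / (1 + exp (r * ln x)) / x)"
    by (simp only: of_real_divide of_real_add of_real_1 exp_of_real[symmetric] of_real_mult)
  also have "exp ((2 - r) * ln x) / (1 + exp (r * ln x)) / x = x powr (1 - r) / (1 + x powr r)"
  proof -
    have "exp ((2 - r) * ln x) = x powr (1 - r) * x"
    proof -
      have "exp ((2 - r) * ln x) = exp ((1 - r) * ln x) * exp (ln x)"
        by (subst exp_add[symmetric]) (simp add: algebra_simps)
      then show ?thesis using x by (simp add: powr_def)
    qed
    then show ?thesis using x by (simp add: powr_def)
  qed
  finally show ?thesis by (simp add: strip_fun_def[abs_def])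
qed

lemma residue_strip_fun_root:
  assumes r: "3/2 < r" "r < 2" and x: "0 < x" and \<sigma>: "\<sigma> = 1 \<or> \<sigma> = -1"
  shows "residue (strip_fun r x) (of_real (\<sigma> * (pi / r)) * \<i>)
           = cis (\<sigma> * (pi / r)) ^ 2 / (cis (\<sigma> * (pi / r)) - of_real x) / of_real r"
proof -
  define S where "S = {v. Im v < (\<sigma> + 1) * pi} \<inter> {v. (\<sigma> - 1) * pi < Im v}"
  define p where "p = of_real (\<sigma> * (pi / r)) * \<i>"
  define \<xi> where "\<xi> = cis (\<sigma> * (pi / r))"
  have nz: "exp v \<noteq> of_real x" if "v \<in> S" for v
  proof
    assume "exp v = of_real x"
    moreover have "\<bar>Im v\<bar> < 2 * pi" using that \<sigma> by (auto simp: S_def)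
    ultimately have "v = of_real (ln x)" using strip_fun_zeros(2)[OF r x, of v] by auto
    then show False using that \<sigma> by (auto simp: S_def)
  qed
  have p: "exp p = \<xi>" "exp (of_real r * p) = -1"
  proof -
    show "exp p = \<xi>" by (simp add: p_def \<xi>_def cis_conv_exp mult.commute)
    have "of_real r * p = of_real (\<sigma> * pi) * \<i>" using r by (simp add: p_def)
    then show "exp (of_real r * p) = -1" using \<sigma> by (auto simp: exp_minus)
  qed
  have e: "exp (of_real (2 - r) * p) = - (\<xi>\<^sup>2)"
  proof -
    have "exp (of_real (2 - r) * p) = (exp p)\<^sup>2 / exp (of_real r * p)"
      by (simp add: exp_diff[symmetric] exp_double[symmetric] algebra_simps)
    then show ?thesis unfolding p by simp
  qed
  have S: "open S" "connected S" "p \<in> S"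
  proof -
    show "p \<in> S" using \<sigma> r by (auto simp: S_def p_def field_simps)
  qed (unfold S_def, (rule open_convex_strip convex_connected)+)
  have "residue (\<lambda>v. exp (of_real (2 - r) * v) / (exp v - of_real x) / (1 + exp (of_real r * v))) p
      = exp (of_real (2 - r) * p) / (exp p - of_real x) / (- of_real r)"
  proof (rule residue_simple_pole_deriv[where s = S])
    show "((\<lambda>v. 1 + exp (of_real r * v)) has_field_derivative - of_real r) (at p)"
      using p by (auto intro!: derivative_eq_intros)
    show "exp (of_real (2 - r) * p) / (exp p - of_real x) \<noteq> 0"
      using nz[OF S(3)] by simp
  qed (use S nz r p in \<open>auto intro!: holomorphic_intros\<close>)
  also have "\<dots> = \<xi>\<^sup>2 / (\<xi> - of_real x) / of_real r"
    unfolding e p by simp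
  finally show ?thesis by (simp add: strip_fun_def[abs_def] p_def \<xi>_def mult.commute)
qed

text \<open>
  These expressions bound the integrand on the right and on the left side of the rectangle
  \<open>\<bar>Re v\<bar> \<le> T\<close>, \<open>\<bar>Im v\<bar> \<le> pi\<close>.
\<close>

lemma tendsto_strip_fun_side_bounds:
  fixes r x :: real
  assumes r: "3/2 < r" "r < 2" and x: "0 < x"
  shows "((\<lambda>T. exp ((2 - r) * T) / ((exp (r * T) - 1) * (exp T - x))) \<longlongrightarrow> 0) at_top"
    and "((\<lambda>T. exp (- ((2 - r) * T)) / ((1 - exp (- (r * T))) * (x - exp (- T)))) \<longlongrightarrow> 0) at_top"
proof -
  have E: "((\<lambda>T. exp (- (a * T))) \<longlongrightarrow> 0) at_top" if "0 < a" for a :: real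
    using that by real_asymp
  have "((\<lambda>T. exp (- ((2 * r - 1) * T)) / ((1 - exp (- (r * T))) * (1 - x * exp (- (1 * T)))))
      \<longlongrightarrow> 0 / ((1 - 0) * (1 - x * 0))) at_top"
    using r by (intro tendsto_intros E) auto
  moreover have "exp (- ((2 * r - 1) * T)) / ((1 - exp (- (r * T))) * (1 - x * exp (- (1 * T))))
      = exp ((2 - r) * T) / ((exp (r * T) - 1) * (exp T - x))" for T
  proof -
    have "exp (r * T) - 1 = exp (r * T) * (1 - exp (- (r * T)))" "exp T - x = exp T * (1 - x * exp (- (1 * T)))"
      by (simp_all add: right_diff_distrib exp_minus)
    moreover have "exp ((2 - r) * T) = exp (r * T) * exp T * exp (- ((2 * r - 1) * T))"
      by (simp add: exp_add[symmetric] algebra_simps)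
    ultimately show ?thesis by (simp only:) simp
  qed
  ultimately show "((\<lambda>T. exp ((2 - r) * T) / ((exp (r * T) - 1) * (exp T - x))) \<longlongrightarrow> 0) at_top"
    by simp
  have "((\<lambda>T. exp (- ((2 - r) * T)) / ((1 - exp (- (r * T))) * (x - exp (- (1 * T)))))
      \<longlongrightarrow> 0 / ((1 - 0) * (x - 0))) at_top"
    using r x by (intro tendsto_intros E) auto
  then show "((\<lambda>T. exp (- ((2 - r) * T)) / ((1 - exp (- (r * T))) * (x - exp (- T)))) \<longlongrightarrow> 0) at_top"
    by simp
qed

text \<open>
  The residue theorem for the rectangle \<open>\<bar>Re v\<bar> \<le> T\<close>, \<open>\<bar>Im v\<bar> \<le> pi\<close>. The values on the lower edge
  are conjugate to those on the upper edge, so the horizontal edges together see just the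
  imaginary part, which is the Stieltjes weight. The vertical edges have length \<open>2 * pi\<close>, which
  cancels the normalisation \<open>1 / (2 * pi)\<close> and leaves the errors \<open>B T\<close> and \<open>B' T\<close>.
\<close>

lemma strip_fun_edge_integral:
  assumes r: "3/2 < r" "r < 2" and x: "0 < x" and T: "\<bar>ln x\<bar> < T"
  defines "G \<equiv> \<lambda>u. stieltjes_weight r (exp u) * exp u / (x + exp u)"
    and "\<xi> \<equiv> cis (pi / r)"
    and "B \<equiv> \<lambda>T. exp ((2 - r) * T) / ((exp (r * T) - 1) * (exp T - x))"
    and "B' \<equiv> \<lambda>T. exp (- ((2 - r) * T)) / ((1 - exp (- (r * T))) * (x - exp (- T)))"
  shows "G integrable_on {-T..T}"
    and "\<bar>integral {-T..T} G - (x powr (1 - r) / (1 + x powr r) - 2 / r * Re (\<xi>\<^sup>2 / (of_real x - \<xi>)))\<bar>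
          \<le> B T + B' T"
proof -
  define F where "F = strip_fun r x"
  define p0 where "p0 = (of_real (ln x) :: complex)"
  define p1 where "p1 = of_real (1 * (pi / r)) * \<i>"
  define p2 where "p2 = of_real (- 1 * (pi / r)) * \<i>"
  define S where "S = {v. Im v < 3 * pi / 2} \<inter> {v. - (3 * pi / 2) < Im v}"
  define pts where "pts = {p0, p1, p2}"
  define a1 where "a1 = of_real (- T) + of_real (- pi) * \<i>"
  define a2 where "a2 = of_real T + of_real (- pi) * \<i>"
  define a3 where "a3 = of_real T + of_real pi * \<i>"
  define a4 where "a4 = of_real (- T) + of_real pi * \<i>"
  have T0: "0 < T" using T by linarith
  have pir: "pi / 2 < pi / r" "pi / r < pi" using r by (auto simp: field_simps)
  have rect: "rectpath a1 a3 = linepath a1 a2 +++ linepath a2 a3 +++ linepath a3 a4 +++ linepath a4 a1"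
  proof -
    have "Complex (Re a3) (Im a1) = a2" "Complex (Re a1) (Im a3) = a4"
      by (simp_all add: a1_def a2_def a3_def a4_def complex_eq_iff)
    then show ?thesis by (simp add: rectpath_def Let_def)
  qed
  have box: "p \<in> box a1 a3" if "p \<in> pts" for p
    using that T pir pi_gt_zero
    by (auto simp: pts_def p0_def p1_def p2_def in_box_complex_iff a1_def a3_def)
  have distinct: "p0 \<noteq> p1" "p0 \<noteq> p2" "p1 \<noteq> p2"
    using r by (auto simp: p0_def p1_def p2_def complex_eq_iff)
  have holo: "F holomorphic_on S - pts"
  proof -
    have "1 + exp (of_real r * v) \<noteq> 0" "exp v - of_real x \<noteq> 0" if "v \<in> S - pts" for v
    proof -
      have Im: "\<bar>Im v\<bar> < 3 * pi / 2" using that by (auto simp: S_def)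
      then have Im': "\<bar>Im v\<bar> < 2 * pi" using pi_gt_zero by linarith
      have v: "v \<noteq> p0" "v \<noteq> p1" "v \<noteq> p2" using that by (auto simp: pts_def)
      show "1 + exp (of_real r * v) \<noteq> 0"
        using strip_fun_zeros(1)[OF r x _ Im] v by (auto simp: p1_def p2_def)
      show "exp v - of_real x \<noteq> 0"
        using strip_fun_zeros(2)[OF r x _ Im'] v by (auto simp: p0_def)
    qed
    then show ?thesis
      unfolding F_def strip_fun_def[abs_def] by (auto intro!: holomorphic_intros)
  qed
  have cbox_S: "cbox a1 a3 \<subseteq> S"
  proof
    fix v assume "v \<in> cbox a1 a3"
    then have "- pi \<le> Im v" "Im v \<le> pi" by (auto simp: in_cbox_complex_iff a1_def a3_def)
    then have "Im v < 3 * pi / 2" "- (3 * pi / 2) < Im v" using pi_gt_zero by linarith+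
    then show "v \<in> S" by (simp add: S_def)
  qed
  have S: "open S" "connected S" unfolding S_def by (rule open_convex_strip convex_connected)+
  have path: "path_image (rectpath a1 a3) \<subseteq> S - pts"
    using box cbox_S T0 pi_gt_zero path_image_rectpath_cbox_minus_box[of a1 a3]
    by (auto simp: a1_def a3_def)
  have "contour_integral (rectpath a1 a3) F
      = 2 * pi * \<i> * (\<Sum>p\<in>pts. winding_number (rectpath a1 a3) p * residue F p)"
  proof (rule Residue_theorem[where S = S])
    show "\<forall>z. z \<notin> S \<longrightarrow> winding_number (rectpath a1 a3) z = 0"
      using cbox_S T0 pi_gt_zero
      by (auto intro!: winding_number_rectpath_outside simp: a1_def a3_def)
  qed (use holo path S in \<open>auto simp: pts_def\<close>)
  also have "(\<Sum>p\<in>pts. winding_number (rectpath a1 a3) p * residue F p) = residue F p0 + (residue F p1 + residue F p2)"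
  proof -
    have "(\<Sum>p\<in>pts. winding_number (rectpath a1 a3) p * residue F p) = (\<Sum>p\<in>pts. residue F p)"
      by (intro sum.cong refl) (simp add: winding_number_rectpath[OF box])
    then show ?thesis using distinct by (simp add: pts_def)
  qed
  also have "residue F p0 = of_real (x powr (1 - r) / (1 + x powr r))"
    unfolding F_def p0_def by (rule residue_strip_fun_ln[OF r x])
  also have "residue F p1 = \<xi>\<^sup>2 / (\<xi> - of_real x) / of_real r"
    unfolding F_def p1_def \<xi>_def using residue_strip_fun_root[OF r x, of 1] by simp
  also have "residue F p2 = cnj (\<xi>\<^sup>2 / (\<xi> - of_real x) / of_real r)"
    unfolding F_def p2_def \<xi>_def using residue_strip_fun_root[OF r x, of "-1"] by (simp add: cis_cnj)
  also have "\<xi>\<^sup>2 / (\<xi> - of_real x) / of_real r + cnj (\<xi>\<^sup>2 / (\<xi> - of_real x) / of_real r)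
      = of_real (- 2 / r * Re (\<xi>\<^sup>2 / (of_real x - \<xi>)))"
  proof -
    have "\<xi>\<^sup>2 / (\<xi> - of_real x) = - (\<xi>\<^sup>2 / (of_real x - \<xi>))"
      by (subst minus_divide_right) simp
    moreover have "w / of_real r + cnj (w / of_real r) = of_real (2 / r * Re w)" for w
      unfolding complex_add_cnj by (simp add: Re_divide_of_real)
    ultimately show ?thesis by (simp only: uminus_complex.sel) simp
  qed
  finally have contour: "contour_integral (rectpath a1 a3) F
      = 2 * pi * \<i> * of_real (x powr (1 - r) / (1 + x powr r) - 2 / r * Re (\<xi>\<^sup>2 / (of_real x - \<xi>)))"
    by simp
  define R where "R = x powr (1 - r) / (1 + x powr r) - 2 / r * Re (\<xi>\<^sup>2 / (of_real x - \<xi>))"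
  have F_cont: "continuous_on (S - pts) F"
    using holo by (rule holomorphic_on_imp_continuous_on)
  have seg: "closed_segment a1 a2 \<union> closed_segment a2 a3 \<union> closed_segment a3 a4 \<union> closed_segment a4 a1
      \<subseteq> S - pts"
    using path unfolding rect by (simp add: path_image_join)
  have int: "F contour_integrable_on linepath a b" if "closed_segment a b \<subseteq> S - pts" for a b
    using that F_cont by (intro contour_integrable_continuous_linepath) (rule continuous_on_subset)
  have ints: "F contour_integrable_on linepath a1 a2" "F contour_integrable_on linepath a2 a3"
      "F contour_integrable_on linepath a3 a4" "F contour_integrable_on linepath a4 a1"
      "F contour_integrable_on linepath a4 a3"
    using seg by (auto intro!: int simp: closed_segment_commute[of a4 a3])
  have sum: "contour_integral (rectpath a1 a3) F = contour_integral (linepath a1 a2) F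
     + (contour_integral (linepath a2 a3) F + (contour_integral (linepath a3 a4) F + contour_integral (linepath a4 a1) F))"
    unfolding rect using ints by simp
  have rev: "contour_integral (linepath a3 a4) F = - contour_integral (linepath a4 a3) F"
    using seg by (intro contour_integral_reverse_linepath continuous_on_subset[OF F_cont]) auto
  define I1 I2 I3 I4 where "I1 = contour_integral (linepath a1 a2) F"
    and "I2 = contour_integral (linepath a2 a3) F"
    and "I3 = contour_integral (linepath a4 a3) F"
    and "I4 = contour_integral (linepath a4 a1) F"
  have total: "I1 + I2 - I3 + I4 = 2 * pi * \<i> * of_real R"
    using sum rev contour by (simp add: I1_def I2_def I3_def I4_def R_def)
  have h1: "((\<lambda>u. F (of_real u + of_real (- pi) * \<i>)) has_integral I1) {-T..T}"
    using has_contour_integral_integral[OF ints(1)] T0 unfolding I1_def a1_def a2_def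
    by (subst (asm) has_contour_integral_linepath_same_Im_iff) auto
  have h3: "((\<lambda>u. F (of_real u + of_real pi * \<i>)) has_integral I3) {-T..T}"
    using has_contour_integral_integral[OF ints(5)] T0 unfolding I3_def a3_def a4_def
    by (subst (asm) has_contour_integral_linepath_same_Im_iff) auto
  have "((\<lambda>u. Im (F (of_real u + of_real (- pi) * \<i>) - F (of_real u + of_real pi * \<i>)) / (2 * pi))
      has_integral Im (I1 - I3) / (2 * pi)) {-T..T}"
    by (intro has_integral_divide has_integral_Im has_integral_diff h1 h3)
  moreover have "Im (F (of_real u + of_real (- pi) * \<i>) - F (of_real u + of_real pi * \<i>)) / (2 * pi) = G u" for u
  proof -
    have "F (of_real u + of_real (- pi) * \<i>) = cnj (F (of_real u + of_real pi * \<i>))"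
      unfolding F_def strip_fun_cnj[symmetric] by simp
    then have "Im (F (of_real u + of_real (- pi) * \<i>) - F (of_real u + of_real pi * \<i>))
        = - 2 * Im (F (of_real u + of_real pi * \<i>))" by simp
    also have "\<dots> = 2 * pi * G u"
      unfolding F_def Im_strip_fun_edge[OF r x] G_def by simp
    finally show ?thesis by simp
  qed
  ultimately have G_int: "(G has_integral Im (I1 - I3) / (2 * pi)) {-T..T}" by simp
  then show "G integrable_on {-T..T}" by blast
  have xT: "exp (- T) < x" "x < exp T"
  proof -
    have "- T < ln x" "ln x < T" using T by auto
    then show "exp (- T) < x" "x < exp T" using x by (metis exp_less_cancel_iff exp_ln)+
  qed
  have rT: "1 < exp (r * T)" "exp (- (r * T)) < 1" using r T0 by auto
  have B_pos: "0 \<le> B T" "0 \<le> B' T" using xT rT by (auto simp: B_def B'_def)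
  have "norm I2 \<le> B T * norm (a3 - a2)"
  proof (rule has_contour_integral_bound_linepath)
    fix v assume v: "v \<in> closed_segment a2 a3"
    have "Re v = T" using v by (subst (asm) closed_segment_same_Re) (auto simp: a2_def a3_def)
    have "cmod (exp (of_real (2 - r) * v)) = exp ((2 - r) * T)" using \<open>Re v = T\<close> by simp
    moreover have "exp (r * T) - 1 \<le> cmod (1 + exp (of_real r * v))"
      using norm_diff_ineq[of "exp (of_real r * v)" 1] \<open>Re v = T\<close> by (simp add: add.commute)
    moreover have "exp T - x \<le> cmod (exp v - of_real x)"
      using norm_triangle_ineq2[of "exp v" "of_real x"] \<open>Re v = T\<close> x by simp
    ultimately show "norm (F v) \<le> B T"
      unfolding F_def strip_fun_def B_def norm_divide norm_mult using rT xT
      by (intro frac_le mult_mono) auto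
  qed (use ints B_pos has_contour_integral_integral in \<open>auto simp: I2_def\<close>)
  moreover have "norm I4 \<le> B' T * norm (a1 - a4)"
  proof (rule has_contour_integral_bound_linepath)
    fix v assume v: "v \<in> closed_segment a4 a1"
    have "Re v = - T" using v by (subst (asm) closed_segment_same_Re) (auto simp: a4_def a1_def)
    have "cmod (exp (of_real (2 - r) * v)) = exp (- ((2 - r) * T))" using \<open>Re v = - T\<close> by simp
    moreover have "1 - exp (- (r * T)) \<le> cmod (1 + exp (of_real r * v))"
      using norm_diff_ineq[of 1 "exp (of_real r * v)"] \<open>Re v = - T\<close> by simp
    moreover have "x - exp (- T) \<le> cmod (exp v - of_real x)"
      using norm_triangle_ineq2[of "of_real x" "exp v"] \<open>Re v = - T\<close> x by (simp add: norm_minus_commute)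
    ultimately show "norm (F v) \<le> B' T"
      unfolding F_def strip_fun_def B'_def norm_divide norm_mult using rT xT
      by (intro frac_le mult_mono) auto
  qed (use ints B_pos has_contour_integral_integral in \<open>auto simp: I4_def\<close>)
  moreover have "norm (a3 - a2) = 2 * pi" "norm (a1 - a4) = 2 * pi"
    by (simp_all add: a1_def a2_def a3_def a4_def norm_mult flip: left_diff_distrib of_real_minus of_real_diff)
  ultimately have "norm (I2 + I4) \<le> (B T + B' T) * (2 * pi)"
    using norm_triangle_ineq[of I2 I4] by (simp add: algebra_simps)
  then have bound: "\<bar>Im (I2 + I4)\<bar> \<le> (B T + B' T) * (2 * pi)"
    using abs_Im_le_cmod[of "I2 + I4"] by linarith
  have "Im (I1 - I3) / (2 * pi) - R = - Im (I2 + I4) / (2 * pi)"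
    using arg_cong[OF total, of Im] by (simp add: field_simps)
  then have "\<bar>integral {-T..T} G - R\<bar> = \<bar>Im (I2 + I4)\<bar> / (2 * pi)"
    using integral_unique[OF G_int] by simp
  also have "\<dots> \<le> B T + B' T" using bound by (simp add: divide_le_eq)
  finally show "\<bar>integral {-T..T} G - (x powr (1 - r) / (1 + x powr r) - 2 / r * Re (\<xi>\<^sup>2 / (of_real x - \<xi>)))\<bar>
          \<le> B T + B' T" unfolding R_def .
qed

text \<open>
  The integration variable is \<open>u = ln t\<close>, where \<open>t\<close> is the distance from 0 along the cut. The
  subtracted term is the contribution of the two poles of \<open>f\<close>, which are complex conjugates of
  each other.
\<close>

lemma stieltjes_representation:
  assumes r: "3/2 < r" "r < 2" and x: "0 < x"
  shows "((\<lambda>u. stieltjes_weight r (exp u) * exp u / (x + exp u)) has_integral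
     (x powr (1 - r) / (1 + x powr r) - 2 / r * Re (cis (pi / r) ^ 2 / (of_real x - cis (pi / r))))) UNIV"
proof -
  define G where "G = (\<lambda>u. stieltjes_weight r (exp u) * exp u / (x + exp u))"
  define L where "L = x powr (1 - r) / (1 + x powr r) - 2 / r * Re (cis (pi / r) ^ 2 / (of_real x - cis (pi / r)))"
  define a where "a k = \<bar>ln x\<bar> + 1 + real k" for k
  define f where "f k u = (if u \<in> {- a k..a k} then G u else 0)" for k u
  have a: "\<bar>ln x\<bar> < a k" for k by (simp add: a_def)
  have G_nonneg: "0 \<le> G u" for u
    unfolding G_def using stieltjes_weight_nonneg[OF r] x
    by (intro divide_nonneg_nonneg mult_nonneg_nonneg) (auto intro: add_nonneg_nonneg)
  have lim: "(\<lambda>k. integral UNIV (f k)) \<longlonglongrightarrow> L"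
  proof -
    have a_top: "filterlim a at_top sequentially" unfolding a_def by real_asymp
    have "(\<lambda>k. integral {- a k..a k} G - L) \<longlonglongrightarrow> 0"
    proof (rule Lim_null_comparison)
      show "\<forall>\<^sub>F k in sequentially. norm (integral {- a k..a k} G - L)
         \<le> exp ((2 - r) * a k) / ((exp (r * a k) - 1) * (exp (a k) - x))
          + exp (- ((2 - r) * a k)) / ((1 - exp (- (r * a k))) * (x - exp (- a k)))"
        using strip_fun_edge_integral(2)[OF r x a] by (auto simp: G_def L_def)
      show "(\<lambda>k. exp ((2 - r) * a k) / ((exp (r * a k) - 1) * (exp (a k) - x))
          + exp (- ((2 - r) * a k)) / ((1 - exp (- (r * a k))) * (x - exp (- a k)))) \<longlonglongrightarrow> 0"
        using tendsto_add[OF filterlim_compose[OF tendsto_strip_fun_side_bounds(1)[OF r x] a_top]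
            filterlim_compose[OF tendsto_strip_fun_side_bounds(2)[OF r x] a_top]] by simp
    qed
    then have "(\<lambda>k. integral {- a k..a k} G) \<longlonglongrightarrow> L" by (simp add: LIM_zero_iff)
    then show ?thesis unfolding f_def integral_restrict_UNIV .
  qed
  have "G integrable_on UNIV \<and> (\<lambda>k. integral UNIV (f k)) \<longlonglongrightarrow> integral UNIV G"
  proof (rule monotone_convergence_increasing)
    show "f k integrable_on UNIV" for k
      unfolding f_def integrable_restrict_UNIV
      using strip_fun_edge_integral(1)[OF r x a] by (simp add: G_def)
    show "f k u \<le> f (Suc k) u" for k u
      using G_nonneg by (auto simp: f_def a_def)
    show "(\<lambda>k. f k u) \<longlonglongrightarrow> G u" for u
    proof (rule tendsto_eventually)
      show "\<forall>\<^sub>F k in sequentially. f k u = G u"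
        using eventually_ge_at_top[of "nat \<lceil>\<bar>u\<bar>\<rceil>"]
      proof eventually_elim
        case (elim k)
        then have "\<bar>u\<bar> \<le> real k" by linarith
        then show ?case by (auto simp: f_def a_def)
      qed
    qed
    show "bounded (range (\<lambda>k. integral UNIV (f k)))"
      using lim by (intro convergent_imp_bounded) (auto simp: convergent_def)
  qed
  then show ?thesis
    using LIMSEQ_unique[OF lim] has_integral_integral[of G UNIV] unfolding G_def L_def by auto
qed

section \<open>Elementary estimates\<close>

lemma has_bochner_integral_of_has_integral:
  fixes f :: "real \<Rightarrow> real"
  assumes "f \<in> borel_measurable borel" "\<And>x. 0 \<le> f x" "(f has_integral I) UNIV"
  shows "has_bochner_integral lborel f I"
proof (rule has_bochner_integral_nn_integral)
  show "0 \<le> I" using assms(2,3) by (blast intro: has_integral_nonneg)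
qed (use assms nn_integral_has_integral_lborel in auto)

lemma sin_taylor_bounds:
  fixes z :: real
  assumes "0 \<le> z"
  shows "z - z ^ 3 / 6 - z ^ 5 / 120 \<le> sin z" "sin z \<le> z - z ^ 3 / 6 + z ^ 5 / 120"
proof -
  have "{..<5::nat} = {0, 1, 2, 3, 4}" by auto
  then have "(\<Sum>m<5. sin_coeff m * z ^ m) = z - z ^ 3 / 6"
    by (simp add: sin_coeff_def fact_numeral)
  then have "\<bar>sin z - (z - z ^ 3 / 6)\<bar> \<le> z ^ 5 / 120"
    using Maclaurin_sin_bound[of z 5] assms by (simp add: fact_numeral)
  from abs_le_D1[OF this] abs_le_D2[OF this]
  show "z - z ^ 3 / 6 - z ^ 5 / 120 \<le> sin z" "sin z \<le> z - z ^ 3 / 6 + z ^ 5 / 120"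
    by linarith+
qed

text \<open>
  Obtained from \<open>sin (pi / 6) = 1 / 2\<close>, and accurate enough for \<open>edge_laplace_dominates\<close> below.
\<close>

lemma pi_bounds: "(157/50) \<le> pi" "pi \<le> (63/20)"
proof -
  have half: "sin (pi / 6) = 1 / 2" by (rule sin_30)
  show "(157/50) \<le> pi"
  proof (rule ccontr)
    assume "\<not> (157/50) \<le> pi"
    then have "pi / 6 < (157/50) / 6" by simp
    then have "sin (pi / 6) < sin ((157/50) / 6)"
      using pi_ge_two by (intro sin_monotone_2pi) auto
    also have "sin ((157/50) / 6) \<le> (157/50) / 6 - ((157/50) / 6) ^ 3 / 6 + ((157/50) / 6) ^ 5 / (120 :: real)"
      by (rule sin_taylor_bounds) simp
    also have "\<dots> < 1 / 2" by (simp add: power_numeral_reduce)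
    finally show False using half by simp
  qed
  show "pi \<le> (63/20)"
  proof (rule ccontr)
    assume "\<not> pi \<le> (63/20)"
    then have "(63/20) / 6 < pi / 6" by simp
    then have "sin ((63/20) / 6) < sin (pi / 6)"
      by (intro sin_monotone_2pi) auto
    moreover have "(63/20) / 6 - ((63/20) / 6) ^ 3 / 6 - ((63/20) / 6) ^ 5 / (120 :: real) \<le> sin ((63/20) / 6)"
      by (rule sin_taylor_bounds) simp
    moreover have "1 / 2 < (63/20) / 6 - ((63/20) / 6) ^ 3 / 6 - ((63/20) / 6) ^ 5 / (120 :: real)"
      by (simp add: power_numeral_reduce)
    ultimately show False using half by simp
  qed
qed

lemma sin_ge_linear:
  assumes "0 \<le> z" "z \<le> pi / 6"
  shows "(19/20) * z \<le> sin z"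
proof -
  have z: "z \<le> (21/40)" using assms pi_bounds by simp
  have "z\<^sup>2 \<le> (21/40)\<^sup>2" using assms z by (intro power_mono) auto
  moreover have "z ^ 4 \<le> (21/40) ^ 4" using assms z by (intro power_mono) auto
  ultimately have "z\<^sup>2 / 6 + z ^ 4 / 120 \<le> (1/20)" by (simp add: power_numeral_reduce)
  then have "z * (z\<^sup>2 / 6 + z ^ 4 / 120) \<le> z * (1/20)"
    using assms by (intro mult_left_mono) auto
  moreover have "z * (z\<^sup>2 / 6 + z ^ 4 / 120) = z ^ 3 / 6 + z ^ 5 / 120"
    by (simp add: power_numeral_reduce algebra_simps)
  ultimately show ?thesis using sin_taylor_bounds(1)[OF assms(1)] by linarith
qed

text \<open>
  Weighted arithmetic and geometric means of \<open>a\<close> and 1.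
\<close>

lemma powr_le_linear:
  fixes a k :: real
  assumes "0 < a" "0 \<le> k" "k \<le> 1"
  shows "a powr k \<le> 1 - k + k * a"
  using Youngs_inequality_0[of k "1 - k" a 1] assms by simp

text \<open>
  Log-convexity between \<open>1 / 2\<close> and 1, where the Gamma function takes the values \<open>sqrt pi\<close> and 1.
\<close>

lemma Gamma_one_minus_le:
  fixes k :: real
  assumes "0 \<le> k" "k \<le> 1 / 2"
  shows "Gamma (1 - k) \<le> pi powr k"
proof -
  have "(ln \<circ> Gamma) ((1 - 2 * k) *\<^sub>R 1 + (2 * k) *\<^sub>R (1 / 2 :: real))
      \<le> (1 - 2 * k) * (ln \<circ> Gamma) 1 + (2 * k) * (ln \<circ> Gamma) (1 / 2 :: real)"
    using assms by (intro convex_onD[OF log_convex_Gamma_real]) auto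
  then have "ln (Gamma (1 - k)) \<le> k * ln pi"
    by (simp add: Gamma_one_half_real ln_sqrt)
  then have "exp (ln (Gamma (1 - k))) \<le> exp (k * ln pi)" by simp
  then show ?thesis
    using assms by (simp add: Gamma_real_pos powr_def)
qed

lemma Gamma_reflection_real:
  fixes k :: real
  shows "Gamma k * Gamma (1 - k) = pi / sin (pi * k)"
proof -
  have "complex_of_real (Gamma k * Gamma (1 - k)) = of_real (pi / sin (pi * k))"
  proof -
    have "1 - complex_of_real k = of_real (1 - k)" by simp
    then show ?thesis
      using Gamma_reflection_complex[of "of_real k"]
      by (simp only: Gamma_complex_of_real of_real_mult of_real_divide)
         (simp add: sin_of_real flip: of_real_mult)
  qed
  then show ?thesis by (simp only: of_real_eq_iff)
qed

text \<open>
  Euler's integral after the substitution \<open>t = l * exp u\<close>.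
\<close>

lemma has_bochner_integral_exp_gamma:
  fixes l k :: real
  assumes "0 < l" "0 < k"
  shows "has_bochner_integral lborel (\<lambda>u. exp (- (l * exp u)) * exp (k * u)) (Gamma k / l powr k)"
proof (rule has_bochner_integral_of_has_integral)
  define f where "f t = t powr (k - 1) / exp t" for t :: real
  have "(f has_integral Gamma k) {0..}"
    unfolding f_def by (rule Gamma_integral_real[OF assms(2)])
  moreover have "(f has_integral Gamma k) {0..} \<longleftrightarrow> (f has_integral Gamma k) {0<..}"
  proof (rule has_integral_spike_set_eq)
    have "{x \<in> {0..} - {0<..}. f x \<noteq> 0} = {}" "{x \<in> {0<..} - {0..}. f x \<noteq> 0} = {}"
      by (auto simp: f_def)
    then show "negligible {x \<in> {0..} - {0<..}. f x \<noteq> 0}" "negligible {x \<in> {0<..} - {0..}. f x \<noteq> 0}"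
      by (simp_all only: negligible_empty)
  qed
  ultimately have "(f has_integral Gamma k) {0<..}" by blast
  moreover have "(\<lambda>u. l * exp u) ` UNIV = {0<..}"
  proof
    show "{0<..} \<subseteq> (\<lambda>u. l * exp u) ` UNIV"
    proof
      fix y :: real assume "y \<in> {0<..}"
      then have "y = l * exp (ln (y / l))" using assms by simp
      then show "y \<in> (\<lambda>u. l * exp u) ` UNIV" by blast
    qed
  qed (use assms in auto)
  ultimately have "f absolutely_integrable_on ((\<lambda>u. l * exp u) ` UNIV)
      \<and> integral ((\<lambda>u. l * exp u) ` UNIV) f = Gamma k"
    by (auto simp: f_def intro!: nonnegative_absolutely_integrable_1)
  then have "(\<lambda>u. \<bar>l * exp u\<bar> * f (l * exp u)) absolutely_integrable_on UNIV
      \<and> integral UNIV (\<lambda>u. \<bar>l * exp u\<bar> * f (l * exp u)) = Gamma k"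
    using assms
    by (subst has_absolute_integral_change_of_variables_1')
       (auto intro!: derivative_eq_intros inj_onI)
  then have "((\<lambda>u. \<bar>l * exp u\<bar> * f (l * exp u)) has_integral Gamma k) UNIV"
    by (auto simp: absolutely_integrable_on_def has_integral_integrable_integral)
  then have "((\<lambda>u. \<bar>l * exp u\<bar> * f (l * exp u) / l powr k) has_integral Gamma k / l powr k) UNIV"
    by (rule has_integral_divide)
  moreover have "\<bar>l * exp u\<bar> * f (l * exp u) / l powr k = exp (- (l * exp u)) * exp (k * u)" for u
  proof -
    have "(l * exp u) * (l * exp u) powr (k - 1) = (l * exp u) powr k"
      using assms powr_mult_base[of "l * exp u" "k - 1"] by simp
    also have "\<dots> = l powr k * exp (k * u)"
      using assms by (simp add: powr_mult) (simp add: powr_def)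
    finally have TP: "(l * exp u) * (l * exp u) powr (k - 1) = l powr k * exp (k * u)" .
    have gen: "T * (P / X) / L = inverse X * E" if "T * P = L * E" "L \<noteq> 0" for T P X L E :: real
    proof -
      have "T * (P / X) / L = T * P / L / X" by simp
      also have "\<dots> = L * E / L / X" by (simp only: that(1))
      also have "\<dots> = inverse X * E" using that(2) by (simp add: divide_inverse mult.commute)
      finally show ?thesis .
    qed
    show ?thesis using gen[OF TP, of "exp (l * exp u)"] assms by (simp add: f_def exp_minus)
  qed
  ultimately show "((\<lambda>u. exp (- (l * exp u)) * exp (k * u)) has_integral Gamma k / l powr k) UNIV"
    by simp
qed auto

section \<open>A nonnegative inverse Laplace transform\<close>

context
  fixes r :: real
  assumes r: "3/2 < r" "r < 2"
begin

text \<open>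
  The Stieltjes weight in the coordinate \<open>u = ln t\<close>, including the Jacobian.
\<close>

definition edge_weight :: "real \<Rightarrow> real" where
  "edge_weight u = stieltjes_weight r (exp u) * exp u"

lemma edge_weight_nonneg: "0 \<le> edge_weight u"
  using stieltjes_weight_nonneg[OF r] by (simp add: edge_weight_def)

lemma edge_weight_measurable [measurable]: "edge_weight \<in> borel_measurable borel"
  unfolding edge_weight_def stieltjes_weight_def by measurable

lemma tendsto_div_diff_cis:
  "((\<lambda>X. of_real X / (of_real X - cis a)) \<longlongrightarrow> 1) at_top"
proof -
  have "((\<lambda>X. 1 / X) \<longlongrightarrow> (0::real)) at_top" by real_asymp
  then have h: "((\<lambda>X. cis a * of_real (1 / X)) \<longlongrightarrow> cis a * of_real 0) at_top"
    by (intro tendsto_intros)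
  have "((\<lambda>X. 1 / (1 - cis a * of_real (1 / X))) \<longlongrightarrow> 1 / (1 - cis a * of_real 0)) at_top"
    by (intro tendsto_divide tendsto_diff tendsto_const h) simp
  moreover have "\<forall>\<^sub>F X in at_top. 1 / (1 - cis a * of_real (1 / X)) = of_real X / (of_real X - cis a)"
    using eventually_gt_at_top[of 0] by eventually_elim (simp add: field_simps)
  ultimately show ?thesis by (simp add: Lim_transform_eventually)
qed

text \<open>
  The function decays like \<open>X powr (1 - 2 * r)\<close>, and \<open>2 * r - 1 > 2\<close>. In the expansion of the
  Stieltjes representation at infinity it is thus invisible up to second order, so that the first
  two moments of the weight are determined by the poles alone.
\<close>

lemma tendsto_power_mult_powr_div:
  assumes "n \<le> 2"
  shows "((\<lambda>X. X ^ n * (X powr (1 - r) / (1 + X powr r))) \<longlongrightarrow> 0) at_top"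
proof (rule Lim_null_comparison)
  show "((\<lambda>X. X powr (3 - 2 * r)) \<longlongrightarrow> 0) at_top"
    using r by (intro tendsto_neg_powr filterlim_ident) auto
  show "\<forall>\<^sub>F X in at_top. norm (X ^ n * (X powr (1 - r) / (1 + X powr r))) \<le> X powr (3 - 2 * r)"
    using eventually_ge_at_top[of 1]
  proof eventually_elim
    case (elim X)
    have "X ^ n * (X powr (1 - r) / (1 + X powr r)) \<le> X ^ 2 * (X powr (1 - r) / X powr r)"
      using elim assms by (intro mult_mono power_increasing divide_left_mono) (auto intro!: mult_pos_pos add_pos_nonneg)
    also have "\<dots> = X powr 2 * X powr (1 - r) * X powr (- r)"
      using elim by (simp add: powr_minus divide_inverse powr_numeral)
    also have "\<dots> = X powr (3 - 2 * r)"
      by (simp add: powr_add[symmetric])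
    finally show ?case using elim by simp
  qed
qed

lemma edge_weight_stieltjes:
  assumes "0 < X"
  shows "((\<lambda>u. edge_weight u / (X + exp u)) has_integral
     (X powr (1 - r) / (1 + X powr r) - 2 / r * Re (cis (pi / r) ^ 2 / (of_real X - cis (pi / r))))) UNIV"
  using stieltjes_representation[OF r assms] by (simp add: edge_weight_def)

lemma real_nat_at_top: "filterlim (\<lambda>n. real n + 1) at_top sequentially"
  by real_asymp

text \<open>
  The Stieltjes representation at \<open>X\<close>, multiplied by \<open>X\<close>, in the limit \<open>X \<rightarrow> \<infinity>\<close>.
\<close>

lemma has_integral_edge_weight: "(edge_weight has_integral - 2 / r * cos (2 * pi / r)) UNIV"
proof -
  define \<xi> where "\<xi> = cis (pi / r)"
  define J where "J X = X * (X powr (1 - r) / (1 + X powr r) - 2 / r * Re (\<xi>\<^sup>2 / (of_real X - \<xi>)))" for X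
  define f where "f n u = (real n + 1) * (edge_weight u / (real n + 1 + exp u))" for n u
  have f: "(f n has_integral J (real n + 1)) UNIV" for n
    unfolding f_def J_def \<xi>_def by (intro has_integral_mult_right edge_weight_stieltjes) auto
  have J_eq: "J X = X ^ 1 * (X powr (1 - r) / (1 + X powr r)) - 2 / r * Re (\<xi>\<^sup>2 * (of_real X / (of_real X - \<xi>)))" for X
  proof -
    have "X * Re (\<xi>\<^sup>2 / (of_real X - \<xi>)) = Re (\<xi>\<^sup>2 * (of_real X / (of_real X - \<xi>)))"
    proof -
      have "X * Re w = Re (of_real X * w)" for w by simp
      then have "X * Re (\<xi>\<^sup>2 / (of_real X - \<xi>)) = Re (of_real X * (\<xi>\<^sup>2 / (of_real X - \<xi>)))" .
      then show ?thesis by (simp only: times_divide_eq_right mult.commute)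
    qed
    then show ?thesis by (simp add: J_def algebra_simps)
  qed
  have "(J \<longlongrightarrow> 0 - 2 / r * Re (\<xi>\<^sup>2 * 1)) at_top"
    unfolding J_eq[abs_def] \<xi>_def
    by (intro tendsto_intros tendsto_power_mult_powr_div tendsto_div_diff_cis) auto
  from filterlim_compose[OF this real_nat_at_top]
  have lim: "(\<lambda>n. integral UNIV (f n)) \<longlonglongrightarrow> - 2 / r * cos (2 * pi / r)"
    unfolding integral_unique[OF f] by (simp add: \<xi>_def Complex.DeMoivre)
  have "edge_weight integrable_on UNIV \<and> (\<lambda>n. integral UNIV (f n)) \<longlonglongrightarrow> integral UNIV edge_weight"
  proof (rule monotone_convergence_increasing)
    show "f n integrable_on UNIV" for n using f by blast
    show "f n u \<le> f (Suc n) u" for n u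
    proof -
      have "(real n + 1) / (real n + 1 + exp u) \<le> (real (Suc n) + 1) / (real (Suc n) + 1 + exp u)"
        by (simp add: divide_simps add_pos_pos) (simp add: algebra_simps)
      from mult_right_mono[OF this edge_weight_nonneg[of u]] show ?thesis by (simp add: f_def)
    qed
    show "(\<lambda>n. f n u) \<longlonglongrightarrow> edge_weight u" for u
    proof -
      have "(\<lambda>n. (real n + 1) / (real n + 1 + exp u)) \<longlonglongrightarrow> 1" by real_asymp
      from tendsto_mult_right[OF this, of "edge_weight u"] show ?thesis by (simp add: f_def)
    qed
    show "bounded (range (\<lambda>n. integral UNIV (f n)))"
      using lim by (intro convergent_imp_bounded) (auto simp: convergent_def)
  qed
  then show ?thesis
    using LIMSEQ_unique[OF lim] has_integral_integral[of edge_weight UNIV] by auto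
qed

text \<open>
  The next coefficient of the expansion at infinity: subtract the leading term, multiply by \<open>X\<close>
  once more and let \<open>X \<rightarrow> \<infinity>\<close>.
\<close>

lemma has_integral_exp_edge_weight:
  "((\<lambda>u. exp u * edge_weight u) has_integral 2 / r * cos (3 * pi / r)) UNIV"
proof -
  define \<xi> where "\<xi> = cis (pi / r)"
  define g where "g X = X powr (1 - r) / (1 + X powr r)" for X
  define J where "J X = X * (- 2 / r * cos (2 * pi / r) - X * (g X - 2 / r * Re (\<xi>\<^sup>2 / (of_real X - \<xi>))))" for X
  define f where "f n u = (real n + 1) * (edge_weight u - (real n + 1) * (edge_weight u / (real n + 1 + exp u)))" for n u
  have f: "(f n has_integral J (real n + 1)) UNIV" for n
    unfolding f_def J_def \<xi>_def g_def
    by (intro has_integral_mult_right has_integral_diff edge_weight_stieltjes has_integral_edge_weight) auto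
  have f_eq: "f n u = (real n + 1) / (real n + 1 + exp u) * (exp u * edge_weight u)" for n u
  proof -
    have "a - X * (a / (X + t)) = t * a / (X + t)" if "X + t \<noteq> 0" for a X t :: real
      using that by (simp add: field_simps)
    moreover have "real n + 1 + exp u \<noteq> 0" using exp_gt_zero[of u] by linarith
    ultimately show ?thesis by (simp add: f_def)
  qed
  have J_eq: "J X = - (X ^ 2 * g X) + 2 / r * Re (\<xi> ^ 3 * (of_real X / (of_real X - \<xi>)))" if "1 < X" for X
  proof -
    have ne: "of_real X - \<xi> \<noteq> 0"
      using that by (auto simp: \<xi>_def complex_eq_iff) (metis abs_cos_le_one abs_le_iff not_less order_less_le_trans)
    have "X * (X * Re (\<xi>\<^sup>2 / (of_real X - \<xi>)) - Re (\<xi>\<^sup>2)) = Re (of_real X * (of_real X * (\<xi>\<^sup>2 / (of_real X - \<xi>)) - \<xi>\<^sup>2))"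
    proof -
      have "X * (X * Re w - Re z) = Re (of_real X * (of_real X * w - z))" for w z by simp
      then show ?thesis .
    qed
    also have "of_real X * (of_real X * (\<xi>\<^sup>2 / (of_real X - \<xi>)) - \<xi>\<^sup>2) = \<xi> ^ 3 * (of_real X / (of_real X - \<xi>))"
      using ne by (simp add: field_simps power2_eq_square power3_eq_cube)
    finally have "X * (X * Re (\<xi>\<^sup>2 / (of_real X - \<xi>)) - Re (\<xi>\<^sup>2)) = Re (\<xi> ^ 3 * (of_real X / (of_real X - \<xi>)))" .
    moreover have "Re (\<xi>\<^sup>2) = cos (2 * pi / r)" by (simp add: \<xi>_def Complex.DeMoivre)
    moreover have "J X = - (X ^ 2 * g X) + 2 / r * (X * (X * Re (\<xi>\<^sup>2 / (of_real X - \<xi>)) - cos (2 * pi / r)))"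
      by (simp add: J_def power2_eq_square algebra_simps)
    ultimately show ?thesis by simp
  qed
  have "((\<lambda>X. - (X ^ 2 * g X) + 2 / r * Re (\<xi> ^ 3 * (of_real X / (of_real X - \<xi>)))) \<longlongrightarrow> - 0 + 2 / r * Re (\<xi> ^ 3 * 1)) at_top"
    unfolding \<xi>_def g_def
    by (intro tendsto_intros tendsto_power_mult_powr_div tendsto_div_diff_cis) auto
  moreover have "\<forall>\<^sub>F X in at_top. - (X ^ 2 * g X) + 2 / r * Re (\<xi> ^ 3 * (of_real X / (of_real X - \<xi>))) = J X"
    using eventually_gt_at_top[of 1] by eventually_elim (simp add: J_eq)
  ultimately have "(J \<longlongrightarrow> - 0 + 2 / r * Re (\<xi> ^ 3 * 1)) at_top"
    by (rule Lim_transform_eventually)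
  from filterlim_compose[OF this real_nat_at_top]
  have lim: "(\<lambda>n. integral UNIV (f n)) \<longlonglongrightarrow> 2 / r * cos (3 * pi / r)"
    unfolding integral_unique[OF f] by (simp add: \<xi>_def Complex.DeMoivre)
  have "(\<lambda>u. exp u * edge_weight u) integrable_on UNIV
      \<and> (\<lambda>n. integral UNIV (f n)) \<longlonglongrightarrow> integral UNIV (\<lambda>u. exp u * edge_weight u)"
  proof (rule monotone_convergence_increasing)
    show "f n integrable_on UNIV" for n using f by blast
    show "f n u \<le> f (Suc n) u" for n u
    proof -
      have "(real n + 1) / (real n + 1 + exp u) \<le> (real (Suc n) + 1) / (real (Suc n) + 1 + exp u)"
        by (simp add: divide_simps add_pos_pos) (simp add: algebra_simps)
      then show ?thesis
        unfolding f_eq using edge_weight_nonneg[of u] by (intro mult_right_mono) auto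
    qed
    show "(\<lambda>n. f n u) \<longlonglongrightarrow> exp u * edge_weight u" for u
    proof -
      have "(\<lambda>n. (real n + 1) / (real n + 1 + exp u)) \<longlonglongrightarrow> 1" by real_asymp
      from tendsto_mult_right[OF this, of "exp u * edge_weight u"] show ?thesis by (simp add: f_eq)
    qed
    show "bounded (range (\<lambda>n. integral UNIV (f n)))"
      using lim by (intro convergent_imp_bounded) (auto simp: convergent_def)
  qed
  then show ?thesis
    using LIMSEQ_unique[OF lim] has_integral_integral[of "\<lambda>u. exp u * edge_weight u" UNIV] by auto
qed

definition edge_laplace :: "real \<Rightarrow> real" where
  "edge_laplace l = (LINT u|lborel. exp (- (l * exp u)) * edge_weight u)"

text \<open>
  The inverse Laplace transform of \<open>x powr (1 - r) / (1 + x powr r)\<close>: the cut contributes the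
  Laplace transform of the weight, the pair of poles a damped oscillation.
\<close>

definition inverse_laplace :: "real \<Rightarrow> real" where
  "inverse_laplace l = edge_laplace l
     + 2 / r * (exp (cos (pi / r) * l) * cos (2 * pi / r + sin (pi / r) * l))"

lemma integrable_edge_weight: "integrable lborel edge_weight"
  and integral_edge_weight: "integral\<^sup>L lborel edge_weight = - 2 / r * cos (2 * pi / r)"
  and integrable_exp_edge_weight: "integrable lborel (\<lambda>u. exp u * edge_weight u)"
  and integral_exp_edge_weight: "(LINT u|lborel. exp u * edge_weight u) = 2 / r * cos (3 * pi / r)"
  using has_bochner_integral_of_has_integral[OF _ _ has_integral_edge_weight]
    has_bochner_integral_of_has_integral[OF _ _ has_integral_exp_edge_weight] edge_weight_nonneg
  by (auto simp: has_bochner_integral_iff)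

lemma integrable_edge_laplace:
  assumes "0 \<le> l"
  shows "integrable lborel (\<lambda>u. exp (- (l * exp u)) * edge_weight u)"
proof (rule Bochner_Integration.integrable_bound[OF integrable_edge_weight])
  have "exp (- (l * exp u)) * edge_weight u \<le> 1 * edge_weight u" for u
    using assms edge_weight_nonneg by (intro mult_right_mono) auto
  then show "AE u in lborel. norm (exp (- (l * exp u)) * edge_weight u) \<le> norm (edge_weight u)"
    using edge_weight_nonneg by (auto simp: abs_mult)
qed measurable

lemma edge_laplace_nonneg: "0 \<le> edge_laplace l"
  unfolding edge_laplace_def using edge_weight_nonneg by (intro integral_nonneg_AE) auto

lemma pi_div_r: "pi / 2 < pi / r" "pi / r < 2 * pi / 3"
  using r by (auto simp: field_simps)

text \<open>
  With \<open>t = exp u\<close>, the inequality \<open>exp ((c - t) * l) \<ge> 1 + (c - t) * l\<close>, integrated against the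
  weight, bounds the monotone part below by its first two moments. What remains is that the cosine
  lies above its tangent at \<open>\<theta> = 2 * pi / r\<close>, and up to \<open>3 * pi / 2\<close> it does, being convex there.
\<close>

lemma inverse_laplace_nonneg_small:
  assumes l: "0 \<le> l" "2 * pi / r + sin (pi / r) * l \<le> 3 * pi / 2"
  shows "0 \<le> inverse_laplace l"
proof -
  define \<theta> c s where "\<theta> = 2 * pi / r" and "c = - cos (pi / r)" and "s = sin (pi / r)"
  have s: "0 < s" unfolding s_def using pi_div_r pi_gt_zero by (intro sin_gt_zero) linarith+
  have \<theta>: "pi < \<theta>" "\<theta> < 4 * pi / 3" 
  proof -
    have "\<theta> = 2 * (pi / r)" by (simp add: \<theta>_def)
    then show "pi < \<theta>" "\<theta> < 4 * pi / 3" using pi_div_r by linarith+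
  qed
  have "(LINT u|lborel. (1 + c * l) * edge_weight u - l * (exp u * edge_weight u))
      \<le> (LINT u|lborel. exp (c * l) * (exp (- (l * exp u)) * edge_weight u))"
  proof (rule integral_mono)
    fix u
    have "1 + (c * l - l * exp u) \<le> exp (c * l - l * exp u)" by (rule exp_ge_add_one_self)
    from mult_right_mono[OF this edge_weight_nonneg[of u]]
    show "(1 + c * l) * edge_weight u - l * (exp u * edge_weight u)
        \<le> exp (c * l) * (exp (- (l * exp u)) * edge_weight u)"
      by (simp add: exp_diff exp_minus divide_inverse algebra_simps)
  qed (use integrable_edge_weight integrable_exp_edge_weight integrable_edge_laplace[OF l(1)] in auto)
  also have "\<dots> = exp (c * l) * edge_laplace l" by (simp add: edge_laplace_def)
  also have "(LINT u|lborel. (1 + c * l) * edge_weight u - l * (exp u * edge_weight u))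
      = (1 + c * l) * (- 2 / r * cos \<theta>) - l * (2 / r * cos (3 * pi / r))"
    using integrable_edge_weight integrable_exp_edge_weight
    by (simp add: integral_edge_weight integral_exp_edge_weight \<theta>_def)
  also have "\<dots> = 2 / r * (- cos \<theta> + s * l * sin \<theta>)"
  proof -
    have "cos (3 * pi / r) = cos (\<theta> + pi / r)" by (simp add: \<theta>_def field_simps)
    also have "\<dots> = - cos \<theta> * c - sin \<theta> * s" by (simp add: cos_add c_def s_def)
    finally have C3: "cos (3 * pi / r) = - cos \<theta> * c - sin \<theta> * s" .
    have "(1 + c * l) * (- q * X) - l * (q * (- X * c - Y * s)) = q * (- X + s * l * Y)" for q X Y
      by (simp add: algebra_simps)
    from this[of "2 / r"] show ?thesis unfolding C3 by simp
  qed
  finally have A: "2 / r * (- cos \<theta> + s * l * sin \<theta>) \<le> exp (c * l) * edge_laplace l" .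
  have "0 \<le> cos (\<theta> + s * l) - cos \<theta> + s * l * sin \<theta>"
  proof -
    define h where "h y = cos (\<theta> + y) - cos \<theta> + y * sin \<theta>" for y
    have "h 0 \<le> h (s * l)"
    proof (rule DERIV_nonneg_imp_nondecreasing[where f = h])
      show "0 \<le> s * l" using s l by simp
      fix y assume y: "0 \<le> y" "y \<le> s * l"
      have "(h has_real_derivative sin \<theta> - sin (\<theta> + y)) (at y)"
        unfolding h_def by (auto intro!: derivative_eq_intros)
      moreover have "sin (\<theta> + y) \<le> sin \<theta>"
      proof -
        have "\<theta> + y \<le> 3 * pi / 2" using y l by (simp add: \<theta>_def s_def)
        then have "sin (\<theta> - pi) \<le> sin (\<theta> + y - pi)"
          using y \<theta> by (intro sin_monotone_2pi_le) (auto simp: field_simps)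
        then show ?thesis by (simp add: sin_diff)
      qed
      ultimately show "\<exists>d. (h has_real_derivative d) (at y) \<and> 0 \<le> d"
        by (intro exI[of _ "sin \<theta> - sin (\<theta> + y)"]) auto
    qed
    then show ?thesis by (simp add: h_def mult.assoc)
  qed
  then have "0 \<le> 2 / r * (cos (\<theta> + s * l) - cos \<theta> + s * l * sin \<theta>)"
    using r by (intro mult_nonneg_nonneg) auto
  then have "0 \<le> exp (c * l) * edge_laplace l + 2 / r * cos (\<theta> + s * l)"
    using A by (simp add: algebra_simps)
  also have "\<dots> = exp (c * l) * inverse_laplace l"
    by (simp add: inverse_laplace_def c_def s_def \<theta>_def distrib_left exp_minus field_simps)
  finally show ?thesis by (simp add: zero_le_mult_iff)
qed

text \<open>
  For small \<open>t = exp u\<close> the weight behaves like \<open>sin (pi * k) / pi * t powr k\<close>; the factor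
  \<open>1 - t ^ 3\<close> absorbs the correction and is negative where the comparison would fail.
\<close>

lemma edge_weight_ge:
  assumes k: "k = 2 - r"
  shows "sin (pi * k) / pi * (exp (k * u) - exp ((k + 3) * u)) \<le> edge_weight u"
proof -
  define t C y where "t = exp u" and "C = cos (pi * r)" and "y = t powr r"
  have t: "0 < t" and C: "0 < C" using cos_pi_r_pos[OF r] by (auto simp: t_def C_def)
  have y: "0 < y" using t by (simp add: y_def)
  have Cy: "0 < C * y" using C y by simp
  have den: "0 < 1 + 2 * C * y + y\<^sup>2" using Cy by (simp add: add_pos_nonneg)
  have "1 - t ^ 3 \<le> (1 + 2 * C * y) / (1 + 2 * C * y + y\<^sup>2)"
  proof (cases "t \<le> 1")
    case True
    have "y\<^sup>2 = t powr (2 * r)" by (simp add: y_def power2_eq_square powr_add[symmetric])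
    also have "\<dots> \<le> t powr 3" using True t r by (intro powr_mono') auto
    finally have y3: "y\<^sup>2 \<le> t ^ 3" using t by (simp add: powr_numeral)
    have "(1 - y\<^sup>2) * (1 + 2 * C * y + y\<^sup>2) \<le> 1 + 2 * C * y"
    proof -
      have "0 \<le> y\<^sup>2 * (2 * C * y + y\<^sup>2)" using Cy by simp
      then show ?thesis by (simp add: algebra_simps)
    qed
    then have "1 - y\<^sup>2 \<le> (1 + 2 * C * y) / (1 + 2 * C * y + y\<^sup>2)"
      using den by (simp add: pos_le_divide_eq)
    then show ?thesis using y3 by linarith
  next
    case False
    then have "1 - t ^ 3 \<le> 0" by (simp add: one_le_power)
    also have "0 \<le> (1 + 2 * C * y) / (1 + 2 * C * y + y\<^sup>2)" using Cy den by simp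
    finally show ?thesis .
  qed
  then have "- sin (pi * r) / pi * t powr (2 - r) * (1 - t ^ 3)
      \<le> - sin (pi * r) / pi * t powr (2 - r) * ((1 + 2 * C * y) / (1 + 2 * C * y + y\<^sup>2))"
    using sin_pi_r_neg[OF r] by (intro mult_left_mono mult_nonneg_nonneg divide_nonneg_nonneg) auto
  also have "\<dots> = - sin (pi * r) / pi * (t powr (1 - r) * t) * ((1 + 2 * C * y) / (1 + 2 * C * y + y\<^sup>2))"
  proof -
    have "t powr (2 - r) = t powr (1 - r) * t" using t powr_add[of t "1 - r" 1] by simp
    then show ?thesis by simp
  qed
  also have "\<dots> = edge_weight u"
    by (simp add: edge_weight_def stieltjes_weight_def t_def[symmetric] C_def[symmetric] y_def[symmetric] mult_ac)
  also have "- sin (pi * r) / pi * t powr (2 - r) * (1 - t ^ 3)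
      = sin (pi * k) / pi * (exp (k * u) - exp ((k + 3) * u))"
  proof -
    have "sin (pi * k) = - sin (pi * r)"
      using sin_2pi_minus[of "pi * r"] by (simp add: k algebra_simps)
    moreover have "t powr (2 - r) = exp (k * u)" by (simp add: t_def powr_def k)
    moreover have "exp ((k + 3) * u) = exp (k * u) * t ^ 3"
      using exp_of_nat_mult[of 3 u] by (simp add: t_def distrib_right exp_add)
    ultimately show ?thesis by (simp only: right_diff_distrib mult_1_right mult.assoc)
  qed
  finally show ?thesis .
qed

text \<open>
  The lower bound of the weight has Gamma integrals as its Laplace transform, and the reflection
  formula removes the sine.
\<close>

lemma edge_laplace_ge:
  assumes l: "0 < l"
  defines "k \<equiv> 2 - r"
  shows "(1 - k * (k + 1) * (k + 2) / l ^ 3) / (Gamma (1 - k) * l powr k) \<le> edge_laplace l"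
proof -
  have k: "0 < k" "k < 1 / 2" using r by (auto simp: k_def)
  have s: "0 < sin (pi * k)" using k by (intro sin_gt_zero) auto
  note G = has_bochner_integral_exp_gamma[OF l]
  have "has_bochner_integral lborel (\<lambda>u. sin (pi * k) / pi *
      (exp (- (l * exp u)) * exp (k * u) - exp (- (l * exp u)) * exp ((k + 3) * u)))
      (sin (pi * k) / pi * (Gamma k / l powr k - Gamma (k + 3) / l powr (k + 3)))"
    using k by (intro has_bochner_integral_mult_right has_bochner_integral_diff G) auto
  note * = this
  have "sin (pi * k) / pi * (Gamma k / l powr k - Gamma (k + 3) / l powr (k + 3))
      = (LINT u|lborel. sin (pi * k) / pi *
      (exp (- (l * exp u)) * exp (k * u) - exp (- (l * exp u)) * exp ((k + 3) * u)))"
    by (rule has_bochner_integral_integral_eq[OF *, symmetric])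
  also have "\<dots> \<le> edge_laplace l"
    unfolding edge_laplace_def
  proof (rule integral_mono)
    fix u
    from mult_left_mono[OF edge_weight_ge[OF k_def[THEN meta_eq_to_obj_eq], of u], of "exp (- (l * exp u))"]
    show "sin (pi * k) / pi *
      (exp (- (l * exp u)) * exp (k * u) - exp (- (l * exp u)) * exp ((k + 3) * u))
      \<le> exp (- (l * exp u)) * edge_weight u"
      by (simp add: algebra_simps)
  qed (rule integrable.intros[OF *], rule integrable_edge_laplace, use l in simp)
  also have "sin (pi * k) / pi * (Gamma k / l powr k - Gamma (k + 3) / l powr (k + 3))
      = sin (pi * k) * Gamma k / pi * (1 - k * (k + 1) * (k + 2) / l ^ 3) / l powr k"
  proof -
    have gamma_step: "Gamma (z + 1) = z * Gamma z" if "0 < z" for z :: real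
      using that nonpos_Ints_nonpos[of z] by (intro Gamma_plus1) auto
    have "Gamma (k + 3) = (k + 2) * Gamma (k + 2)" "Gamma (k + 2) = (k + 1) * Gamma (k + 1)"
        "Gamma (k + 1) = k * Gamma k"
      using gamma_step[of "k + 2"] gamma_step[of "k + 1"] gamma_step[of k] k by (simp_all add: add.assoc)
    then have "Gamma (k + 3) = (k + 2) * ((k + 1) * (k * Gamma k))"
      by (simp only:)
    moreover have "l powr (k + 3) = l powr k * l ^ 3"
      using l by (simp add: powr_add powr_numeral)
    ultimately show ?thesis using l by (simp add: field_simps)
  qed
  also have "sin (pi * k) * Gamma k / pi = 1 / Gamma (1 - k)"
  proof -
    have "0 < Gamma (1 - k)" using k by (intro Gamma_real_pos) auto
    then have "Gamma (1 - k) \<noteq> 0" by simp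
    then show ?thesis using Gamma_reflection_real[of k] s by (simp add: field_simps)
  qed
  finally show ?thesis by (simp add: mult_ac)
qed

text \<open>
  Since \<open>sin (pi / r) \<le> 1\<close>, the hypothesis holds whenever the phase has passed \<open>5 * pi / 2\<close>. Both
  sides tend to 1 as \<open>r\<close> tends to 2, which leaves no room for a constant factor; therefore every
  factor is estimated by the \<open>k\<close>-th power of a constant, where \<open>k = 2 - r\<close>. The proof comes down
  to \<open>(16/9) * pi \<le> (61/10) * (23/25)\<close>: here \<open>(16/9) powr k\<close> bounds \<open>2 / r\<close>, \<open>(23/25) powr k\<close>
  bounds the correction in the lower estimate of the weight, \<open>pi powr k\<close> bounds the Gamma
  function, and \<open>((61/10) * l) powr k\<close> is what the exponential decay provides.
\<close>

lemma edge_laplace_dominates: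
  assumes l: "pi * (5 / 2 - 2 / r) \<le> l"
  shows "2 / r * exp (cos (pi / r) * l) \<le> edge_laplace l"
proof -
  define k c m where "k = 2 - r" and "c = - cos (pi / r)" and "m = pi * (5 / 2 - 2 / r)"
  have k: "0 < k" "k < 1 / 2" using r by (auto simp: k_def)
  have inv_r: "1 / 2 < 1 / r" "1 / r < 2 / 3" using r by (auto simp: field_simps)
  have two_r: "2 / r = 2 * (1 / r)" by simp
  have l_lower: "(183/50) \<le> m"
  proof -
    have "183 / 50 \<le> (157 / 50) * (7 / 6 :: real)" by simp
    also have "\<dots> \<le> pi * (5 / 2 - 2 / r)"
      unfolding two_r using inv_r pi_bounds by (intro mult_mono) auto
    finally show ?thesis by (simp add: m_def)
  qed
  have l_upper: "m \<le> (189/40)"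
  proof -
    have "pi * (5 / 2 - 2 / r) \<le> (63/20) * (3 / 2)"
      unfolding two_r using inv_r pi_bounds by (intro mult_mono) auto
    then show ?thesis by (simp add: m_def)
  qed
  have "m \<le> l" using l by (simp add: m_def)
  then have l0: "m \<le> l" "0 < l" using l_lower by linarith+
  have c_ge: "(19/20) * (pi * k / (2 * r)) \<le> c"
  proof -
    have "c = sin (pi * k / (2 * r))"
    proof -
      have "pi * k / (2 * r) = pi / r - pi / 2" using r by (simp add: k_def field_simps)
      then show ?thesis by (simp add: c_def sin_diff)
    qed
    moreover have "pi * k / (2 * r) \<le> pi / 6"
      using r by (simp add: k_def field_simps)
    ultimately show ?thesis using sin_ge_linear[of "pi * k / (2 * r)"] k r by simp
  qed
  define B where "B = (19/20) * (pi / (2 * r))"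
  have B_l: "(7/2) \<le> B * m"
  proof -
    have "0 \<le> (1 / r - 1 / 2) * (3 / 4 - 1 / r)"
      using inv_r by (intro mult_nonneg_nonneg) auto
    then have h2: "3 / 4 \<le> 1 / r * (5 / 2 - 2 / r)"
      by (simp add: algebra_simps)
    have h1: "(157/50) * (157/50) \<le> pi * pi" using pi_bounds by (intro mult_mono) auto
    have h3: "(157/50) * (157/50) * (3 / 4) \<le> pi * pi * (1 / r * (5 / 2 - 2 / r))"
      by (rule mult_mono[OF h1 h2]) auto
    have "7 / 2 \<le> (19/40) * ((157/50) * (157/50) * (3 / 4) :: real)" by simp
    also have "\<dots> \<le> (19/40) * (pi * pi * (1 / r * (5 / 2 - 2 / r)))"
      using h3 by (rule mult_left_mono) simp
    also have "\<dots> = B * m" by (simp add: B_def m_def)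
    finally show ?thesis by simp
  qed
  have "ln ((61/10) * l) \<le> B * l"
  proof -
    have e: "(61/10) * m \<le> exp (7/2)"
    proof -
      have "(13/8) \<le> exp (1 / 2 :: real)"
        using exp_lower_Taylor_quadratic[of "1/2 :: real"] by (simp add: power2_eq_square)
      then have "(13/8) ^ 7 \<le> exp (1 / 2 :: real) ^ 7" by (intro power_mono) auto
      also have "\<dots> = exp ((7/2) :: real)" by (simp flip: exp_of_nat_mult)
      finally have "(289/10) \<le> exp ((7/2) :: real)" by (simp add: power_numeral_reduce)
      then show ?thesis using l_upper by simp
    qed
    define q where "q = l / m"
    have q: "1 \<le> q" "l = q * m" using l0 l_lower by (auto simp: q_def)
    have "ln ((61/10) * l) = ln ((61/10) * m) + ln q"
      using ln_mult[of "(61/10) * m" q] q l_lower by (simp add: mult_ac)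
    also have "\<dots> \<le> (7/2) + (q - 1)"
    proof (rule add_mono)
      have "ln ((61/10) * m) \<le> ln (exp (7/2))" by (rule ln_mono[OF e]) (use l_lower in simp)
      then show "ln ((61/10) * m) \<le> 7/2" by simp
      show "ln q \<le> q - 1" using q by (intro ln_le_minus_one) auto
    qed
    also have "\<dots> \<le> (7/2) * q" using q by simp
    also have "\<dots> \<le> (B * m) * q" using B_l q by (intro mult_right_mono) auto
    also have "(B * m) * q = B * l" using q(2) by simp
    finally show ?thesis .
  qed
  then have "k * ln ((61/10) * l) \<le> k * (B * l)" using k by (intro mult_left_mono) auto
  also have "\<dots> = ((19/20) * (pi * k / (2 * r))) * l" by (simp add: B_def)
  also have "\<dots> \<le> c * l" using c_ge l0 by (intro mult_right_mono) auto
  finally have cl: "((61/10) * l) powr k \<le> exp (c * l)" using l0 by (simp add: powr_def)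
  have a: "(23/25) powr k \<le> 1 - k * (k + 1) * (k + 2) / l ^ 3"
  proof -
    have "(183/50) ^ 3 \<le> l ^ 3" using l_lower l0 by (intro power_mono) auto
    then have l3: "49 \<le> l ^ 3" by (simp add: power_numeral_reduce)
    have "(k + 1) * (k + 2) \<le> (3 / 2) * (5 / 2)" using k by (intro mult_mono) auto
    then have "k * ((k + 1) * (k + 2)) \<le> k * (15/4)" using k by (intro mult_left_mono) auto
    then have "k * (k + 1) * (k + 2) / l ^ 3 \<le> k * (15/4) / 49"
      using l3 k by (intro frac_le) (auto simp: mult.assoc)
    also have "\<dots> \<le> k * (2/25)" using k by simp
    finally show ?thesis using powr_le_linear[of "23/25" k] k by simp
  qed
  have b: "2 / r \<le> (16 / 9) powr k"
  proof -
    have "(9 / 16 :: real) powr k = (3 / 4) powr (2 * k)"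
    proof -
      have "(3 / 4 :: real) powr (2 * k) = ((3 / 4) powr 2) powr k" by (simp only: powr_powr)
      also have "(3 / 4 :: real) powr 2 = 9 / 16" by (simp add: power2_eq_square)
      finally show ?thesis by simp
    qed
    also have "\<dots> \<le> 1 - 2 * k + 2 * k * (3 / 4)" using k by (intro powr_le_linear) auto
    also have "\<dots> = r / 2" by (simp add: k_def field_simps)
    finally have le: "(9 / 16) powr k \<le> r / 2" .
    have "1 / (r / 2) \<le> 1 / (9 / 16) powr k" by (rule divide_left_mono[OF le]) (use r in auto)
    also have "1 / (9 / 16 :: real) powr k = (16 / 9) powr k"
      by (simp add: powr_divide)
    finally show ?thesis by simp
  qed
  have "2 / r * exp (cos (pi / r) * l) = 2 / r / exp (c * l)"
    by (simp add: c_def exp_minus divide_inverse)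
  also have "\<dots> \<le> (16 / 9) powr k / ((61/10) * l) powr k"
    using b cl l0 r by (intro frac_le) auto
  also have "\<dots> = (16 / 9 / (61/10)) powr k / l powr k"
  proof -
    have "a powr k / (b * l) powr k = (a / b) powr k / l powr k" if "0 < a" "0 < b" for a b
      using that l0 by (simp add: powr_mult powr_divide)
    from this[of "16 / 9" "61/10"] show ?thesis by simp
  qed
  also have "\<dots> \<le> ((23/25) / pi) powr k / l powr k"
  proof -
    have "16 / 9 / (61/10) \<le> (23/25) / pi" using pi_bounds by (simp add: pos_le_divide_eq)
    then show ?thesis using k by (intro divide_right_mono powr_mono2) auto
  qed
  also have "\<dots> = (23/25) powr k / (pi powr k * l powr k)"
  proof -
    have "(a / b) powr k / L = a powr k / (b powr k * L)" if "0 < a" "0 < b" for a b L :: real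
      using that by (simp add: powr_divide)
    from this[of "23/25" pi "l powr k"] show ?thesis by simp
  qed
  also have "\<dots> \<le> (1 - k * (k + 1) * (k + 2) / l ^ 3) / (Gamma (1 - k) * l powr k)"
  proof (rule frac_le[OF _ a])
    have G: "0 < Gamma (1 - k)" "Gamma (1 - k) \<le> pi powr k"
      using k by (auto intro!: Gamma_real_pos Gamma_one_minus_le)
    show "0 < Gamma (1 - k) * l powr k" using G l0 by simp
    show "Gamma (1 - k) * l powr k \<le> pi powr k * l powr k" using G by (intro mult_right_mono) auto
    show "0 \<le> 1 - k * (k + 1) * (k + 2) / l ^ 3" by (rule order_trans[OF _ a]) simp
  qed
  also have "\<dots> \<le> edge_laplace l"
    using edge_laplace_ge[OF l0(2)] by (simp add: k_def)
  finally show ?thesis .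
qed

text \<open>
  The case distinction is on the phase of the oscillation.
\<close>

lemma inverse_laplace_nonneg:
  assumes l: "0 \<le> l"
  shows "0 \<le> inverse_laplace l"
proof -
  define \<psi> where "\<psi> = 2 * pi / r + sin (pi / r) * l"
  have s: "0 < sin (pi / r)" "sin (pi / r) \<le> 1"
    using pi_div_r pi_gt_zero by (intro sin_gt_zero, linarith, linarith) simp
  consider "\<psi> \<le> 3 * pi / 2" | "3 * pi / 2 \<le> \<psi>" "\<psi> \<le> 5 * pi / 2" | "5 * pi / 2 \<le> \<psi>" by linarith
  then show ?thesis
  proof cases
    case 1
    then show ?thesis using inverse_laplace_nonneg_small[OF l] by (simp add: \<psi>_def)
  next
    case 2
    then have "0 \<le> cos (\<psi> - 2 * pi)" by (intro cos_ge_zero) auto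
    then have "0 \<le> cos \<psi>" by (simp add: cos_diff)
    then show ?thesis
      unfolding inverse_laplace_def \<psi>_def[symmetric] using edge_laplace_nonneg r by (intro add_nonneg_nonneg) auto
  next
    case 3
    have "pi * (5 / 2 - 2 / r) \<le> sin (pi / r) * l" using 3 by (simp add: \<psi>_def algebra_simps)
    also have "\<dots> \<le> 1 * l" using s l by (intro mult_right_mono) auto
    finally have "2 / r * exp (cos (pi / r) * l) \<le> edge_laplace l"
      using edge_laplace_dominates by simp
    moreover have "2 / r * exp (cos (pi / r) * l) * (- 1) \<le> 2 / r * exp (cos (pi / r) * l) * cos \<psi>"
      using r by (intro mult_left_mono) auto
    ultimately show ?thesis unfolding inverse_laplace_def \<psi>_def[symmetric] by (simp add: mult.assoc)
  qed
qed

text \<open>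
  Twice the Laplace transform is the Stieltjes transform, by Fubini's theorem.
\<close>

lemma laplace_edge_laplace:
  assumes x: "0 < x"
  shows "has_bochner_integral lborel (\<lambda>l. indicator {0<..} l * (exp (- (x * l)) * edge_laplace l))
     (x powr (1 - r) / (1 + x powr r) - 2 / r * Re (cis (pi / r) ^ 2 / (of_real x - cis (pi / r))))"
    (is "has_bochner_integral _ ?f ?I")
proof -
  note st = has_bochner_integral_of_has_integral[OF _ _ edge_weight_stieltjes[OF x]]
  have nn_I: "(\<integral>\<^sup>+u. ennreal (edge_weight u / (x + exp u)) \<partial>lborel) = ennreal ?I"
    by (rule nn_integral_has_integral_lborel[OF _ _ edge_weight_stieltjes[OF x]])
       (use x edge_weight_nonneg in \<open>auto intro!: divide_nonneg_nonneg add_nonneg_nonneg\<close>)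
  have I: "0 \<le> ?I"
    by (rule has_integral_nonneg[OF edge_weight_stieltjes[OF x]])
       (use x edge_weight_nonneg in \<open>auto intro!: divide_nonneg_nonneg add_nonneg_nonneg\<close>)
  have inner: "(\<integral>\<^sup>+l. ennreal (exp (- (a * l))) * indicator {0..} l \<partial>lborel) = ennreal (1 / a)"
    if a: "0 < a" for a :: real
  proof -
    have "(\<integral>\<^sup>+l. ennreal (exp (- (a * l))) * indicator {0..} l \<partial>lborel)
        = ennreal (0 - (- exp (- (a * 0)) / a))"
    proof (rule nn_integral_FTC_atLeast)
      show "((\<lambda>l. - exp (- (a * l)) / a) \<longlongrightarrow> 0) at_top"
        using a by real_asymp
    qed (use a in \<open>auto intro!: derivative_eq_intros\<close>)
    then show ?thesis by simp
  qed
  have el: "ennreal (edge_laplace l) = (\<integral>\<^sup>+u. ennreal (exp (- (l * exp u)) * edge_weight u) \<partial>lborel)" if "0 \<le> l" for l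
    unfolding edge_laplace_def using integrable_edge_laplace[OF that] edge_weight_nonneg
    by (subst nn_integral_eq_integral) auto
  have meas: "edge_laplace \<in> borel_measurable borel"
    unfolding edge_laplace_def by measurable
  have "(\<integral>\<^sup>+l. ennreal (?f l) \<partial>lborel)
      = (\<integral>\<^sup>+l. (\<integral>\<^sup>+u. ennreal (edge_weight u) * (ennreal (exp (- ((x + exp u) * l))) * indicator {0<..} l) \<partial>lborel) \<partial>lborel)"
  proof (rule nn_integral_cong)
    fix l :: real
    show "ennreal (?f l) = (\<integral>\<^sup>+u. ennreal (edge_weight u) * (ennreal (exp (- ((x + exp u) * l))) * indicator {0<..} l) \<partial>lborel)"
    proof (cases "0 < l")
      case True
      then have "ennreal (?f l) = ennreal (exp (- (x * l))) * (\<integral>\<^sup>+u. ennreal (exp (- (l * exp u)) * edge_weight u) \<partial>lborel)"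
        using el[of l] by (simp add: ennreal_mult' )
      also have "\<dots> = (\<integral>\<^sup>+u. ennreal (exp (- (x * l))) * ennreal (exp (- (l * exp u)) * edge_weight u) \<partial>lborel)"
        by (subst nn_integral_cmult) auto
      also have "\<dots> = (\<integral>\<^sup>+u. ennreal (edge_weight u) * (ennreal (exp (- ((x + exp u) * l))) * indicator {0<..} l) \<partial>lborel)"
      proof (rule nn_integral_cong)
        fix u
        have "exp (- (x * l)) * (exp (- (l * exp u)) * edge_weight u) = edge_weight u * exp (- ((x + exp u) * l))"
          by (simp add: exp_add[symmetric] mult_ac flip: mult.assoc) (simp add: algebra_simps exp_add exp_diff)
        then show "ennreal (exp (- (x * l))) * ennreal (exp (- (l * exp u)) * edge_weight u)
            = ennreal (edge_weight u) * (ennreal (exp (- ((x + exp u) * l))) * indicator {0<..} l)"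
          using True edge_weight_nonneg[of u] by (simp flip: ennreal_mult')
      qed
      finally show ?thesis .
    qed simp
  qed
  also have "\<dots> = (\<integral>\<^sup>+u. (\<integral>\<^sup>+l. ennreal (edge_weight u) * (ennreal (exp (- ((x + exp u) * l))) * indicator {0<..} l) \<partial>lborel) \<partial>lborel)"
    by (rule lborel_pair.Fubini') measurable
  also have "\<dots> = (\<integral>\<^sup>+u. ennreal (edge_weight u / (x + exp u)) \<partial>lborel)"
  proof (rule nn_integral_cong)
    fix u
    have "(\<integral>\<^sup>+l. ennreal (exp (- ((x + exp u) * l))) * indicator {0<..} l \<partial>lborel)
        = (\<integral>\<^sup>+l. ennreal (exp (- ((x + exp u) * l))) * indicator {0..} l \<partial>lborel)"
    proof (rule nn_integral_cong_AE)
      show "AE l in lborel. ennreal (exp (- ((x + exp u) * l))) * indicator {0<..} l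
          = ennreal (exp (- ((x + exp u) * l))) * indicator {0..} l"
        using AE_lborel_singleton[of "0::real"] by eventually_elim (auto simp: indicator_def)
    qed
    also have "\<dots> = ennreal (1 / (x + exp u))" by (rule inner) (use x in \<open>simp add: add_pos_pos\<close>)
    finally show "(\<integral>\<^sup>+l. ennreal (edge_weight u) * (ennreal (exp (- ((x + exp u) * l))) * indicator {0<..} l) \<partial>lborel)
        = ennreal (edge_weight u / (x + exp u))"
      using edge_weight_nonneg[of u] x
      by (subst nn_integral_cmult) (auto simp flip: ennreal_mult')
  qed
  finally have "(\<integral>\<^sup>+l. ennreal (?f l) \<partial>lborel) = ennreal ?I" unfolding nn_I .
  then show ?thesis
    using I edge_laplace_nonneg meas by (intro has_bochner_integral_nn_integral) auto
qed

text \<open>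
  The real part of the integral of \<open>\<xi>\<^sup>2 * exp (- ((x - \<xi>) * l))\<close> with \<open>\<xi> = cis (pi / r)\<close>. It
  converges for all \<open>x > 0\<close> because \<open>\<xi>\<close> lies in the left half plane.
\<close>

lemma laplace_oscillation:
  assumes x: "0 < x"
  shows "has_bochner_integral lborel
     (\<lambda>l. indicator {0<..} l * (exp (- (x * l)) * (exp (cos (pi / r) * l) * cos (2 * pi / r + sin (pi / r) * l))))
     (Re (cis (pi / r) ^ 2 / (of_real x - cis (pi / r))))"
proof -
  define \<xi> w where "\<xi> = cis (pi / r)" and "w = of_real x - \<xi>"
  have "cos (pi / r) < 0"
  proof -
    have "0 < cos (pi - pi / r)" using pi_div_r pi_gt_zero by (intro cos_gt_zero_pi) linarith+
    then show ?thesis by (simp add: cos_diff)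
  qed
  then have Re_w: "0 < Re w" using x by (simp add: w_def \<xi>_def)
  then have w0: "w \<noteq> 0" by auto
  have int: "set_integrable lborel {0<..} (\<lambda>l. exp (- (w * of_real l)))"
    unfolding set_integrable_def
  proof (rule Bochner_Integration.integrable_bound)
    show "integrable lborel (\<lambda>l. indicator {0<..} l *\<^sub>R exp (- (l * Re w)))"
      using integrable_I0i_exp_mscale[OF Re_w] by (simp add: set_integrable_def)
  qed (auto simp: indicator_def mult.commute)
  have "(LBINT l=0..\<infinity>. exp (- (w * of_real l))) = 0 - (- (1 / w))"
  proof (rule interval_integral_FTC_integrable[where F = "\<lambda>l. - exp (- (w * of_real l)) / w"])
    fix l :: real
    show "((\<lambda>l. - exp (- (w * of_real l)) / w) has_vector_derivative exp (- (w * of_real l))) (at l)"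
      using w0 by (auto intro!: derivative_eq_intros has_vector_derivative_real_field)
    show "isCont (\<lambda>l. exp (- (w * of_real l))) l" by (intro continuous_intros)
  next
    show "set_integrable lborel (einterval 0 \<infinity>) (\<lambda>l. exp (- (w * of_real l)))"
      using int by (simp add: einterval_eq zero_ereal_def)
    have "((\<lambda>l. - exp (- (w * of_real l)) / w) \<longlongrightarrow> - exp (- (w * of_real 0)) / w) (at_right 0)"
      by (intro tendsto_intros w0)
    then show "(((\<lambda>l. - exp (- (w * of_real l)) / w) \<circ> real_of_ereal) \<longlongrightarrow> - (1 / w)) (at_right 0)"
      unfolding zero_ereal_def ereal_tendsto_simps1(2)[symmetric]
      by (simp add: ereal_tendsto_simps comp_def)
    have "((\<lambda>l. norm (- exp (- (w * of_real l)) / w)) \<longlongrightarrow> 0) at_top"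
    proof -
      have "((\<lambda>l. exp (- (Re w * l)) / norm w) \<longlongrightarrow> 0 / norm w) at_top"
        using Re_w w0 by (intro tendsto_divide tendsto_const) (real_asymp, simp)
      then show ?thesis by (simp add: norm_divide)
    qed
    then have "((\<lambda>l. - exp (- (w * of_real l)) / w) \<longlongrightarrow> 0) at_top"
      by (simp only: tendsto_norm_zero_iff)
    then show "(((\<lambda>l. - exp (- (w * of_real l)) / w) \<circ> real_of_ereal) \<longlongrightarrow> 0) (at_left \<infinity>)"
      by (simp only: ereal_tendsto_simps1)
  qed auto
  then have "(LINT l|lborel. indicator {0<..} l *\<^sub>R exp (- (w * of_real l))) = 1 / w"
    by (simp add: interval_lebesgue_integral_def einterval_eq zero_ereal_def set_lebesgue_integral_def)
  then have "has_bochner_integral lborel (\<lambda>l. indicator {0<..} l *\<^sub>R exp (- (w * of_real l))) (1 / w)"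
    using int by (simp add: has_bochner_integral_iff set_integrable_def)
  then have "has_bochner_integral lborel (\<lambda>l. \<xi>\<^sup>2 * (indicator {0<..} l *\<^sub>R exp (- (w * of_real l)))) (\<xi>\<^sup>2 * (1 / w))"
    by (intro has_bochner_integral_mult_right) auto
  then have "has_bochner_integral lborel (\<lambda>l. Re (\<xi>\<^sup>2 * (indicator {0<..} l *\<^sub>R exp (- (w * of_real l))))) (Re (\<xi>\<^sup>2 * (1 / w)))"
    by (rule has_bochner_integral_Re)
  moreover have "Re (\<xi>\<^sup>2 * (indicator {0<..} l *\<^sub>R exp (- (w * of_real l))))
     = indicator {0<..} l * (exp (- (x * l)) * (exp (cos (pi / r) * l) * cos (2 * pi / r + sin (pi / r) * l)))" for l
  proof -
    have "\<xi>\<^sup>2 * exp (- (w * of_real l)) = of_real (exp (- (x * l)) * exp (cos (pi / r) * l)) * cis (2 * pi / r + sin (pi / r) * l)"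
    proof -
      have "- (w * of_real l) = of_real (- (x * l) + cos (pi / r) * l) + \<i> * of_real (sin (pi / r) * l)"
        by (simp add: complex_eq_iff w_def \<xi>_def algebra_simps)
      then have "exp (- (w * of_real l)) = of_real (exp (- (x * l) + cos (pi / r) * l)) * cis (sin (pi / r) * l)"
        by (simp only: exp_add exp_of_real cis_conv_exp)
      moreover have "\<xi>\<^sup>2 = cis (2 * pi / r)" by (simp add: \<xi>_def Complex.DeMoivre)
      ultimately show ?thesis
        by (simp only: exp_add of_real_mult cis_mult[symmetric] mult_ac)
    qed
    then have "Re (\<xi>\<^sup>2 * exp (- (w * of_real l))) = exp (- (x * l)) * exp (cos (pi / r) * l) * cos (2 * pi / r + sin (pi / r) * l)"
      by simp
    then show ?thesis by (simp add: indicator_def)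
  qed
  ultimately have "has_bochner_integral lborel
     (\<lambda>l. indicator {0<..} l * (exp (- (x * l)) * (exp (cos (pi / r) * l) * cos (2 * pi / r + sin (pi / r) * l))))
     (Re (\<xi>\<^sup>2 * (1 / w)))" by (simp only:)
  then show ?thesis by (simp add: w_def \<xi>_def)
qed

lemma laplace_inverse_laplace:
  assumes x: "0 < x"
  shows "has_bochner_integral lborel (\<lambda>l. indicator {0<..} l * (exp (- (x * l)) * inverse_laplace l))
     (x powr (1 - r) / (1 + x powr r))"
proof -
  have "has_bochner_integral lborel (\<lambda>l. indicator {0<..} l * (exp (- (x * l)) * edge_laplace l)
      + 2 / r * (indicator {0<..} l * (exp (- (x * l)) * (exp (cos (pi / r) * l) * cos (2 * pi / r + sin (pi / r) * l)))))
     (x powr (1 - r) / (1 + x powr r) - 2 / r * Re (cis (pi / r) ^ 2 / (of_real x - cis (pi / r)))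
      + 2 / r * Re (cis (pi / r) ^ 2 / (of_real x - cis (pi / r))))"
    by (intro has_bochner_integral_add has_bochner_integral_mult_right laplace_edge_laplace laplace_oscillation x)
  then show ?thesis
    by (simp add: inverse_laplace_def algebra_simps)
qed

lemma inverse_laplace_measurable: "inverse_laplace \<in> borel_measurable borel"
  unfolding inverse_laplace_def edge_laplace_def by measurable

end

section \<open>Completely monotone functions\<close>

inductive exp_mixture :: "(real \<Rightarrow> real) \<Rightarrow> bool" where
  zero: "exp_mixture (\<lambda>_. 0)"
| add_exp: "exp_mixture f \<Longrightarrow> 0 \<le> c \<Longrightarrow> 0 \<le> l \<Longrightarrow> exp_mixture (\<lambda>x. f x + c * exp (- (l * x)))"

lemma exp_mixture_exp: "0 \<le> c \<Longrightarrow> 0 \<le> l \<Longrightarrow> exp_mixture (\<lambda>x. c * exp (- (l * x)))"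
  using exp_mixture.add_exp[OF exp_mixture.zero] by simp

lemma exp_mixture_add:
  assumes "exp_mixture f" "exp_mixture g"
  shows "exp_mixture (\<lambda>x. f x + g x)"
  using assms(2)
proof induction
  case zero
  then show ?case using assms(1) by simp
next
  case (add_exp g c l)
  from exp_mixture.add_exp[OF add_exp.IH add_exp.hyps(2,3)] show ?case by (simp add: add.assoc)
qed

lemma exp_mixture_mult:
  assumes "exp_mixture f" "exp_mixture g"
  shows "exp_mixture (\<lambda>x. f x * g x)"
  using assms(2)
proof induction
  case zero
  then show ?case by (simp add: exp_mixture.zero)
next
  case (add_exp g c l)
  have "exp_mixture (\<lambda>x. f x * (c * exp (- (l * x))))"
    using assms(1)
  proof induction
    case zero
    then show ?case by (simp add: exp_mixture.zero)
  next
    case (add_exp f c' l')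
    from exp_mixture.add_exp[OF add_exp.IH, of "c' * c" "l' + l"] add_exp.hyps \<open>0 \<le> c\<close> \<open>0 \<le> l\<close>
    show ?case by (simp add: algebra_simps exp_add exp_diff exp_minus divide_inverse)
  qed
  from exp_mixture_add[OF add_exp.IH this] show ?case by (simp add: algebra_simps)
qed

lemma exp_mixture_imp_sum:
  assumes "exp_mixture f"
  shows "\<exists>(n::nat) c l. (\<forall>i<n. 0 \<le> c i \<and> 0 \<le> l i) \<and> f = (\<lambda>x. \<Sum>i<n. c i * exp (- (l i * x)))"
  using assms
proof induction
  case zero
  show ?case by (intro exI[of _ 0]) auto
next
  case (add_exp f a b)
  then obtain n :: nat and c l where IH: "\<forall>i<n. 0 \<le> c i \<and> 0 \<le> l i"
    "f = (\<lambda>x. \<Sum>i<n. c i * exp (- (l i * x)))" by blast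
  show ?case
    by (rule exI[of _ "Suc n"], rule exI[of _ "c(n := a)"], rule exI[of _ "l(n := b)"])
       (use IH add_exp.hyps in \<open>auto simp: less_Suc_eq\<close>)
qed

lemma exp_mixture_antimono: "exp_mixture f \<Longrightarrow> x \<le> y \<Longrightarrow> f y \<le> f x"
proof (induction rule: exp_mixture.induct)
  case (add_exp f c l)
  have "exp (- (l * y)) \<le> exp (- (l * x))" using add_exp by (simp add: mult_left_mono)
  then show ?case using add_exp by (simp add: add_mono mult_left_mono)
qed simp

text \<open>
  By Bernstein's theorem these are the completely monotone functions on the positive half line.
  Approximation on finite sets by finite mixtures makes the closure properties immediate, and it
  is the form in which complete monotonicity is used later: a coefficient of a logarithmic
  derivative involves finitely many values of \<open>g\<close>.
\<close>

definition comp_mono :: "(real \<Rightarrow> real) \<Rightarrow> bool" where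
  "comp_mono g \<longleftrightarrow> (\<forall>X \<epsilon>. finite X \<longrightarrow> X \<subseteq> {0<..} \<longrightarrow> 0 < \<epsilon> \<longrightarrow>
     (\<exists>f. exp_mixture f \<and> (\<forall>x\<in>X. \<bar>f x - g x\<bar> < \<epsilon>)))"

lemma comp_monoD:
  assumes "comp_mono g" "finite X" "X \<subseteq> {0<..}" "0 < \<epsilon>"
  obtains f where "exp_mixture f" "\<And>x. x \<in> X \<Longrightarrow> \<bar>f x - g x\<bar> < \<epsilon>"
  using assms(1)[unfolded comp_mono_def, rule_format, OF assms(2-4)] that by blast

lemma comp_mono_exp_mixture: "exp_mixture f \<Longrightarrow> comp_mono f"
  unfolding comp_mono_def by (intro allI impI, rule exI[of _ f]) simp

lemma comp_mono_limit:
  assumes "\<forall>\<^sub>F n in F. comp_mono (f n)" "F \<noteq> bot" "\<And>x. 0 < x \<Longrightarrow> ((\<lambda>n. f n x) \<longlongrightarrow> g x) F"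
  shows "comp_mono g"
  unfolding comp_mono_def
proof (intro allI impI)
  fix X :: "real set" and \<epsilon> :: real
  assume X: "finite X" "X \<subseteq> {0<..}" "0 < \<epsilon>"
  have "\<forall>\<^sub>F n in F. \<forall>x\<in>X. dist (f n x) (g x) < \<epsilon> / 2"
    using X assms(3) by (intro eventually_ball_finite ballI tendstoD) auto
  then have "\<forall>\<^sub>F n in F. comp_mono (f n) \<and> (\<forall>x\<in>X. dist (f n x) (g x) < \<epsilon> / 2)"
    using assms(1) by eventually_elim auto
  then obtain n where n: "comp_mono (f n)" "\<forall>x\<in>X. dist (f n x) (g x) < \<epsilon> / 2"
    using assms(2) eventually_happens' by blast
  have e2: "0 < \<epsilon> / 2" using X by simp
  obtain h where h: "exp_mixture h" "\<And>x. x \<in> X \<Longrightarrow> \<bar>h x - f n x\<bar> < \<epsilon> / 2"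
    by (rule comp_monoD[OF n(1) X(1,2) e2]) blast
  have "\<bar>h x - g x\<bar> < \<epsilon>" if "x \<in> X" for x
  proof -
    have "\<bar>f n x - g x\<bar> < \<epsilon> / 2" using n(2) that by (simp add: dist_real_def)
    then show ?thesis using h(2)[OF that] by linarith
  qed
  then show "\<exists>f. exp_mixture f \<and> (\<forall>x\<in>X. \<bar>f x - g x\<bar> < \<epsilon>)" using h(1) by blast
qed

lemma comp_mono_cong:
  assumes "comp_mono f" "\<And>x. 0 < x \<Longrightarrow> f x = g x"
  shows "comp_mono g"
proof (rule comp_mono_limit[OF always_eventually sequentially_bot])
  show "\<forall>n. comp_mono f" using assms(1) by blast
  show "(\<lambda>n. f x) \<longlonglongrightarrow> g x" if "0 < x" for x using assms(2)[OF that] by simp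
qed

lemma comp_mono_approx:
  assumes "comp_mono g" "finite X" "X \<subseteq> {0<..}"
  shows "\<exists>f. (\<forall>n. exp_mixture (f n)) \<and> (\<forall>x\<in>X. (\<lambda>n. f n x) \<longlonglongrightarrow> g x)"
proof -
  have "\<exists>f. exp_mixture f \<and> (\<forall>x\<in>X. \<bar>f x - g x\<bar> < 1 / real (Suc n))" for n
  proof -
    have "0 < 1 / real (Suc n)" by simp
    from assms(1)[unfolded comp_mono_def, rule_format, OF assms(2,3) this] show ?thesis .
  qed
  then obtain f where f: "\<And>n. exp_mixture (f n)" "\<And>n x. x \<in> X \<Longrightarrow> \<bar>f n x - g x\<bar> < 1 / real (Suc n)"
    by metis
  have "(\<lambda>n. f n x) \<longlonglongrightarrow> g x" if "x \<in> X" for x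
  proof (rule LIM_zero_cancel, rule Lim_null_comparison)
    show "\<forall>\<^sub>F n in sequentially. norm (f n x - g x) \<le> 1 / real (Suc n)"
      by (intro always_eventually allI) (unfold real_norm_def, rule less_imp_le, rule f(2)[OF that])
    show "(\<lambda>n. 1 / real (Suc n)) \<longlonglongrightarrow> 0" by real_asymp
  qed
  with f(1) show ?thesis by blast
qed

lemma comp_mono_binary:
  assumes f: "comp_mono f" and g: "comp_mono g"
    and op: "\<And>f g. exp_mixture f \<Longrightarrow> exp_mixture g \<Longrightarrow> exp_mixture (\<lambda>x. h (f x) (g x))"
    and lim: "\<And>a b x y. a \<longlonglongrightarrow> x \<Longrightarrow> b \<longlonglongrightarrow> y \<Longrightarrow> (\<lambda>n. h (a n) (b n)) \<longlonglongrightarrow> h x y"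
  shows "comp_mono (\<lambda>x. h (f x) (g x))"
  unfolding comp_mono_def
proof (intro allI impI)
  fix X :: "real set" and \<epsilon> :: real
  assume X: "finite X" "X \<subseteq> {0<..}" "0 < \<epsilon>"
  obtain F where F: "\<And>n. exp_mixture (F n)" "\<And>x. x \<in> X \<Longrightarrow> (\<lambda>n. F n x) \<longlonglongrightarrow> f x"
    using comp_mono_approx[OF f X(1,2)] by blast
  obtain G where G: "\<And>n. exp_mixture (G n)" "\<And>x. x \<in> X \<Longrightarrow> (\<lambda>n. G n x) \<longlonglongrightarrow> g x"
    using comp_mono_approx[OF g X(1,2)] by blast
  have "\<forall>\<^sub>F n in sequentially. \<forall>x\<in>X. dist (h (F n x) (G n x)) (h (f x) (g x)) < \<epsilon>"
    using X F G by (intro eventually_ball_finite ballI tendstoD lim) auto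
  then obtain n where "\<forall>x\<in>X. dist (h (F n x) (G n x)) (h (f x) (g x)) < \<epsilon>"
    using eventually_happens'[OF sequentially_bot] by blast
  then show "\<exists>f'. exp_mixture f' \<and> (\<forall>x\<in>X. \<bar>f' x - h (f x) (g x)\<bar> < \<epsilon>)"
    using op[OF F(1) G(1)] by (intro exI[of _ "\<lambda>x. h (F n x) (G n x)"]) (auto simp: dist_real_def)
qed

lemma comp_mono_add: "comp_mono f \<Longrightarrow> comp_mono g \<Longrightarrow> comp_mono (\<lambda>x. f x + g x)"
  by (rule comp_mono_binary[where h = "(+)", OF _ _ exp_mixture_add tendsto_add])

lemma comp_mono_mult: "comp_mono f \<Longrightarrow> comp_mono g \<Longrightarrow> comp_mono (\<lambda>x. f x * g x)"
  by (rule comp_mono_binary[where h = times, OF _ _ exp_mixture_mult tendsto_mult])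

lemma comp_mono_const: "0 \<le> c \<Longrightarrow> comp_mono (\<lambda>_. c)"
  using comp_mono_exp_mixture[OF exp_mixture_exp[of c 0]] by simp

lemma comp_mono_exp: "0 \<le> l \<Longrightarrow> comp_mono (\<lambda>x. exp (- (l * x)))"
  using comp_mono_exp_mixture[OF exp_mixture_exp[of 1 l]] by simp

lemma comp_mono_power: "comp_mono f \<Longrightarrow> comp_mono (\<lambda>x. f x ^ n)"
proof (induction n)
  case 0
  show ?case by (simp add: comp_mono_const)
next
  case (Suc n)
  from comp_mono_mult[OF Suc.prems Suc.IH[OF Suc.prems]] show ?case by simp
qed

lemma comp_mono_sum: "(\<And>i. i \<in> I \<Longrightarrow> comp_mono (f i)) \<Longrightarrow> comp_mono (\<lambda>x. \<Sum>i\<in>I. f i x)"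
proof (induction I rule: infinite_finite_induct)
  case (insert i I)
  from comp_mono_add[of "f i", OF _ insert.IH] insert show ?case by simp
qed (simp_all add: comp_mono_const)

lemma comp_mono_power_series:
  assumes "comp_mono g" "\<And>n. 0 \<le> a n" "\<And>x. 0 < x \<Longrightarrow> (\<lambda>n. a n * g x ^ n) sums S x"
  shows "comp_mono S"
proof (rule comp_mono_limit[OF always_eventually sequentially_bot])
  show "\<forall>n. comp_mono (\<lambda>x. \<Sum>i<n. a i * g x ^ i)"
    using assms(1,2) by (intro allI comp_mono_sum comp_mono_mult comp_mono_const comp_mono_power)
  show "(\<lambda>n. \<Sum>i<n. a i * g x ^ i) \<longlonglongrightarrow> S x" if "0 < x" for x
    using assms(3)[OF that] by (simp add: sums_def)
qed

text \<open>
  The functions \<open>B\<close> that qualify are the Bernstein functions.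
\<close>

lemma comp_mono_compose:
  assumes g: "comp_mono g" and B: "\<And>x. 0 < x \<Longrightarrow> 0 < B x"
    and exp: "\<And>l. 0 \<le> l \<Longrightarrow> comp_mono (\<lambda>x. exp (- (l * B x)))"
  shows "comp_mono (\<lambda>x. g (B x))"
  unfolding comp_mono_def
proof (intro allI impI)
  fix X :: "real set" and \<epsilon> :: real
  assume X: "finite X" "X \<subseteq> {0<..}" "0 < \<epsilon>"
  have e2: "0 < \<epsilon> / 2" and BX: "finite (B ` X)" "B ` X \<subseteq> {0<..}" using X B by auto
  obtain f where f: "exp_mixture f" "\<And>y. y \<in> B ` X \<Longrightarrow> \<bar>f y - g y\<bar> < \<epsilon> / 2"
    by (rule comp_monoD[OF g BX e2]) blast
  have "comp_mono (\<lambda>x. f (B x))"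
    using f(1)
  proof induction
    case zero
    show ?case by (simp add: comp_mono_const)
  next
    case (add_exp f c l)
    then show ?case by (intro comp_mono_add comp_mono_mult comp_mono_const exp)
  qed
  then obtain h where h: "exp_mixture h" "\<And>x. x \<in> X \<Longrightarrow> \<bar>h x - f (B x)\<bar> < \<epsilon> / 2"
    by (rule comp_monoD[OF _ X(1,2) e2]) blast
  have "\<bar>h x - g (B x)\<bar> < \<epsilon>" if "x \<in> X" for x
    using h(2)[OF that] f(2)[OF imageI[OF that]] by linarith
  then show "\<exists>h. exp_mixture h \<and> (\<forall>x\<in>X. \<bar>h x - g (B x)\<bar> < \<epsilon>)" using h(1) by blast
qed

lemma comp_mono_antimono:
  assumes "comp_mono g" "0 < x" "x \<le> y"
  shows "g y \<le> g x"
proof -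
  have X: "finite {x, y}" "{x, y} \<subseteq> {0<..}" using assms(2,3) by auto
  obtain f where f: "\<And>n. exp_mixture (f n)" "\<And>z. z \<in> {x, y} \<Longrightarrow> (\<lambda>n. f n z) \<longlonglongrightarrow> g z"
    using comp_mono_approx[OF assms(1) X] by blast
  show ?thesis
    using f(2)[of x] f(2)[of y] exp_mixture_antimono[OF f(1) assms(3)]
    by (intro LIMSEQ_le[of "\<lambda>n. f n y" _ "\<lambda>n. f n x"]) auto
qed

lemma pochhammer_nonneg_real: "0 \<le> x \<Longrightarrow> 0 \<le> pochhammer (x::real) n"
  by (simp add: pochhammer_prod prod_nonneg)

text \<open>
  \<open>x\<close> is the limit of \<open>(1 - exp (- (u * x))) / u\<close> as \<open>u\<close> tends to 0, and the binomial series of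
  \<open>(1 - z) powr (- d)\<close> has nonnegative coefficients.
\<close>

lemma comp_mono_powr:
  assumes "0 \<le> d"
  shows "comp_mono (\<lambda>x. x powr (- d))"
proof (rule comp_mono_limit[OF always_eventually sequentially_bot])
  define u where "u n = 1 / real (Suc n)" for n
  define f where "f n x = u n powr d * (1 - exp (- (u n * x))) powr (- d)" for n x
  have u: "0 < u n" for n by (simp add: u_def)
  show "\<forall>n. comp_mono (f n)"
  proof
    fix n
    have "comp_mono (\<lambda>x. (1 - exp (- (u n * x))) powr (- d))"
    proof (rule comp_mono_power_series[OF comp_mono_exp])
      show "0 \<le> u n" using u less_imp_le by blast
      show "0 \<le> pochhammer d k / fact k" for k
        using assms by (intro divide_nonneg_nonneg pochhammer_nonneg_real) auto
      fix x :: real assume "0 < x"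
      then have "\<bar>- exp (- (u n * x))\<bar> < 1" using u by simp
      from gen_binomial_real[OF this, of "- d"]
      have "(\<lambda>j. (- d gchoose j) * (- exp (- (u n * x))) ^ j) sums (1 - exp (- (u n * x))) powr (- d)"
        by simp
      moreover have "(- d gchoose j) * (- z) ^ j = pochhammer d j / fact j * z ^ j" for j z
      proof -
        have 1: "(- 1) ^ j * (- z) ^ j = z ^ j"
          unfolding power_mult_distrib[symmetric] by simp
        have 2: "(- d gchoose j) = (- 1) ^ j * (pochhammer d j / fact j)"
          by (simp add: gbinomial_pochhammer)
        have "(- d gchoose j) * (- z) ^ j = ((- 1) ^ j * (- z) ^ j) * (pochhammer d j / fact j)"
          unfolding 2 by (simp only: mult_ac)
        then show ?thesis unfolding 1 by (simp only: mult_ac)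
      qed
      ultimately show "(\<lambda>j. pochhammer d j / fact j * exp (- (u n * x)) ^ j) sums (1 - exp (- (u n * x))) powr (- d)"
        by (simp only:)
    qed
    then show "comp_mono (f n)"
      unfolding f_def by (intro comp_mono_mult comp_mono_const) auto
  qed
  fix x :: real assume x: "0 < x"
  have "(\<lambda>n. ((1 - exp (- (u n * x))) / u n) powr (- d)) \<longlonglongrightarrow> x powr (- d)"
  proof (rule tendsto_powr[OF _ tendsto_const])
    show "(\<lambda>n. (1 - exp (- (u n * x))) / u n) \<longlonglongrightarrow> x" unfolding u_def by real_asymp
  qed (use x in simp)
  moreover have "((1 - exp (- (u n * x))) / u n) powr (- d) = f n x" for n
  proof -
    have "(a / v) powr (- d) = v powr d * a powr (- d)" if "0 \<le> a" "0 < v" for a v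
    proof -
      have "(a / v) powr (- d) = a powr (- d) / v powr (- d)" using that by (simp add: powr_divide)
      also have "\<dots> = v powr d * a powr (- d)" by (simp add: powr_minus divide_inverse)
      finally show ?thesis .
    qed
    moreover have "0 \<le> 1 - exp (- (u n * x))" using u[of n] x by simp
    ultimately show ?thesis using u[of n] by (simp add: f_def)
  qed
  ultimately show "(\<lambda>n. f n x) \<longlonglongrightarrow> x powr (- d)" by simp
qed

lemma comp_mono_exp_of:
  assumes "comp_mono g" "0 \<le> L"
  shows "comp_mono (\<lambda>x. exp (L * g x))"
proof (rule comp_mono_power_series[OF assms(1)])
  show "0 \<le> L ^ n / fact n" for n using assms(2) by simp
  show "(\<lambda>n. L ^ n / fact n * g x ^ n) sums exp (L * g x)" for x
    using exp_converges[of "L * g x"] by (simp add: power_mult_distrib divide_inverse mult_ac)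
qed

text \<open>
  The same approximation of \<open>x\<close> as before, together with the fact that \<open>1 - (1 - z) powr k\<close> has
  nonnegative coefficients if \<open>0 \<le> k \<le> 1\<close>. In other words, \<open>x powr k\<close> is a Bernstein function.
\<close>

lemma comp_mono_exp_powr:
  assumes k: "0 \<le> k" "k \<le> 1" and L: "0 \<le> L"
  shows "comp_mono (\<lambda>x. exp (- (L * x powr k)))"
proof (rule comp_mono_limit[OF always_eventually sequentially_bot])
  define u where "u n = 1 / real (Suc n)" for n
  define f where "f n x = exp (- (L * ((1 - exp (- (u n * x))) powr k / u n powr k)))" for n x
  have u: "0 < u n" for n by (simp add: u_def)
  define b where "b j = k * pochhammer (1 - k) j / fact (Suc j)" for j
  have b: "0 \<le> b j" for j
    unfolding b_def using k by (intro divide_nonneg_nonneg mult_nonneg_nonneg pochhammer_nonneg_real) auto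
  show "\<forall>n. comp_mono (f n)"
  proof
    fix n
    define S where "S x = 1 - (1 - exp (- (u n * x))) powr k" for x
    \<comment> \<open>The series of \<open>S\<close> starts with the first power of \<open>z = exp (- (u n * x))\<close>, hence the quotient.\<close>
    have "comp_mono (\<lambda>x. S x / exp (- (u n * x)))"
    proof (rule comp_mono_power_series[OF comp_mono_exp b])
      show "0 \<le> u n" using u less_imp_le by blast
      fix x :: real assume x: "0 < x"
      define z where "z = exp (- (u n * x))"
      have z: "z \<noteq> 0" "\<bar>- z\<bar> < 1" using x u by (auto simp: z_def)
      from gen_binomial_real[OF z(2), of k]
      have "(\<lambda>j. (k gchoose Suc j) * (- z) ^ Suc j) sums ((1 + - z) powr k - (k gchoose 0) * (- z) ^ 0)"
        by (subst sums_Suc_iff) simp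
      moreover have "(k gchoose Suc j) * (- z) ^ Suc j = - (b j * z ^ j * z)" for j
      proof -
        have 1: "(- 1) ^ Suc j * (- z) ^ Suc j = z ^ Suc j"
          unfolding power_mult_distrib[symmetric] by simp
        have 2: "(k gchoose Suc j) = (- 1) ^ Suc j * (- b j)"
          by (simp add: gbinomial_pochhammer pochhammer_rec b_def)
        have "(k gchoose Suc j) * (- z) ^ Suc j = ((- 1) ^ Suc j * (- z) ^ Suc j) * (- b j)"
          unfolding 2 by (simp only: mult_ac)
        then have "(k gchoose Suc j) * (- z) ^ Suc j = z ^ Suc j * (- b j)"
          unfolding 1 .
        then show ?thesis by (simp add: mult_ac)
      qed
      ultimately have "(\<lambda>j. - (b j * z ^ j * z)) sums ((1 + - z) powr k - (k gchoose 0) * (- z) ^ 0)"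
        by (simp only:)
      then have "(\<lambda>j. - (b j * z ^ j * z)) sums - (S x)" by (simp add: S_def z_def)
      then have "(\<lambda>j. - (- (b j * z ^ j * z))) sums - (- S x)" by (rule sums_minus)
      then have "(\<lambda>j. b j * z ^ j * z / z) sums (S x / z)" by (intro sums_divide) simp
      then show "(\<lambda>j. b j * exp (- (u n * x)) ^ j) sums (S x / exp (- (u n * x)))"
        using z by (simp add: z_def)
    qed
    from comp_mono_mult[OF this comp_mono_exp[OF less_imp_le[OF u[of n]]]]
    have "comp_mono S" by (rule comp_mono_cong) simp
    then have "comp_mono (\<lambda>x. exp (- (L / u n powr k)) * exp (L / u n powr k * S x))"
      using L by (intro comp_mono_mult comp_mono_const comp_mono_exp_of) auto
    then show "comp_mono (f n)"
      by (rule comp_mono_cong) (simp add: f_def S_def exp_add[symmetric] right_diff_distrib)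
  qed
  fix x :: real assume x: "0 < x"
  have "(\<lambda>n. ((1 - exp (- (u n * x))) / u n) powr k) \<longlonglongrightarrow> x powr k"
  proof (rule tendsto_powr[OF _ tendsto_const])
    show "(\<lambda>n. (1 - exp (- (u n * x))) / u n) \<longlonglongrightarrow> x" unfolding u_def by real_asymp
  qed (use x in simp)
  from tendsto_exp[OF tendsto_minus[OF tendsto_mult_left[OF this]]]
  have "(\<lambda>n. exp (- (L * ((1 - exp (- (u n * x))) / u n) powr k))) \<longlonglongrightarrow> exp (- (L * x powr k))" .
  moreover have "exp (- (L * ((1 - exp (- (u n * x))) / u n) powr k)) = f n x" for n
    using u[of n] x by (simp add: f_def powr_divide)
  ultimately show "(\<lambda>n. f n x) \<longlonglongrightarrow> exp (- (L * x powr k))" by simp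
qed

text \<open>
  Riemann sums of the Laplace integral over a grid of mesh \<open>1 / (n + 1)\<close> up to \<open>n + 1\<close>. The
  exponential is taken at the right end point of each cell, so the integrand of the Laplace
  integral dominates.
\<close>

lemma comp_mono_laplace:
  fixes W :: "real \<Rightarrow> real"
  assumes W [measurable]: "W \<in> borel_measurable borel" and nonneg: "\<And>l. 0 < l \<Longrightarrow> 0 \<le> W l"
    and g: "\<And>x. 0 < x \<Longrightarrow> has_bochner_integral lborel (\<lambda>l. indicator {0<..} l * (exp (- (x * l)) * W l)) (g x)"
  shows "comp_mono g"
proof (rule comp_mono_limit[OF always_eventually sequentially_bot])
  define a where "a n k = real k / real (Suc n)" for n k
  define I where "I n k = {a n k<..a n (Suc k)}" for n k
  define f where "f n x = (\<Sum>k<(Suc n)\<^sup>2. (LINT l|lborel. indicator (I n k) l * W l) * exp (- (a n (Suc k) * x)))" for n x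
  have a: "0 \<le> a n k" for n k by (simp add: a_def)
  have W_nonneg: "0 \<le> indicator (I n k) l * W l" for n k l
    using nonneg[of l] a[of n k] by (auto simp: I_def indicator_def)
  have int: "integrable lborel (\<lambda>l. indicator (I n k) l * W l)" for n k
  proof (rule Bochner_Integration.integrable_bound)
    show "integrable lborel (\<lambda>l. exp (a n (Suc k)) * (indicator {0<..} l * (exp (- (1 * l)) * W l)))"
      using g[of 1] by (auto simp: has_bochner_integral_iff)
    show "AE l in lborel. norm (indicator (I n k) l * W l)
        \<le> norm (exp (a n (Suc k)) * (indicator {0<..} l * (exp (- (1 * l)) * W l)))"
    proof (intro AE_I2)
      fix l
      show "norm (indicator (I n k) l * W l) \<le> norm (exp (a n (Suc k)) * (indicator {0<..} l * (exp (- (1 * l)) * W l)))"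
      proof (cases "l \<in> I n k")
        case True
        then have l: "0 < l" "l \<le> a n (Suc k)" using a[of n k] by (auto simp: I_def)
        have "1 * W l \<le> exp (a n (Suc k) - l) * W l"
          using l nonneg by (intro mult_right_mono) auto
        then show ?thesis using True l nonneg[of l] by (simp add: exp_diff exp_minus divide_inverse abs_mult mult_ac)
      qed simp
    qed
  qed (auto simp: I_def)
  show "\<forall>n. comp_mono (f n)"
    unfolding f_def using a W_nonneg
    by (intro allI comp_mono_sum comp_mono_mult comp_mono_const comp_mono_exp integral_nonneg_AE) auto
  fix x :: real assume x: "0 < x"
  define h where "h n l = (\<Sum>k<(Suc n)\<^sup>2. indicator (I n k) l * exp (- (a n (Suc k) * x)))" for n l :: "_"
  have f_h: "f n x = (LINT l|lborel. h n l * W l)" for n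
  proof -
    have "f n x = (\<Sum>k<(Suc n)\<^sup>2. LINT l|lborel. indicator (I n k) l * W l * exp (- (a n (Suc k) * x)))"
      by (simp add: f_def)
    also have "\<dots> = (LINT l|lborel. (\<Sum>k<(Suc n)\<^sup>2. indicator (I n k) l * W l * exp (- (a n (Suc k) * x))))"
      using int by (subst Bochner_Integration.integral_sum) auto
    finally show ?thesis unfolding h_def sum_distrib_right by (simp only: mult_ac)
  qed
  have h_out: "h n l = 0" if "l \<le> 0" for n l
  proof -
    have "\<not> a n k < l" for k using a[of n k] that by linarith
    then show ?thesis unfolding h_def by (intro sum.neutral ballI) (auto simp: I_def indicator_def)
  qed
  have h_bounds: "0 \<le> h n l" "h n l \<le> exp (- (x * l))"
      "l \<le> real (Suc n) \<Longrightarrow> exp (- (x * (l + 1 / real (Suc n)))) \<le> h n l" if l: "0 < l" for n l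
  proof -
    define K where "K = nat (\<lceil>real (Suc n) * l\<rceil> - 1)"
    have pos: "0 < real (Suc n) * l" using l by simp
    then have "1 \<le> \<lceil>real (Suc n) * l\<rceil>" by linarith
    then have K: "real K < real (Suc n) * l" "real (Suc n) * l \<le> real (Suc K)"
      unfolding K_def by linarith+
    have uniq: "l \<in> I n k \<longleftrightarrow> k = K" for k
    proof -
      have "l \<in> I n k \<longleftrightarrow> real k < real (Suc n) * l \<and> real (Suc n) * l \<le> real (Suc k)"
        by (simp add: I_def a_def pos_divide_less_eq pos_le_divide_eq mult.commute)
      also have "\<dots> \<longleftrightarrow> k = K" using K by linarith
      finally show ?thesis .
    qed
    have h_eq: "h n l = (if K < (Suc n)\<^sup>2 then exp (- (a n (Suc K) * x)) else 0)"
    proof -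
      have "h n l = (\<Sum>k<(Suc n)\<^sup>2. if k = K then exp (- (a n (Suc K) * x)) else 0)"
        unfolding h_def by (intro sum.cong refl) (auto simp: indicator_def uniq)
      then show ?thesis by simp
    qed
    have al: "l \<le> a n (Suc K)" "a n (Suc K) \<le> l + 1 / real (Suc n)"
    proof -
      show "l \<le> a n (Suc K)" using K by (simp add: a_def pos_le_divide_eq mult.commute)
      have "real K / real (Suc n) \<le> l" using K by (simp add: pos_divide_le_eq mult.commute)
      then show "a n (Suc K) \<le> l + 1 / real (Suc n)" by (simp add: a_def add_divide_distrib)
    qed
    show "0 \<le> h n l" by (simp add: h_eq)
    show "h n l \<le> exp (- (x * l))" using al x by (auto simp: h_eq mult.commute intro!: mult_left_mono)
    assume "l \<le> real (Suc n)"
    then have "real (Suc n) * l \<le> real (Suc n) * real (Suc n)" by (rule mult_left_mono) simp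
    then have "real K < real (Suc n) * real (Suc n)" using K(1) by linarith
    then have "real K < real ((Suc n)\<^sup>2)" by (simp only: of_nat_power power2_eq_square of_nat_mult)
    then have "K < (Suc n)\<^sup>2" by (simp only: of_nat_less_iff)
    then show "exp (- (x * (l + 1 / real (Suc n)))) \<le> h n l"
      using al x by (auto simp: h_eq mult.commute intro!: mult_left_mono)
  qed
  have "(\<lambda>n. LINT l|lborel. h n l * W l) \<longlonglongrightarrow> (LINT l|lborel. indicator {0<..} l * (exp (- (x * l)) * W l))"
  proof (rule integral_dominated_convergence)
    show "integrable lborel (\<lambda>l. indicator {0<..} l * (exp (- (x * l)) * W l))"
      using g[OF x] by (simp add: has_bochner_integral_iff)
    show "(\<lambda>l. h n l * W l) \<in> borel_measurable lborel" for n
      unfolding h_def I_def by measurable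
    show "AE l in lborel. (\<lambda>n. h n l * W l) \<longlonglongrightarrow> indicator {0<..} l * (exp (- (x * l)) * W l)"
    proof (intro AE_I2)
      fix l :: real
      show "(\<lambda>n. h n l * W l) \<longlonglongrightarrow> indicator {0<..} l * (exp (- (x * l)) * W l)"
      proof (cases "0 < l")
        case True
        have "(\<lambda>n. h n l) \<longlonglongrightarrow> exp (- (x * l))"
        proof (rule tendsto_sandwich)
          show "\<forall>\<^sub>F n in sequentially. exp (- (x * (l + 1 / real (Suc n)))) \<le> h n l"
            using eventually_ge_at_top[of "nat \<lceil>l\<rceil>"]
          proof eventually_elim
            case (elim n)
            then have "l \<le> real (Suc n)" by linarith
            then show ?case by (rule h_bounds(3)[OF True])
          qed
          show "\<forall>\<^sub>F n in sequentially. h n l \<le> exp (- (x * l))"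
            using h_bounds(2)[OF True] by simp
          show "(\<lambda>n. exp (- (x * (l + 1 / real (Suc n))))) \<longlonglongrightarrow> exp (- (x * l))"
          proof -
            have "(\<lambda>n. exp (- (x * (l + 1 / real (Suc n))))) \<longlonglongrightarrow> exp (- (x * (l + 0)))"
              by (intro tendsto_intros) real_asymp
            then show ?thesis by simp
          qed
        qed simp
        from tendsto_mult_right[OF this, of "W l"] show ?thesis using True by simp
      qed (simp add: h_out)
    qed
    show "AE l in lborel. norm (h n l * W l) \<le> indicator {0<..} l * (exp (- (x * l)) * W l)" for n
    proof (intro AE_I2)
      fix l :: real
      show "norm (h n l * W l) \<le> indicator {0<..} l * (exp (- (x * l)) * W l)"
        using h_bounds(1,2)[of l n] nonneg[of l] by (cases "0 < l") (auto simp: h_out abs_mult intro!: mult_right_mono)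
    qed
  qed measurable
  also have "(LINT l|lborel. indicator {0<..} l * (exp (- (x * l)) * W l)) = g x"
    using g[OF x] by (simp add: has_bochner_integral_iff)
  finally show "(\<lambda>n. f n x) \<longlonglongrightarrow> g x" unfolding f_h .
qed

lemma comp_mono_powr_div_open_range:
  assumes "3/2 < r" "r < 2"
  shows "comp_mono (\<lambda>x. x powr (1 - r) / (1 + x powr r))"
  by (rule comp_mono_laplace[of "inverse_laplace r", OF inverse_laplace_measurable[OF assms] inverse_laplace_nonneg[OF assms less_imp_le] laplace_inverse_laplace[OF assms]])

lemma comp_mono_powr_div_closed_range:
  assumes r: "3/2 \<le> r" "r \<le> 2"
  shows "comp_mono (\<lambda>x. x powr (1 - r) / (1 + x powr r))"
proof -
  \<comment> \<open>the end points are limits of interior points\<close>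
  define s where "s n = r + (7/4 - r) * (1 / (real n + 2))" for n
  have rng: "3/2 < s n \<and> s n < 2" for n
  proof -
    define e where "e = 1 / (real n + 2)"
    have e: "0 < e" "e < 1" by (auto simp: e_def)
    define A where "A = r * (1 - e)"
    have "s n = A + (7/4) * e"
      unfolding s_def e_def[symmetric] A_def by (simp add: algebra_simps)
    moreover have A1: "(3/2) * (1 - e) \<le> A" unfolding A_def by (rule mult_right_mono) (use r e in auto)
    moreover have A2: "A \<le> 2 * (1 - e)" unfolding A_def by (rule mult_right_mono) (use r e in auto)
    moreover have "3/2 < (3/2) * (1 - e) + (7/4) * e" "2 * (1 - e) + (7/4) * e < 2"
      using e by (simp_all add: field_simps)
    ultimately have "3/2 < s n" "s n < 2"
      using add_right_mono[OF A1, of "(7/4) * e"] add_right_mono[OF A2, of "(7/4) * e"]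
      by (metis order_less_le_trans, metis order_le_less_trans)
    then show ?thesis ..
  qed
  have lim: "s \<longlonglongrightarrow> r" unfolding s_def by real_asymp
  show ?thesis
  proof (rule comp_mono_limit[OF always_eventually sequentially_bot])
    show "\<forall>n. comp_mono (\<lambda>x. x powr (1 - s n) / (1 + x powr s n))"
      using rng comp_mono_powr_div_open_range by blast
    fix x :: real assume x: "0 < x"
    have "0 < 1 + x powr r" by (simp add: add_pos_nonneg)
    then show "(\<lambda>n. x powr (1 - s n) / (1 + x powr s n)) \<longlonglongrightarrow> x powr (1 - r) / (1 + x powr r)"
      by (intro tendsto_divide tendsto_add tendsto_powr tendsto_const tendsto_diff lim) (use x in auto)
  qed
qed

text \<open>
  For \<open>r \<ge> 3/2\<close> the function is a product of \<open>x powr (1 - r) / (1 + x powr r)\<close> and a power of \<open>x\<close>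
  with nonpositive exponent. For smaller \<open>r\<close>, the case \<open>3/2\<close> composed with \<open>x powr (2 * r / 3)\<close>
  gives \<open>x powr (- (r / 3)) / (1 + x powr r)\<close>, and there \<open>r / 3 \<le> 2 - r\<close>.
\<close>

lemma comp_mono_powr_div_one_plus_powr:
  assumes r: "0 < r" "r \<le> 2" and d: "2 - r \<le> d" "r - 1 \<le> d"
  shows "comp_mono (\<lambda>x. x powr (- d) / (1 + x powr r))"
proof (cases "3/2 \<le> r")
  case True
  have "comp_mono (\<lambda>x. x powr (- (d - (r - 1))) * (x powr (1 - r) / (1 + x powr r)))"
    using d r True by (intro comp_mono_mult comp_mono_powr comp_mono_powr_div_closed_range) auto
  then show ?thesis
    by (rule comp_mono_cong) (simp add: powr_add[symmetric])
next
  case False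
  define k where "k = 2 * r / 3"
  have k: "0 \<le> k" "k \<le> 1" using r False by (auto simp: k_def)
  have "comp_mono (\<lambda>x. (x powr k) powr (1 - 3/2) / (1 + (x powr k) powr (3/2)))"
    using comp_mono_powr_div_closed_range[of "3/2"] by (rule comp_mono_compose) (auto intro: comp_mono_exp_powr k)
  then have "comp_mono (\<lambda>x. x powr (- (d - r / 3)) * ((x powr k) powr (1 - 3/2) / (1 + (x powr k) powr (3/2))))"
    using d r False by (intro comp_mono_mult comp_mono_powr) auto
  then show ?thesis
    by (rule comp_mono_cong) (simp add: powr_powr k_def powr_add[symmetric])
qed

section \<open>Roots of lattice distributions\<close>

lemma fps_log_deriv_nth:
  fixes F :: "real fps"
  assumes "F $ 0 \<noteq> 0"
  shows "fps_log_deriv F $ k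
      = (real (k + 1) * F $ (k + 1) - (\<Sum>i<k. fps_log_deriv F $ i * F $ (k - i))) / F $ 0"
proof -
  have "fps_deriv F $ k = (\<Sum>i=0..k. fps_log_deriv F $ i * F $ (k - i))"
    by (subst fps_log_deriv_mult_self[OF assms, symmetric]) (rule fps_mult_nth)
  also have "{0..k} = insert k {..<k}" by auto
  finally show ?thesis using assms by simp
qed

text \<open>
  The recursion for the coefficients shows that each is a continuous function of finitely many
  coefficients of the series.
\<close>

lemma fps_log_deriv_limit:
  fixes p :: "nat \<Rightarrow> real fps" and P :: "real fps"
  assumes lim: "\<And>j. j \<le> k + 1 \<Longrightarrow> (\<lambda>n. p n $ j) \<longlonglongrightarrow> P $ j" and P0: "P $ 0 \<noteq> 0"
  shows "(\<lambda>n. fps_log_deriv (p n) $ k) \<longlonglongrightarrow> fps_log_deriv P $ k"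
proof -
  have p0: "\<forall>\<^sub>F n in sequentially. p n $ 0 \<noteq> 0"
    using lim[of 0] P0 by (intro tendsto_imp_eventually_ne) auto
  have "(\<lambda>n. fps_log_deriv (p n) $ i) \<longlonglongrightarrow> fps_log_deriv P $ i" if "i \<le> k" for i
    using that
  proof (induction i rule: less_induct)
    case (less i)
    have "(\<lambda>n. (real (i + 1) * p n $ (i + 1) - (\<Sum>j<i. fps_log_deriv (p n) $ j * p n $ (i - j))) / p n $ 0)
        \<longlonglongrightarrow> (real (i + 1) * P $ (i + 1) - (\<Sum>j<i. fps_log_deriv P $ j * P $ (i - j))) / P $ 0"
      using less.prems
      by (intro tendsto_divide tendsto_diff tendsto_mult tendsto_const tendsto_sum lim P0 less.IH) auto
    moreover have "\<forall>\<^sub>F n in sequentially. (real (i + 1) * p n $ (i + 1)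
        - (\<Sum>j<i. fps_log_deriv (p n) $ j * p n $ (i - j))) / p n $ 0 = fps_log_deriv (p n) $ i"
      using p0 by eventually_elim (rule fps_log_deriv_nth[symmetric])
    ultimately show ?case
      unfolding fps_log_deriv_nth[OF P0, of i] by (rule Lim_transform_eventually)
  qed
  then show ?thesis by simp
qed

text \<open>
  If \<open>g\<close> is a finite mixture of exponentials, its values on the grid are sums of geometric
  sequences, which is the case of \<open>fps_log_deriv_nb2_mixture_nonneg\<close>. The rest is continuity.
\<close>

lemma fps_log_deriv_comp_mono_nonneg:
  assumes g: "comp_mono g" and h: "0 < h" and pos: "0 < g h"
  shows "0 \<le> fps_log_deriv (Abs_fps (\<lambda>k. real (k + 1) * g (real (k + 1) * h))) $ k"
proof -
  define X where "X = (\<lambda>j. real (j + 1) * h) ` {..k + 1}"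
  have X: "finite X" "X \<subseteq> {0<..}" using h by (auto simp: X_def)
  obtain f where f: "\<And>n. exp_mixture (f n)" "\<And>x. x \<in> X \<Longrightarrow> (\<lambda>n. f n x) \<longlonglongrightarrow> g x"
    using comp_mono_approx[OF g X] by blast
  define Q where "Q n = Abs_fps (\<lambda>j. real (j + 1) * f n (real (j + 1) * h))" for n
  have lim: "(\<lambda>n. f n (real (j + 1) * h)) \<longlonglongrightarrow> g (real (j + 1) * h)" if "j \<le> k + 1" for j
    using that by (intro f(2)) (auto simp: X_def)
  have "(\<lambda>n. fps_log_deriv (Q n) $ k)
      \<longlonglongrightarrow> fps_log_deriv (Abs_fps (\<lambda>k. real (k + 1) * g (real (k + 1) * h))) $ k"
  proof (rule fps_log_deriv_limit)
    fix j assume "j \<le> k + 1"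
    from tendsto_mult_left[OF lim[OF this], of "real (j + 1)"]
    show "(\<lambda>n. Q n $ j) \<longlonglongrightarrow> Abs_fps (\<lambda>k. real (k + 1) * g (real (k + 1) * h)) $ j"
      by (simp add: Q_def)
  qed (use pos in simp)
  moreover have "\<forall>\<^sub>F n in sequentially. 0 \<le> fps_log_deriv (Q n) $ k"
  proof -
    have "\<forall>\<^sub>F n in sequentially. 0 < f n h"
      using order_tendstoD(1)[OF lim[of 0], of 0] pos by simp
    then show ?thesis
    proof eventually_elim
      case (elim n)
      obtain N :: nat and c l where cl: "\<forall>i<N. 0 \<le> c i \<and> 0 \<le> l i"
        "f n = (\<lambda>x. \<Sum>i<N. c i * exp (- (l i * x)))"
        using exp_mixture_imp_sum[OF f(1)] by blast
      define c' q where "c' i = c i * exp (- (l i * h))" and "q i = exp (- (l i * h))" for i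
      have "Q n = Abs_fps (\<lambda>j. \<Sum>i<N. c' i * (real j + 1) * q i ^ j)"
      proof (rule fps_ext)
        fix j
        have eq: "exp (- (l i * (real (j + 1) * h))) = exp (- (l i * h)) * q i ^ j" for i
        proof -
          have "- (l i * (real (j + 1) * h)) = - (l i * h) + real j * (- (l i * h))"
            by (simp add: algebra_simps)
          then show ?thesis by (simp only: exp_add exp_of_nat_mult q_def)
        qed
        have "Q n $ j = (\<Sum>i<N. real (j + 1) * (c i * (exp (- (l i * h)) * q i ^ j)))"
          by (simp only: Q_def cl(2) eq fps_nth_Abs_fps sum_distrib_left)
        also have "\<dots> = (\<Sum>i<N. c' i * (real j + 1) * q i ^ j)"
          by (intro sum.cong refl) (simp add: c'_def mult_ac add.commute)
        finally show "Q n $ j = Abs_fps (\<lambda>j. \<Sum>i<N. c' i * (real j + 1) * q i ^ j) $ j" by simp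
      qed
      then show ?case
        using cl elim by (simp only:) (intro fps_log_deriv_nb2_mixture_nonneg, auto simp: c'_def q_def)
    qed
  qed
  ultimately show ?thesis by (rule tendsto_lowerbound) simp
qed

lemma fps_log_deriv_power:
  fixes F :: "'a :: field fps"
  assumes "F $ 0 \<noteq> 0"
  shows "fps_log_deriv (F ^ n) = of_nat n * fps_log_deriv F"
  using fps_log_deriv_prod[of "{..<n}" "\<lambda>_. F"] assms by simp

text \<open>
  The root \<open>Q\<close> has the logarithmic derivative of \<open>P\<close> divided by \<open>n\<close>, and \<open>Q' = (Q' / Q) * Q\<close>
  determines its coefficients one after the other from nonnegative data.
\<close>

lemma fps_nonneg_root:
  fixes P :: "real fps"
  assumes P0: "0 < P $ 0" and ld: "\<And>k. 0 \<le> fps_log_deriv P $ k" and n: "0 < n"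
  obtains Q where "Q ^ n = P" "0 < Q $ 0" "\<And>k. 0 \<le> Q $ k"
proof -
  define Q where "Q = fps_radical root n P"
  obtain m where m: "n = Suc m" using n by (cases n) auto
  have pow: "Q ^ n = P"
    unfolding Q_def m using P0 power_radical[of P root m] by (simp add: real_root_pow_pos2 del: power_Suc)
  have Q0: "0 < Q $ 0" using P0 n by (simp add: Q_def fps_radical_nth_0)
  have "fps_log_deriv P = of_nat n * fps_log_deriv Q"
    using fps_log_deriv_power[of Q n] pow Q0 by simp
  then have "fps_log_deriv P $ k = real n * fps_log_deriv Q $ k" for k
    by (simp add: fps_of_nat[symmetric])
  then have ldQ: "0 \<le> fps_log_deriv Q $ k" for k
    using ld[of k] n by (simp add: zero_le_mult_iff)
  have "0 \<le> Q $ k" for k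
  proof (induction k rule: less_induct)
    case (less k)
    show ?case
    proof (cases k)
      case (Suc j)
      have "real (j + 1) * Q $ (j + 1) = (fps_log_deriv Q * Q) $ j"
        using fps_log_deriv_mult_self[of Q] Q0 by simp
      also have "\<dots> \<ge> 0"
        unfolding fps_mult_nth using ldQ less Suc by (intro sum_nonneg mult_nonneg_nonneg) auto
      finally show ?thesis using Suc by (simp add: zero_le_mult_iff)
    qed (use Q0 in simp)
  qed
  then show ?thesis using that pow Q0 by blast
qed

definition fps_sum_at :: "real fps \<Rightarrow> complex \<Rightarrow> complex" where
  "fps_sum_at F z = (\<Sum>k. of_real (F $ k) * z ^ k)"

lemma
  assumes F: "summable (\<lambda>k. \<bar>F $ k\<bar>)" and G: "summable (\<lambda>k. \<bar>G $ k\<bar>)"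
  shows summable_fps_mult: "summable (\<lambda>k. \<bar>(F * G) $ k\<bar>)"
    and fps_sum_at_mult: "cmod z \<le> 1 \<Longrightarrow> fps_sum_at (F * G) z = fps_sum_at F z * fps_sum_at G z"
proof -
  have "summable (\<lambda>k. norm (\<Sum>i\<le>k. F $ i * G $ (k - i)))"
  proof (rule summable_comparison_test)
    show "\<exists>N. \<forall>k\<ge>N. norm (norm (\<Sum>i\<le>k. F $ i * G $ (k - i))) \<le> (\<Sum>i\<le>k. \<bar>F $ i\<bar> * \<bar>G $ (k - i)\<bar>)"
    proof (intro exI allI impI)
      fix k
      have "\<bar>\<Sum>i\<le>k. F $ i * G $ (k - i)\<bar> \<le> (\<Sum>i\<le>k. \<bar>F $ i * G $ (k - i)\<bar>)" by (rule sum_abs)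
      then show "norm (norm (\<Sum>i\<le>k. F $ i * G $ (k - i))) \<le> (\<Sum>i\<le>k. \<bar>F $ i\<bar> * \<bar>G $ (k - i)\<bar>)"
        by (simp add: abs_mult)
    qed
    show "summable (\<lambda>k. \<Sum>i\<le>k. \<bar>F $ i\<bar> * \<bar>G $ (k - i)\<bar>)"
      using F G by (intro summable_Cauchy_product) auto
  qed
  then show "summable (\<lambda>k. \<bar>(F * G) $ k\<bar>)"
    by (simp add: fps_mult_nth atMost_atLeast0)
  assume z: "cmod z \<le> 1"
  have sm: "summable (\<lambda>k. norm (of_real (H $ k) * z ^ k))" if "summable (\<lambda>k. \<bar>H $ k\<bar>)" for H :: "real fps"
  proof (rule summable_comparison_test[OF _ that])
    have "\<bar>H $ k\<bar> * cmod z ^ k \<le> \<bar>H $ k\<bar> * 1" for k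
      using z by (intro mult_left_mono) (auto simp: power_le_one)
    then show "\<exists>N. \<forall>k\<ge>N. norm (norm (of_real (H $ k) * z ^ k)) \<le> \<bar>H $ k\<bar>"
      by (auto simp: norm_mult norm_power)
  qed
  have "fps_sum_at F z * fps_sum_at G z
      = (\<Sum>k. \<Sum>i\<le>k. (of_real (F $ i) * z ^ i) * (of_real (G $ (k - i)) * z ^ (k - i)))"
    unfolding fps_sum_at_def by (rule Cauchy_product[OF sm[OF F] sm[OF G]])
  also have "\<dots> = fps_sum_at (F * G) z"
    unfolding fps_sum_at_def
  proof (rule suminf_cong)
    fix k
    have eq: "(of_real (F $ i) * z ^ i) * (of_real (G $ (k - i)) * z ^ (k - i)) = of_real (F $ i * G $ (k - i)) * z ^ k"
      if "i \<in> {..k}" for i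
    proof -
      have "z ^ k = z ^ i * z ^ (k - i)" using that power_add[of z i "k - i"] by simp
      then show ?thesis by (simp only: of_real_mult mult_ac)
    qed
    have "(\<Sum>i\<le>k. (of_real (F $ i) * z ^ i) * (of_real (G $ (k - i)) * z ^ (k - i)))
        = (\<Sum>i\<le>k. of_real (F $ i * G $ (k - i)) * z ^ k)"
      by (rule sum.cong[OF refl eq])
    also have "\<dots> = of_real ((F * G) $ k) * z ^ k"
      by (simp add: fps_mult_nth atMost_atLeast0 sum_distrib_right)
    finally show "(\<Sum>i\<le>k. (of_real (F $ i) * z ^ i) * (of_real (G $ (k - i)) * z ^ (k - i)))
        = of_real ((F * G) $ k) * z ^ k" .
  qed
  finally show "fps_sum_at (F * G) z = fps_sum_at F z * fps_sum_at G z" by simp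
qed

lemma
  assumes F: "summable (\<lambda>k. \<bar>F $ k\<bar>)"
  shows summable_fps_power: "summable (\<lambda>k. \<bar>(F ^ n) $ k\<bar>)"
    and fps_sum_at_power: "cmod z \<le> 1 \<Longrightarrow> fps_sum_at (F ^ n) z = fps_sum_at F z ^ n"
proof (induction n)
  case 0
  have *: "(\<lambda>k. of_real ((1 :: real fps) $ k) * z ^ k) = (\<lambda>k. if k = 0 then 1 else 0)"
    by (auto simp: fun_eq_iff)
  case 1
  show ?case by (rule summable_finite[of "{0}"]) auto
  case 2
  have "fps_sum_at 1 z = (\<Sum>k. if k = 0 then 1 else 0)" unfolding fps_sum_at_def * ..
  also have "\<dots> = 1" using sums_unique[OF sums_single[of 0 "\<lambda>_. 1 :: complex"]] by simp
  finally show ?case by simp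
next
  case (Suc n)
  case 1
  show ?case using summable_fps_mult[OF F Suc.IH(1)] by simp
  case 2
  then show ?case using fps_sum_at_mult[OF F Suc.IH(1)] Suc.IH(2) by simp
qed

lemma fps_sum_at_one:
  assumes "summable (\<lambda>k. \<bar>F $ k\<bar>)"
  shows "fps_sum_at F 1 = of_real (\<Sum>k. F $ k)"
  using suminf_of_real[OF summable_rabs_cancel[OF assms], where 'a = complex]
  by (simp add: fps_sum_at_def)

text \<open>
  The second property says that the root is stochastically smaller than \<open>P\<close>, as it must be: \<open>P\<close> is
  the law of a sum of \<open>n\<close> nonnegative variables with law \<open>q\<close>. It makes the roots tight later on.
\<close>

lemma fps_distribution_root:
  fixes P :: "real fps"
  assumes P0: "0 < P $ 0" and nonneg: "\<And>k. 0 \<le> P $ k" and sums: "(\<lambda>k. P $ k) sums 1"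
    and ld: "\<And>k. 0 \<le> fps_log_deriv P $ k" and n: "0 < n"
  obtains q :: "nat pmf" where
    "\<And>z. cmod z \<le> 1 \<Longrightarrow> (\<Sum>k. of_real (pmf q k) * z ^ k) ^ n = (\<Sum>k. of_real (P $ k) * z ^ k)"
    "\<And>N. (\<Sum>k\<le>N. P $ k) \<le> (\<Sum>k\<le>N. pmf q k)"
proof -
  obtain Q where Q: "Q ^ n = P" "0 < Q $ 0" "\<And>k. 0 \<le> Q $ k"
    by (rule fps_nonneg_root[OF P0 ld n]) blast
  define S where "S = Q ^ (n - 1)"
  have P_eq: "P = Q * S" using Q(1) n by (cases n) (auto simp: S_def)
  have S_nonneg: "0 \<le> (Q ^ m) $ k" for m k
  proof (induction m arbitrary: k)
    case (Suc m)
    then show ?case using Q(3) by (auto simp: fps_mult_nth intro!: sum_nonneg mult_nonneg_nonneg)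
  qed (simp)
  have S0: "0 < S $ 0" using Q(2) by (simp add: S_def fps_power_zeroth)
  have Q_le: "Q $ k \<le> P $ k / S $ 0" for k
  proof -
    have "Q $ k * S $ (k - k) \<le> (\<Sum>i=0..k. Q $ i * S $ (k - i))"
      using Q(3) S_nonneg[of "n - 1"] by (intro member_le_sum) (auto simp: S_def)
    then show ?thesis using S0 by (simp add: P_eq fps_mult_nth pos_le_divide_eq)
  qed
  have Q_sm: "summable (\<lambda>k. \<bar>Q $ k\<bar>)"
  proof (rule summable_comparison_test)
    show "summable (\<lambda>k. P $ k / S $ 0)"
      using sums by (intro summable_divide) (rule sums_summable)
    show "\<exists>N. \<forall>k\<ge>N. norm \<bar>Q $ k\<bar> \<le> P $ k / S $ 0"
      using Q_le Q(3) by auto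
  qed
  have eval: "fps_sum_at Q z ^ n = fps_sum_at P z" if "cmod z \<le> 1" for z
    using fps_sum_at_power[OF Q_sm that, of n] Q(1) by simp
  define t where "t = (\<Sum>k. Q $ k)"
  have t: "0 \<le> t" unfolding t_def using Q(3) summable_rabs_cancel[OF Q_sm] by (intro suminf_nonneg) auto
  have "complex_of_real (t ^ n) = of_real (\<Sum>k. P $ k)"
    using eval[of 1] fps_sum_at_one[OF Q_sm] fps_sum_at_one[of P] nonneg sums
    by (simp add: t_def sums_iff)
  then have "t ^ n = 1" using sums by (simp only: of_real_eq_iff sums_iff)
  then have t1: "t = 1" using power_eq_iff_eq_base[OF n t zero_le_one] by simp
  have Q_sums: "(\<lambda>k. Q $ k) sums 1"
    using summable_sums[OF summable_rabs_cancel[OF Q_sm]] t1 by (simp add: t_def)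
  define q where "q = embed_pmf (\<lambda>k. Q $ k)"
  have pmf_q: "pmf q k = Q $ k" for k
    unfolding q_def
  proof (rule pmf_embed_pmf)
    have "(\<integral>\<^sup>+k. ennreal (Q $ k) \<partial>count_space UNIV) = (\<Sum>k. ennreal (Q $ k))"
      by (rule nn_integral_count_space_nat)
    also have "\<dots> = ennreal (\<Sum>k. Q $ k)"
      using Q(3) Q_sums by (intro suminf_ennreal2) (auto simp: sums_iff)
    finally show "(\<integral>\<^sup>+k. ennreal (Q $ k) \<partial>count_space UNIV) = 1"
      using Q_sums by (simp add: sums_iff)
  qed (use Q in auto)
  have S_sm: "summable (\<lambda>k. \<bar>S $ k\<bar>)" unfolding S_def by (rule summable_fps_power[OF Q_sm])
  have S_sum: "(\<Sum>k. S $ k) = 1"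
  proof -
    have "complex_of_real (\<Sum>k. S $ k) = 1"
      using fps_sum_at_power[OF Q_sm, of 1 "n - 1"] fps_sum_at_one[OF Q_sm] fps_sum_at_one[OF S_sm] t1
      by (simp add: S_def t_def)
    then show ?thesis by (simp only: of_real_eq_1_iff)
  qed
  have "(\<Sum>k\<le>N. P $ k) \<le> (\<Sum>k\<le>N. pmf q k)" for N
  proof -
    have "(\<Sum>k\<le>N. P $ k) = (\<Sum>k\<le>N. \<Sum>i\<le>k. Q $ i * S $ (k - i))"
      by (simp add: P_eq fps_mult_nth atMost_atLeast0)
    also have "\<dots> = (\<Sum>(i,j)\<in>{(i,j). i + j \<le> N}. Q $ i * S $ j)"
      by (rule sum.triangle_reindex_eq[symmetric])
    also have "\<dots> \<le> (\<Sum>(i,j)\<in>{..N} \<times> {..N}. Q $ i * S $ j)"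
      using Q(3) S_nonneg[of "n - 1"] by (intro sum_mono2) (auto simp: S_def intro!: mult_nonneg_nonneg)
    also have "\<dots> = (\<Sum>i\<le>N. Q $ i) * (\<Sum>j\<le>N. S $ j)"
      by (simp add: sum_product sum.cartesian_product)
    also have "\<dots> \<le> (\<Sum>i\<le>N. Q $ i) * 1"
    proof (rule mult_left_mono)
      show "(\<Sum>j\<le>N. S $ j) \<le> 1"
        unfolding S_sum[symmetric] using S_nonneg[of "n - 1"] summable_rabs_cancel[OF S_sm]
        by (intro sum_le_suminf) (auto simp: S_def)
    qed (use Q(3) in \<open>auto intro: sum_nonneg\<close>)
    finally show ?thesis by (simp add: pmf_q)
  qed
  then show ?thesis
    using eval by (intro that[of q]) (simp_all add: pmf_q fps_sum_at_def)
qed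

section \<open>Limits of convolution roots\<close>

lemma char_convolution:
  assumes "real_distribution M" "real_distribution N"
  shows "real_distribution (convolution M N)" "char (convolution M N) t = char M t * char N t"
proof -
  interpret M: real_distribution M by fact
  interpret N: real_distribution N by fact
  interpret MN: pair_prob_space M N ..
  have conv: "convolution M N = distr (M \<Otimes>\<^sub>M N) borel (\<lambda>(x, y). x + y)"
    by (simp add: convolution_def)
  have meas: "(\<lambda>(x, y). x + y) \<in> measurable (M \<Otimes>\<^sub>M N) borel"
    by measurable
  show "real_distribution (convolution M N)"
    unfolding conv by (rule MN.real_distribution_distr[OF meas])
  have intM: "integrable M (\<lambda>x. iexp (t * x))" by (rule M.integrable_iexp) auto
  have intN: "integrable N (\<lambda>x. iexp (t * x))" by (rule N.integrable_iexp) auto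
  have "char (convolution M N) t = (CLINT z|M \<Otimes>\<^sub>M N. iexp (t * fst z) * iexp (t * snd z))"
    unfolding char_def conv
    by (subst integral_distr) (auto simp: case_prod_beta algebra_simps exp_add intro!: Bochner_Integration.integral_cong)
  also have "\<dots> = (CLINT x|M. (CLINT y|N. iexp (t * x) * iexp (t * y)))"
    by (subst MN.integral_fst'[symmetric])
       (auto intro!: MN.integrable_const_bound[where B = 1] simp: norm_mult case_prod_beta)
  also have "\<dots> = char M t * char N t"
    by (simp add: char_def)
  finally show "char (convolution M N) t = char M t * char N t" .
qed

lemma
  assumes "real_distribution N"
  shows real_distribution_convolution_power: "real_distribution (convolution_power N n)"
    and char_convolution_power: "char (convolution_power N n) t = char N t ^ n"
proof (induction n)
  case 0
  have R: "real_distribution (return borel (0::real))"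
    by (intro real_distribution.intro prob_space_return real_distribution_axioms.intro) auto
  case 1
  show ?case using R by simp
  case 2
  show ?case by (simp add: char_def integral_return)
next
  case (Suc n)
  case 1
  show ?case using char_convolution(1)[OF assms Suc.IH(1)] by simp
  case 2
  show ?case using char_convolution(2)[OF assms Suc.IH(1)] Suc.IH(2) by simp
qed

text \<open>
  A weak limit point of the \<open>\<nu> j\<close>, which exists by tightness, is an \<open>n\<close>-th convolution root of \<open>\<mu>\<close>
  by uniqueness of characteristic functions. No branch of an \<open>n\<close>-th root of \<open>char \<mu>\<close> has to be
  chosen.
\<close>

lemma infinitely_divisible_lawI_limit:
  assumes \<mu>: "real_distribution \<mu>"
    and root: "\<And>n. 0 < n \<Longrightarrow> \<exists>\<nu>. tight \<nu> \<and> (\<forall>t. (\<lambda>j. char (\<nu> j) t ^ n) \<longlonglongrightarrow> char \<mu> t)"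
  shows "infinitely_divisible_law \<mu>"
  unfolding infinitely_divisible_law_def
proof (intro allI impI)
  fix n :: nat assume "1 \<le> n"
  then obtain \<nu> where tight: "tight \<nu>" and lim: "\<And>t. (\<lambda>j. char (\<nu> j) t ^ n) \<longlonglongrightarrow> char \<mu> t"
    using root[of n] by auto
  have rd: "real_distribution (\<nu> j)" for j using tight by (simp add: tight_def)
  obtain s M where s: "strict_mono s" and M: "real_distribution M" and weak: "weak_conv_m (\<nu> \<circ> id \<circ> s) M"
    using tight_imp_convergent_subsubsequence[OF tight strict_mono_id] by blast
  have "char M t ^ n = char \<mu> t" for t
  proof (rule LIMSEQ_unique)
    have "(\<lambda>j. char ((\<nu> \<circ> id \<circ> s) j) t) \<longlonglongrightarrow> char M t"
      by (rule levy_continuity1[OF _ M weak]) (simp add: rd)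
    then show "(\<lambda>j. char (\<nu> (s j)) t ^ n) \<longlonglongrightarrow> char M t ^ n"
      by (intro tendsto_power) simp
    show "(\<lambda>j. char (\<nu> (s j)) t ^ n) \<longlonglongrightarrow> char \<mu> t"
      using LIMSEQ_subseq_LIMSEQ[OF lim s] by (simp add: comp_def)
  qed
  then have "char \<mu> = char (convolution_power M n)"
    by (simp add: fun_eq_iff char_convolution_power[OF M])
  then have "\<mu> = convolution_power M n"
    by (intro Levy_uniqueness \<mu> real_distribution_convolution_power M)
  with M show "\<exists>\<nu>. real_distribution \<nu> \<and> \<mu> = convolution_power \<nu> n" by blast
qed

text \<open>
  The half-open interval starts at \<open>-1\<close> so that it contains the atom at 0.
\<close>

lemma char_lattice_pmf:
  fixes q :: "nat pmf" and h t :: real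
  defines "\<nu> \<equiv> distr (measure_pmf q) borel (\<lambda>k. real k * h)"
  shows "real_distribution \<nu>"
    and "char \<nu> t = (\<Sum>k. of_real (pmf q k) * iexp (t * h) ^ k)"
    and "0 < h \<Longrightarrow> measure \<nu> {-1<..real N * h} = (\<Sum>k\<le>N. pmf q k)"
proof -
  show "real_distribution \<nu>"
    unfolding \<nu>_def by (rule prob_space.real_distribution_distr[OF prob_space_measure_pmf]) simp
  have "char \<nu> t = (CLINT k|measure_pmf q. iexp (t * (real k * h)))"
    unfolding char_def \<nu>_def by (subst integral_distr) auto
  also have "\<dots> = (CLINT k|count_space UNIV. pmf q k *\<^sub>R iexp (t * (real k * h)))"
    unfolding measure_pmf_eq_density by (subst integral_density) auto
  also have "\<dots> = (\<Sum>k. pmf q k *\<^sub>R iexp (t * (real k * h)))"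
  proof (rule integral_count_space_nat)
    have "integrable (count_space UNIV) (\<lambda>k. pmf q k)" by (rule integrable_pmf)
    then show "integrable (count_space UNIV) (\<lambda>k. pmf q k *\<^sub>R iexp (t * (real k * h)))"
      by (rule Bochner_Integration.integrable_bound) auto
  qed
  also have "\<dots> = (\<Sum>k. of_real (pmf q k) * iexp (t * h) ^ k)"
    by (intro suminf_cong) (simp add: scaleR_conv_of_real exp_of_nat_mult[symmetric] mult_ac)
  finally show "char \<nu> t = (\<Sum>k. of_real (pmf q k) * iexp (t * h) ^ k)" .
  assume h: "0 < h"
  have "measure \<nu> {-1<..real N * h} = measure (measure_pmf q) ((\<lambda>k. real k * h) -` {-1<..real N * h})"
    unfolding \<nu>_def by (subst measure_distr) auto
  also have "(\<lambda>k. real k * h) -` {-1<..real N * h} = {..N}"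
  proof -
    have "-1 < real k * h" for k using h by (meson less_le_trans mult_nonneg_nonneg of_nat_0_le_iff less_imp_le neg_less_0_iff_less zero_less_one order_less_le_trans)
    then show ?thesis using h by auto
  qed
  also have "measure (measure_pmf q) {..N} = (\<Sum>k\<le>N. pmf q k)"
    by (rule measure_measure_pmf_finite) simp
  finally show "measure \<nu> {-1<..real N * h} = (\<Sum>k\<le>N. pmf q k)" .
qed

section \<open>Mixtures of Gamma distributions of shape two\<close>

context
  fixes g :: "real \<Rightarrow> real"
  assumes g: "comp_mono g" and cont: "continuous_on {0<..} g" and pos: "\<And>x. 0 < x \<Longrightarrow> 0 < g x"
    and total: "(\<integral>\<^sup>+x. ennreal (indicator {0<..} x * (x * g x)) \<partial>lborel) = 1"
begin

definition dens :: "real \<Rightarrow> real" where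
  "dens x = indicator {0<..} x * (x * g x)"

text \<open>
  The density at the right end point of cell \<open>k\<close>. In the lattice law, the mass \<open>h * sample h k\<close>
  sits at the left end point \<open>k * h\<close>, which makes the mass at 0 positive and puts the coefficients
  of the generating function into the form required by \<open>fps_log_deriv_comp_mono_nonneg\<close>.
\<close>

definition sample :: "real \<Rightarrow> nat \<Rightarrow> real" where
  "sample h k = real (k + 1) * h * g (real (k + 1) * h)"

definition cell :: "real \<Rightarrow> nat \<Rightarrow> real set" where
  "cell h k = {real k * h<..real (k + 1) * h}"

text \<open>
  The cell at 0 is left out: there the density need not dominate its value at the right end point
  up to a constant, and the mass of this cell is treated in \<open>first_cell_tendsto_0\<close>.
\<close>

definition step_term :: "real \<Rightarrow> (nat \<Rightarrow> complex) \<Rightarrow> nat \<Rightarrow> real \<Rightarrow> complex" where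
  "step_term h c k x = indicator (cell h (Suc k)) x *\<^sub>R (of_real (sample h (Suc k)) * c (Suc k))"

definition step :: "real \<Rightarrow> (nat \<Rightarrow> complex) \<Rightarrow> real \<Rightarrow> complex" where
  "step h c x = (\<Sum>k. step_term h c k x)"

lemma dens_nonneg: "0 \<le> dens x"
  by (cases "0 < x") (simp_all add: dens_def less_imp_le pos)

lemma dens_measurable [measurable]: "dens \<in> borel_measurable borel"
proof -
  have "continuous_on {0<..} (\<lambda>x. x * g x)" by (intro continuous_intros cont)
  then have "(\<lambda>x. indicator {0<..} x *\<^sub>R (x * g x)) \<in> borel_measurable borel"
    by (intro borel_measurable_continuous_on_indicator) auto
  then show ?thesis by (simp add: dens_def[abs_def])
qed

lemma has_bochner_integral_dens: "has_bochner_integral lborel dens 1"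
  using total dens_nonneg
  by (intro has_bochner_integral_nn_integral) (auto simp: dens_def[abs_def, symmetric] simp flip: dens_def)

lemma integrable_dens: "integrable lborel dens"
  using has_bochner_integral_dens by (simp add: has_bochner_integral_iff)

lemma sample_pos: "0 < h \<Longrightarrow> 0 < sample h k"
  unfolding sample_def by (intro mult_pos_pos pos) auto

lemma cell_unique:
  assumes h: "0 < h" and x: "0 < x"
  obtains K where "\<And>k. x \<in> cell h k \<longleftrightarrow> k = K" "real K * h < x" "x \<le> real (K + 1) * h"
proof -
  define K where "K = nat (\<lceil>x / h\<rceil> - 1)"
  have "0 < x / h" using h x by simp
  then have "1 \<le> \<lceil>x / h\<rceil>" by linarith
  then have K: "real K < x / h" "x / h \<le> real (K + 1)" unfolding K_def by linarith+
  have "x \<in> cell h k \<longleftrightarrow> k = K" for k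
  proof -
    have "x \<in> cell h k \<longleftrightarrow> real k < x / h \<and> x / h \<le> real (k + 1)"
      using h by (simp add: cell_def pos_less_divide_eq pos_divide_le_eq)
    also have "\<dots> \<longleftrightarrow> k = K" using K by linarith
    finally show ?thesis .
  qed
  moreover have "real K * h < x" "x \<le> real (K + 1) * h"
    using K h by (simp_all add: pos_less_divide_eq pos_divide_le_eq)
  ultimately show ?thesis by (rule that)
qed

lemma step_term_sums:
  assumes h: "0 < h" and K: "\<And>k. x \<in> cell h k \<longleftrightarrow> k = K"
  shows "(\<lambda>k. step_term h c k x) sums (if K = 0 then 0 else of_real (sample h K) * c K)"
proof (cases K)
  case 0
  then have "step_term h c k x = 0" for k by (simp add: step_term_def K)
  then show ?thesis using 0 by simp
next
  case (Suc m)
  then have "step_term h c k x = (if k = m then of_real (sample h K) * c K else 0)" for k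
    by (simp add: step_term_def K)
  then show ?thesis using Suc sums_single[of m "\<lambda>_. of_real (sample h K) * c K"] by simp
qed

lemma step_term_nonpos: "0 < h \<Longrightarrow> x \<le> 0 \<Longrightarrow> step_term h c k x = 0"
proof -
  assume "0 < h" "x \<le> 0"
  then have "x \<le> real (Suc k) * h" by (meson mult_nonneg_nonneg of_nat_0_le_iff less_imp_le order_trans)
  then have "x \<notin> cell h (Suc k)" by (simp add: cell_def)
  then show ?thesis by (simp add: step_term_def)
qed

text \<open>
  \<open>g\<close> decreases, and the argument \<open>(k + 2) * h\<close> is at most twice any point of a cell other than
  the first.
\<close>

lemma sample_le_dens:
  assumes h: "0 < h" and x: "x \<in> cell h (Suc k)"
  shows "sample h (Suc k) \<le> 2 * dens x"
proof -
  have kx: "real (Suc k) * h < x" "x \<le> real (Suc k + 1) * h" using x by (auto simp: cell_def)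
  have "0 < real (Suc k) * h" using h by simp
  then have x0: "0 < x" using kx by linarith
  have "1 * h \<le> real (Suc k) * h" using h by (intro mult_right_mono) auto
  moreover have "real (Suc k + 1) * h = real (Suc k) * h + h" by (simp add: algebra_simps)
  ultimately have "real (Suc k + 1) * h \<le> 2 * x" using kx by linarith
  moreover have "g (real (Suc k + 1) * h) \<le> g x" by (rule comp_mono_antimono[OF g x0 kx(2)])
  ultimately have "sample h (Suc k) \<le> 2 * x * g x"
    unfolding sample_def by (rule mult_mono) (use x0 h pos[of "real (Suc k + 1) * h"] in \<open>simp_all add: less_imp_le\<close>)
  then show ?thesis using x0 by (simp add: dens_def)
qed

lemma step_term_summable: "0 < h \<Longrightarrow> summable (\<lambda>k. norm (step_term h c k x))"
  and step_bound: "0 < h \<Longrightarrow> (\<And>k. cmod (c k) \<le> 1) \<Longrightarrow> cmod (step h c x) \<le> 2 * dens x"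
proof -
  assume h: "0 < h"
  show "summable (\<lambda>k. norm (step_term h c k x))"
  proof (cases "0 < x")
    case True
    then obtain K where K: "\<And>k. x \<in> cell h k \<longleftrightarrow> k = K" by (rule cell_unique[OF h]) blast
    show ?thesis by (rule summable_finite[of "{K - 1}"]) (auto simp: step_term_def K indicator_def)
  qed (simp add: step_term_nonpos h)
  assume c: "\<And>k. cmod (c k) \<le> 1"
  show "cmod (step h c x) \<le> 2 * dens x"
  proof (cases "0 < x")
    case True
    then obtain K where K: "\<And>k. x \<in> cell h k \<longleftrightarrow> k = K" by (rule cell_unique[OF h]) blast
    have eq: "step h c x = (if K = 0 then 0 else of_real (sample h K) * c K)"
      using sums_unique[OF step_term_sums[OF h K]] by (simp add: step_def)
    show ?thesis
    proof (cases K)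
      case (Suc m)
      have "cmod (step h c x) \<le> sample h K * 1"
        using eq Suc c[of K] sample_pos[OF h, of K] by (simp add: norm_mult mult_left_le)
      then show ?thesis using sample_le_dens[OF h, of x m] K[of "Suc m"] Suc by simp
    qed (simp add: eq dens_nonneg)
  next
    case False
    then show ?thesis using dens_nonneg by (simp add: step_def step_term_nonpos h)
  qed
qed

lemma has_bochner_integral_step_term:
  assumes h: "0 < h"
  shows "has_bochner_integral lborel (step_term h c k) (of_real (h * sample h (Suc k)) * c (Suc k))"
proof -
  have "has_bochner_integral lborel (\<lambda>x. indicator (cell h (Suc k)) x :: real) (measure lborel (cell h (Suc k)))"
    using h by (intro has_bochner_integral_real_indicator) (auto simp: cell_def)
  moreover have "measure lborel (cell h (Suc k)) = h"
    using h by (simp add: cell_def algebra_simps)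
  ultimately have "has_bochner_integral lborel (\<lambda>x. indicator (cell h (Suc k)) x :: real) h" by simp
  from has_bochner_integral_scaleR_left[OF this, of "of_real (sample h (Suc k)) * c (Suc k)"]
  show ?thesis by (simp add: step_term_def[abs_def] scaleR_conv_of_real mult_ac)
qed

lemma summable_lattice: "0 < h \<Longrightarrow> summable (\<lambda>k. h * sample h (Suc k))"
proof (rule summableI_nonneg_bounded)
  assume h: "0 < h"
  show "0 \<le> h * sample h (Suc k)" for k using h sample_pos[OF h] by (simp add: less_imp_le)
  fix n
  have int: "has_bochner_integral lborel (\<lambda>x. \<Sum>k<n. step_term h (\<lambda>_. 1) k x) (\<Sum>k<n. of_real (h * sample h (Suc k)) * 1)"
    by (intro has_bochner_integral_sum has_bochner_integral_step_term h)
  have "(\<Sum>k<n. h * sample h (Suc k)) = cmod (LINT x|lborel. (\<Sum>k<n. step_term h (\<lambda>_. 1) k x))"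
  proof -
    have "(LINT x|lborel. (\<Sum>k<n. step_term h (\<lambda>_. 1) k x)) = of_real (\<Sum>k<n. h * sample h (Suc k))"
      using int by (simp add: has_bochner_integral_iff)
    moreover have "0 \<le> (\<Sum>k<n. h * sample h (Suc k))"
      using h sample_pos[OF h] by (intro sum_nonneg) (simp add: less_imp_le)
    ultimately show ?thesis by (simp only: norm_of_real abs_of_nonneg)
  qed
  also have "\<dots> \<le> (LINT x|lborel. norm (\<Sum>k<n. step_term h (\<lambda>_. 1) k x))"
    by (rule integral_norm_bound)
  also have "\<dots> \<le> (LINT x|lborel. 2 * dens x)"
  proof (rule integral_mono)
    show "integrable lborel (\<lambda>x. norm (\<Sum>k<n. step_term h (\<lambda>_. 1) k x))"
      using int by (intro integrable_norm) (simp add: has_bochner_integral_iff)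
    show "integrable lborel (\<lambda>x. 2 * dens x)" using integrable_dens by simp
    fix x :: real
    show "norm (\<Sum>k<n. step_term h (\<lambda>_. 1) k x) \<le> 2 * dens x"
    proof (cases "0 < x")
      case True
      then obtain K where K: "\<And>k. x \<in> cell h k \<longleftrightarrow> k = K" by (rule cell_unique[OF h]) blast
      have "(\<Sum>k<n. step_term h (\<lambda>_. 1) k x) = (\<Sum>k<n. if k = K - 1 then (if K = 0 then 0 else of_real (sample h K)) else 0)"
        by (intro sum.cong refl) (auto simp: step_term_def K)
      also have "\<dots> = (if K - 1 < n then (if K = 0 then 0 else of_real (sample h K)) else 0)" by simp
      finally have eq: "(\<Sum>k<n. step_term h (\<lambda>_. 1) k x) = (if K - 1 < n then (if K = 0 then 0 else of_real (sample h K)) else 0)" .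
      show ?thesis
      proof (cases K)
        case (Suc m)
        then show ?thesis using eq sample_le_dens[OF h, of x m] K[of "Suc m"] sample_pos[OF h, of K] dens_nonneg[of x]
          by auto
      qed (simp add: eq dens_nonneg)
    qed (simp add: step_term_nonpos h dens_nonneg)
  qed
  finally show "(\<Sum>k<n. h * sample h (Suc k)) \<le> (LINT x|lborel. 2 * dens x)" .
qed

lemma lattice_sums:
  assumes h: "0 < h" and c: "\<And>k. cmod (c k) \<le> 1"
  shows "(\<lambda>k. of_real (h * sample h k) * c k) sums (of_real (h * sample h 0) * c 0 + (LINT x|lborel. step h c x))"
    and "integrable lborel (step h c)"
proof -
  have int: "integrable lborel (step_term h c k)" for k
    using has_bochner_integral_step_term[OF h] by (auto simp: has_bochner_integral_iff)
  have norm_int: "(LINT x|lborel. norm (step_term h c k x)) = h * sample h (Suc k) * cmod (c (Suc k))" for k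
  proof -
    have "norm (step_term h c k x) = indicator (cell h (Suc k)) x * (sample h (Suc k) * cmod (c (Suc k)))" for x
      using sample_pos[OF h, of "Suc k"] by (simp add: step_term_def norm_mult)
    moreover have "measure lborel (cell h (Suc k)) = h" using h by (simp add: cell_def algebra_simps)
    ultimately show ?thesis by (simp add: cell_def)
  qed
  have sm: "summable (\<lambda>k. LINT x|lborel. norm (step_term h c k x))"
  proof (rule summable_comparison_test[OF _ summable_lattice[OF h]])
    have "h * sample h (Suc k) * cmod (c (Suc k)) \<le> h * sample h (Suc k) * 1" for k
      using h sample_pos[OF h, of "Suc k"] c[of "Suc k"] by (intro mult_left_mono) auto
    then show "\<exists>N. \<forall>k\<ge>N. norm (LINT x|lborel. norm (step_term h c k x)) \<le> h * sample h (Suc k)"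
      unfolding norm_int using h sample_pos[OF h] by (auto simp: abs_mult less_imp_le)
  qed
  have AE: "AE x in lborel. summable (\<lambda>k. norm (step_term h c k x))"
    using step_term_summable[OF h] by simp
  have "(\<lambda>k. LINT x|lborel. step_term h c k x) sums (LINT x|lborel. step h c x)"
    unfolding step_def by (rule sums_integral[OF int AE sm])
  then have "(\<lambda>k. of_real (h * sample h (Suc k)) * c (Suc k)) sums (LINT x|lborel. step h c x)"
    using has_bochner_integral_step_term[OF h] by (simp add: has_bochner_integral_iff)
  then show "(\<lambda>k. of_real (h * sample h k) * c k) sums (of_real (h * sample h 0) * c 0 + (LINT x|lborel. step h c x))"
    by (subst (asm) sums_Suc_iff) (simp add: add.commute)
  show "integrable lborel (step h c)"
    unfolding step_def[abs_def] by (rule integrable_suminf[OF int AE sm])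
qed

text \<open>
  On the upper half of the first cell the density is at least half of its value at the right end
  point, so the mass of this cell is bounded by an integral over a shrinking interval.
\<close>

lemma first_cell_tendsto_0:
  assumes h: "\<And>n. 0 < h n" "h \<longlonglongrightarrow> 0"
  shows "(\<lambda>n. h n * sample (h n) 0) \<longlonglongrightarrow> 0"
proof -
  define I where "I n = (LINT x|lborel. indicator {..h n} x * dens x)" for n
  have int: "integrable lborel (\<lambda>x. indicator A x * dens x)" if "A \<in> sets borel" for A
    using that by (intro Bochner_Integration.integrable_bound[OF integrable_dens]) (auto simp: indicator_def dens_nonneg)
  have "I \<longlonglongrightarrow> (LINT x|(lborel :: real measure). 0 :: real)"
    unfolding I_def
  proof (rule integral_dominated_convergence[where w = dens and f = "\<lambda>_. 0"
        and s = "\<lambda>n x. indicator {..h n} x * dens x"])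
    show "integrable lborel dens" by (rule integrable_dens)
    show "AE x in lborel. (\<lambda>n. indicator {..h n} x * dens x) \<longlonglongrightarrow> 0"
    proof (intro AE_I2)
      fix x :: real
      show "(\<lambda>n. indicator {..h n} x * dens x) \<longlonglongrightarrow> 0"
      proof (cases "0 < x")
        case True
        from order_tendstoD(2)[OF h(2) this]
        show ?thesis by (intro tendsto_eventually) (auto elim: eventually_mono)
      qed (simp add: dens_def)
    qed
    show "AE x in lborel. norm (indicator {..h n} x * dens x) \<le> dens x" for n
      by (auto simp: indicator_def dens_nonneg)
  qed auto
  then have lim: "(\<lambda>n. 4 * I n) \<longlonglongrightarrow> 0" using tendsto_mult_left[of I 0 _ 4] by simp
  have "h n * sample (h n) 0 \<le> 4 * I n" for n
  proof -
    define a where "a = h n"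
    have a: "0 < a" using h by (simp add: a_def)
    have "(LINT x|lborel. indicator {a/2<..a} x * (a / 2 * g a)) \<le> I n"
      unfolding I_def
    proof (rule integral_mono)
      show "integrable lborel (\<lambda>x. indicator {a/2<..a} x * (a / 2 * g a))"
        by (intro integrable_mult_left integrable_real_indicator) (use a in auto)
      show "integrable lborel (\<lambda>x. indicator {..h n} x * dens x)" by (rule int) simp
      fix x
      show "indicator {a/2<..a} x * (a / 2 * g a) \<le> indicator {..h n} x * dens x"
      proof (cases "x \<in> {a/2<..a}")
        case True
        then have x: "0 < x" "a / 2 \<le> x" "x \<le> a" using a by auto
        have "a / 2 * g a \<le> x * g x"
          using x a pos[of a] comp_mono_antimono[OF g x(1,3)] by (intro mult_mono) auto
        then show ?thesis using True x by (simp add: dens_def a_def)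
      qed (simp add: dens_nonneg)
    qed
    moreover have "(LINT x|lborel. indicator {a/2<..a} x * (a / 2 * g a)) = a / 2 * (a / 2 * g a)"
      using a by simp
    ultimately have "a / 2 * (a / 2 * g a) \<le> I n" by (simp only:)
    then show ?thesis by (simp add: sample_def flip: a_def)
  qed
  then show ?thesis
    using h(1) sample_pos
    by (intro tendsto_sandwich[OF always_eventually always_eventually tendsto_const lim])
       (auto intro!: mult_nonneg_nonneg less_imp_le)
qed

lemma step_integral_tendsto:
  assumes h: "\<And>n. 0 < h n" "h \<longlonglongrightarrow> 0" and \<phi>: "\<And>x. isCont \<phi> x" "\<And>x. cmod (\<phi> x) \<le> 1"
  shows "(\<lambda>n. LINT x|lborel. step (h n) (\<lambda>k. \<phi> (real k * h n)) x) \<longlonglongrightarrow> (LINT x|lborel. of_real (dens x) * \<phi> x)"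
proof (rule integral_dominated_convergence)
  have \<phi>_meas: "\<phi> \<in> borel_measurable borel"
    using \<phi>(1) by (intro borel_measurable_continuous_onI) (auto simp: continuous_on_eq_continuous_at)
  show "(\<lambda>x. of_real (dens x) * \<phi> x) \<in> borel_measurable lborel" using \<phi>_meas by simp
  show "step (h n) (\<lambda>k. \<phi> (real k * h n)) \<in> borel_measurable lborel" for n
    using lattice_sums(2)[OF h(1), of "\<lambda>k. \<phi> (real k * h n)"] \<phi>(2) by auto
  show "integrable lborel (\<lambda>x. 2 * dens x)" using integrable_dens by simp
  show "AE x in lborel. norm (step (h n) (\<lambda>k. \<phi> (real k * h n)) x) \<le> 2 * dens x" for n
    using step_bound[OF h(1)] \<phi>(2) by simp
  show "AE x in lborel. (\<lambda>n. step (h n) (\<lambda>k. \<phi> (real k * h n)) x) \<longlonglongrightarrow> of_real (dens x) * \<phi> x"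
  proof (intro AE_I2)
    fix x :: real
    show "(\<lambda>n. step (h n) (\<lambda>k. \<phi> (real k * h n)) x) \<longlonglongrightarrow> of_real (dens x) * \<phi> x"
    proof (cases "0 < x")
      case True
      have "\<exists>K. (\<forall>k. x \<in> cell (h n) k \<longleftrightarrow> k = K) \<and> real K * h n < x \<and> x \<le> real (K + 1) * h n" for n
        using cell_unique[OF h(1) True] by metis
      then obtain K where K: "\<And>n k. x \<in> cell (h n) k \<longleftrightarrow> k = K n"
          "\<And>n. real (K n) * h n < x" "\<And>n. x \<le> real (K n + 1) * h n" by metis
      have left: "(\<lambda>n. real (K n) * h n) \<longlonglongrightarrow> x"
      proof (rule tendsto_sandwich[OF _ _ _ tendsto_const])
        show "\<forall>\<^sub>F n in sequentially. x - h n \<le> real (K n) * h n"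
          using K(3) by (auto simp: algebra_simps)
        show "\<forall>\<^sub>F n in sequentially. real (K n) * h n \<le> x" 
          by (intro always_eventually allI less_imp_le K(2))
        show "(\<lambda>n. x - h n) \<longlonglongrightarrow> x" using tendsto_diff[OF tendsto_const h(2), of x] by simp
      qed
      have right: "(\<lambda>n. real (K n + 1) * h n) \<longlonglongrightarrow> x"
        using tendsto_add[OF left h(2)] by (simp add: algebra_simps)
      have "isCont g x" using cont True by (simp add: continuous_on_eq_continuous_at)
      then have "(\<lambda>n. sample (h n) (K n)) \<longlonglongrightarrow> x * g x"
        unfolding sample_def by (intro tendsto_mult right isCont_tendsto_compose[OF _ right])
      then have lim: "(\<lambda>n. of_real (sample (h n) (K n)) * \<phi> (real (K n) * h n)) \<longlonglongrightarrow> of_real (x * g x) * \<phi> x"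
        by (intro tendsto_mult tendsto_of_real isCont_tendsto_compose[OF \<phi>(1) left])
      have "\<forall>\<^sub>F n in sequentially. of_real (sample (h n) (K n)) * \<phi> (real (K n) * h n)
          = step (h n) (\<lambda>k. \<phi> (real k * h n)) x"
        using order_tendstoD(2)[OF h(2) True]
      proof eventually_elim
        case (elim n)
        then have "K n \<noteq> 0" using K(3)[of n] by (intro notI) simp
        then show ?case
          using sums_unique[OF step_term_sums[OF h(1)[of n] K(1)[of n], where c = "\<lambda>k. \<phi> (real k * h n)"]] by (simp add: step_def)
      qed
      with lim have "(\<lambda>n. step (h n) (\<lambda>k. \<phi> (real k * h n)) x) \<longlonglongrightarrow> of_real (x * g x) * \<phi> x"
        by (rule Lim_transform_eventually)
      then show ?thesis using True by (simp add: dens_def)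
    qed (simp add: step_def step_term_nonpos h dens_def)
  qed
qed

definition lattice_mass :: "real \<Rightarrow> real" where
  "lattice_mass h = (\<Sum>k. h * sample h k)"

lemma lattice_mass_sums: "0 < h \<Longrightarrow> (\<lambda>k. h * sample h k) sums lattice_mass h"
  using summable_lattice[of h] unfolding lattice_mass_def
  by (intro summable_sums) (simp only: summable_Suc_iff[of "\<lambda>k. h * sample h k"])

lemma lattice_mass_pos: "0 < h \<Longrightarrow> 0 < lattice_mass h"
  unfolding lattice_mass_def using sample_pos[of h]
  by (intro suminf_pos) (use lattice_mass_sums[of h] in \<open>auto simp: sums_iff\<close>)

lemma lattice_tendsto:
  assumes h: "\<And>n. 0 < h n" "h \<longlonglongrightarrow> 0" and \<phi>: "\<And>x. isCont \<phi> x" "\<And>x. cmod (\<phi> x) \<le> 1"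
  shows "(\<lambda>n. \<Sum>k. of_real (h n * sample (h n) k) * \<phi> (real k * h n)) \<longlonglongrightarrow> (LINT x|lborel. of_real (dens x) * \<phi> x)"
proof -
  have eq: "(\<Sum>k. of_real (h n * sample (h n) k) * \<phi> (real k * h n))
      = of_real (h n * sample (h n) 0) * \<phi> 0 + (LINT x|lborel. step (h n) (\<lambda>k. \<phi> (real k * h n)) x)" for n
    using sums_unique[OF lattice_sums(1)[OF h(1)[of n], of "\<lambda>k. \<phi> (real k * h n)"]] \<phi>(2) by simp
  have "(\<lambda>n. of_real (h n * sample (h n) 0) * \<phi> 0 + (LINT x|lborel. step (h n) (\<lambda>k. \<phi> (real k * h n)) x))
      \<longlonglongrightarrow> of_real 0 * \<phi> 0 + (LINT x|lborel. of_real (dens x) * \<phi> x)"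
    by (intro tendsto_add tendsto_mult tendsto_const tendsto_of_real first_cell_tendsto_0 step_integral_tendsto h \<phi>)
  then show ?thesis unfolding eq by simp
qed

lemma lattice_mass_tendsto:
  assumes h: "\<And>n. 0 < h n" "h \<longlonglongrightarrow> 0"
  shows "(\<lambda>n. lattice_mass (h n)) \<longlonglongrightarrow> 1"
proof -
  have "complex_of_real (lattice_mass (h n)) = (\<Sum>k. of_real (h n * sample (h n) k) * 1)" for n
    unfolding lattice_mass_def using lattice_mass_sums[OF h(1)[of n]]
    by (subst suminf_of_real) (auto simp: sums_iff)
  moreover have "(LINT x|lborel. complex_of_real (dens x) * 1) = 1"
    using has_bochner_integral_dens by (simp add: has_bochner_integral_iff)
  ultimately have "(\<lambda>n. complex_of_real (lattice_mass (h n))) \<longlonglongrightarrow> of_real 1"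
    using lattice_tendsto[OF h, of "\<lambda>_. 1"] by simp
  then show ?thesis by (simp only: tendsto_of_real_iff)
qed

text \<open>
  An integral of \<open>step\<close> with coefficients that vanish up to \<open>N\<close>. The bound is independent of the
  mesh, as tightness demands.
\<close>

lemma lattice_tail:
  assumes h: "0 < h" and M: "0 \<le> M" "M < real (N + 1) * h"
  shows "lattice_mass h - (\<Sum>k\<le>N. h * sample h k) \<le> (LINT x|lborel. indicator {M<..} x * (2 * dens x))"
proof -
  define c where "c k = (if k \<le> N then 0 else 1 :: complex)" for k
  have c: "cmod (c k) \<le> 1" for k by (simp add: c_def)
  have "(\<lambda>k. complex_of_real (h * sample h k)) sums of_real (lattice_mass h)"
    by (intro sums_of_real lattice_mass_sums h)
  moreover have "(\<lambda>k. if k \<in> {..N} then complex_of_real (h * sample h k) else 0) sums (\<Sum>k\<le>N. of_real (h * sample h k))"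
    by (rule sums_If_finite_set) simp
  ultimately have "(\<lambda>k. of_real (h * sample h k) - (if k \<in> {..N} then complex_of_real (h * sample h k) else 0))
      sums (of_real (lattice_mass h) - (\<Sum>k\<le>N. of_real (h * sample h k)))" by (rule sums_diff)
  moreover have "of_real (h * sample h k) - (if k \<in> {..N} then complex_of_real (h * sample h k) else 0)
      = of_real (h * sample h k) * c k" for k by (simp add: c_def)
  ultimately have "(\<lambda>k. of_real (h * sample h k) * c k)
      sums (of_real (lattice_mass h) - (\<Sum>k\<le>N. of_real (h * sample h k)))" by (simp only:)
  from sums_unique2[OF this lattice_sums(1)[of h c, OF h c]]
  have eq: "complex_of_real (lattice_mass h - (\<Sum>k\<le>N. h * sample h k)) = (LINT x|lborel. step h c x)"
    by (simp add: c_def)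
  have "lattice_mass h - (\<Sum>k\<le>N. h * sample h k) \<le> cmod (complex_of_real (lattice_mass h - (\<Sum>k\<le>N. h * sample h k)))"
    by (simp only: norm_of_real abs_ge_self)
  also have "\<dots> \<le> (LINT x|lborel. norm (step h c x))"
    unfolding eq by (rule integral_norm_bound)
  also have "\<dots> \<le> (LINT x|lborel. indicator {M<..} x * (2 * dens x))"
  proof (rule integral_mono)
    show "integrable lborel (\<lambda>x. norm (step h c x))" by (intro integrable_norm lattice_sums(2) h c)
    show "integrable lborel (\<lambda>x. indicator {M<..} x * (2 * dens x))"
      by (rule Bochner_Integration.integrable_bound[of _ "\<lambda>x. 2 * dens x"])
         (use integrable_dens in \<open>auto simp: indicator_def\<close>)
    fix x :: real
    show "norm (step h c x) \<le> indicator {M<..} x * (2 * dens x)"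
    proof (cases "M < x")
      case True
      then show ?thesis using step_bound[of h c, OF h c] by simp
    next
      case False
      have "step_term h c k x = 0" for k
      proof (cases "k < N")
        case True
        then show ?thesis by (simp add: step_term_def c_def)
      next
        case False
        then have "real (N + 1) * h \<le> real (Suc k) * h" using h by (intro mult_right_mono) auto
        then have "x \<notin> cell h (Suc k)" using M \<open>\<not> M < x\<close> by (auto simp: cell_def)
        then show ?thesis by (simp add: step_term_def)
      qed
      then show ?thesis using False by (simp add: step_def)
    qed
  qed
  finally show ?thesis .
qed

lemma tail_tendsto_0: "(\<lambda>n. LINT x|lborel. indicator {real n<..} x * (2 * dens x)) \<longlonglongrightarrow> 0"
proof -
  have "(\<lambda>n. LINT x|lborel. indicator {real n<..} x * (2 * dens x)) \<longlonglongrightarrow> (LINT x|(lborel :: real measure). 0 :: real)"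
  proof (rule integral_dominated_convergence[where w = "\<lambda>x. 2 * dens x"])
    show "integrable lborel (\<lambda>x. 2 * dens x)" using integrable_dens by simp
    show "AE x in lborel. (\<lambda>n. indicator {real n<..} x * (2 * dens x)) \<longlonglongrightarrow> 0"
    proof (intro AE_I2 tendsto_eventually)
      fix x :: real
      show "\<forall>\<^sub>F n in sequentially. indicator {real n<..} x * (2 * dens x) = 0"
        using eventually_ge_at_top[of "nat \<lceil>x\<rceil>"]
      proof eventually_elim
        case (elim n)
        then have "x \<le> real n" by linarith
        then show ?case by simp
      qed
    qed
    show "AE x in lborel. norm (indicator {real n<..} x * (2 * dens x)) \<le> 2 * dens x" for n
      by (auto simp: indicator_def dens_nonneg)
  qed auto
  then show ?thesis by simp
qed

lemma lattice_root:
  assumes h: "0 < h" and n: "0 < n"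
  obtains q :: "nat pmf" where
    "\<And>t. (\<Sum>k. of_real (pmf q k) * iexp (t * h) ^ k) ^ n
        = (\<Sum>k. of_real (h * sample h k) * iexp (t * (real k * h))) / of_real (lattice_mass h)"
    "\<And>N. (\<Sum>k\<le>N. h * sample h k) / lattice_mass h \<le> (\<Sum>k\<le>N. pmf q k)"
proof -
  define Z where "Z = lattice_mass h"
  have Z: "0 < Z" unfolding Z_def by (rule lattice_mass_pos[OF h])
  define G where "G = Abs_fps (\<lambda>k. real (k + 1) * g (real (k + 1) * h))"
  define P where "P = fps_const (h\<^sup>2 / Z) * G"
  have P_k: "P $ k = h * sample h k / Z" for k
    by (simp add: P_def G_def sample_def power2_eq_square)
  have G0: "0 < g h" by (rule pos[OF h])
  have ld: "0 \<le> fps_log_deriv P $ k" for k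
    unfolding P_def using h Z G0 fps_log_deriv_comp_mono_nonneg[OF g h G0]
    by (subst fps_log_deriv_const_mult) (auto simp: G_def)
  have sums: "(\<lambda>k. P $ k) sums 1"
    using sums_divide[OF lattice_mass_sums[OF h], of Z] Z by (simp add: P_k Z_def)
  have P_pos: "0 < P $ k" for k using h Z sample_pos[OF h] by (simp add: P_k)
  obtain q :: "nat pmf" where q:
    "\<And>z. cmod z \<le> 1 \<Longrightarrow> (\<Sum>k. of_real (pmf q k) * z ^ k) ^ n = (\<Sum>k. of_real (P $ k) * z ^ k)"
    "\<And>N. (\<Sum>k\<le>N. P $ k) \<le> (\<Sum>k\<le>N. pmf q k)"
    by (rule fps_distribution_root[OF P_pos less_imp_le[OF P_pos] sums ld n]) blast
  show ?thesis
  proof (rule that)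
    fix t
    have "cmod (iexp (t * h)) \<le> 1" by simp
    from q(1)[OF this]
    have "(\<Sum>k. of_real (pmf q k) * iexp (t * h) ^ k) ^ n = (\<Sum>k. of_real (P $ k) * iexp (t * h) ^ k)" .
    also have "\<dots> = (\<Sum>k. of_real (h * sample h k) * iexp (t * (real k * h)) / of_real Z)"
    proof (rule suminf_cong)
      fix k
      have "iexp (t * h) ^ k = iexp (t * (real k * h))"
        by (simp add: exp_of_nat_mult[symmetric] mult_ac)
      then show "of_real (P $ k) * iexp (t * h) ^ k = of_real (h * sample h k) * iexp (t * (real k * h)) / of_real Z"
        by (simp add: P_k)
    qed
    also have "\<dots> = (\<Sum>k. of_real (h * sample h k) * iexp (t * (real k * h))) / of_real Z"
      using lattice_sums(1)[OF h, of "\<lambda>k. iexp (t * (real k * h))"]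
      by (intro suminf_divide) (auto simp: sums_iff)
    finally show "(\<Sum>k. of_real (pmf q k) * iexp (t * h) ^ k) ^ n
        = (\<Sum>k. of_real (h * sample h k) * iexp (t * (real k * h))) / of_real (lattice_mass h)"
      by (simp add: Z_def)
  next
    show "(\<Sum>k\<le>N. h * sample h k) / lattice_mass h \<le> (\<Sum>k\<le>N. pmf q k)" for N
      using q(2)[of N] by (simp add: P_k Z_def sum_divide_distrib)
  qed
qed

text \<open>
  Kristiansen's theorem for continuous densities. The lattice laws have convolution roots of all
  orders; those are stochastically smaller than the lattice laws, hence tight, and the powers of
  their characteristic functions converge to that of \<open>\<mu>\<close>.
\<close>

theorem infinitely_divisible_gamma2_mixture:
  assumes \<mu>: "real_distribution \<mu>" and \<mu>_eq: "\<mu> = density lborel (\<lambda>x. ennreal (indicator {0<..} x * (x * g x)))"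
  shows "infinitely_divisible_law \<mu>"
proof (rule infinitely_divisible_lawI_limit[OF \<mu>])
  fix n :: nat assume n: "0 < n"
  have "(\<lambda>j. lattice_mass (1 / real (Suc j))) \<longlonglongrightarrow> 1"
    by (rule lattice_mass_tendsto) (simp, real_asymp)
  \<comment> \<open>The total mass is kept away from 0, since the lattice laws are divided by it.\<close>
  from order_tendstoD(1)[OF this, of "1/2"]
  obtain J where J: "\<And>j. J \<le> j \<Longrightarrow> 1/2 < lattice_mass (1 / real (Suc j))"
    by (auto simp: eventually_sequentially)
  define h where "h j = 1 / real (Suc (J + j))" for j
  have h: "0 < h j" for j by (simp add: h_def)
  have h0: "h \<longlonglongrightarrow> 0" unfolding h_def by real_asymp
  have Z: "1/2 < lattice_mass (h j)" for j unfolding h_def by (rule J) simp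
  have "\<exists>q :: nat pmf. (\<forall>t. (\<Sum>k. of_real (pmf q k) * iexp (t * h j) ^ k) ^ n
        = (\<Sum>k. of_real (h j * sample (h j) k) * iexp (t * (real k * h j))) / of_real (lattice_mass (h j)))
      \<and> (\<forall>N. (\<Sum>k\<le>N. h j * sample (h j) k) / lattice_mass (h j) \<le> (\<Sum>k\<le>N. pmf q k))" for j
    by (rule lattice_root[OF h[of j] n]) blast
  then obtain q :: "nat \<Rightarrow> nat pmf" where q:
    "\<And>j t. (\<Sum>k. of_real (pmf (q j) k) * iexp (t * h j) ^ k) ^ n
        = (\<Sum>k. of_real (h j * sample (h j) k) * iexp (t * (real k * h j))) / of_real (lattice_mass (h j))"
    "\<And>j N. (\<Sum>k\<le>N. h j * sample (h j) k) / lattice_mass (h j) \<le> (\<Sum>k\<le>N. pmf (q j) k)"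
    by metis
  define \<nu> where "\<nu> j = distr (measure_pmf (q j)) borel (\<lambda>k. real k * h j)" for j
  have "tight \<nu>"
    unfolding tight_def
  proof (intro conjI allI impI)
    show "real_distribution (\<nu> j)" for j unfolding \<nu>_def by (rule char_lattice_pmf)
    fix \<epsilon> :: real assume \<epsilon>: "0 < \<epsilon>"
    then have "0 < \<epsilon> / 2" by simp
    from order_tendstoD(2)[OF tail_tendsto_0 this]
    obtain m where m: "(LINT x|lborel. indicator {real m<..} x * (2 * dens x)) < \<epsilon> / 2"
      by (auto simp: eventually_sequentially)
    have "1 - \<epsilon> < measure (\<nu> j) {-1<..real m}" for j
    proof -
      define N where "N = nat \<lfloor>real m / h j\<rfloor>"
      have "0 \<le> real m / h j" using h[of j] by simp
      then have N: "real N \<le> real m / h j" "real m / h j < real (N + 1)" unfolding N_def by linarith+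
      have Nh: "real N * h j \<le> real m" "real m < real (N + 1) * h j"
        using N h[of j] by (simp_all add: pos_le_divide_eq pos_divide_less_eq)
      define Z where "Z = lattice_mass (h j)"
      have Z2: "1/2 < Z" using Z by (simp add: Z_def)
      have "Z - (\<Sum>k\<le>N. h j * sample (h j) k) < \<epsilon> / 2"
        using lattice_tail[OF h[of j] _ Nh(2)] m by (simp add: Z_def)
      also have "\<dots> \<le> \<epsilon> * Z" using Z2 \<epsilon> by simp
      finally have "(1 - \<epsilon>) * Z < (\<Sum>k\<le>N. h j * sample (h j) k)" by (simp add: algebra_simps)
      then have "1 - \<epsilon> < (\<Sum>k\<le>N. h j * sample (h j) k) / Z"
        using Z2 by (simp add: pos_less_divide_eq)
      also have "\<dots> \<le> (\<Sum>k\<le>N. pmf (q j) k)" using q(2) by (simp add: Z_def)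
      also have "\<dots> = measure (\<nu> j) {-1<..real N * h j}"
        unfolding \<nu>_def using char_lattice_pmf(3)[OF h[of j]] by simp
      also have "\<dots> \<le> measure (\<nu> j) {-1<..real m}"
      proof -
        interpret R: real_distribution "\<nu> j" unfolding \<nu>_def by (rule char_lattice_pmf)
        show ?thesis using Nh by (intro R.finite_measure_mono) auto
      qed
      finally show ?thesis .
    qed
    then show "\<exists>a b. a < b \<and> (\<forall>j. 1 - \<epsilon> < measure (\<nu> j) {a<..b})"
      by (intro exI[of _ "-1"] exI[of _ "real m"]) auto
  qed
  moreover have "(\<lambda>j. char (\<nu> j) t ^ n) \<longlonglongrightarrow> char \<mu> t" for t
  proof -
    have char_eq: "char (\<nu> j) t ^ n
        = (\<Sum>k. of_real (h j * sample (h j) k) * iexp (t * (real k * h j))) / of_real (lattice_mass (h j))" for j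
      unfolding \<nu>_def char_lattice_pmf(2) by (rule q(1))
    have "(\<lambda>j. (\<Sum>k. of_real (h j * sample (h j) k) * iexp (t * (real k * h j))) / of_real (lattice_mass (h j)))
        \<longlonglongrightarrow> (LINT x|lborel. of_real (dens x) * iexp (t * x)) / of_real 1"
      by (intro tendsto_divide tendsto_of_real lattice_mass_tendsto h h0
            lattice_tendsto[of h "\<lambda>x. iexp (t * x)"]) (auto intro!: continuous_intros)
    moreover have "char \<mu> t = (LINT x|lborel. of_real (dens x) * iexp (t * x))"
    proof -
      have "char \<mu> t = (LINT x|lborel. dens x *\<^sub>R iexp (t * x))"
        unfolding char_def \<mu>_eq dens_def[symmetric] by (rule integral_density) (auto simp: dens_nonneg)
      then show ?thesis by (simp add: scaleR_conv_of_real)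
    qed
    ultimately show ?thesis unfolding char_eq by simp
  qed
  ultimately show "\<exists>\<nu>. tight \<nu> \<and> (\<forall>t. (\<lambda>j. char (\<nu> j) t ^ n) \<longlonglongrightarrow> char \<mu> t)" by blast
qed

end

section \<open>Powers of a random variable with symmetric density\<close>

lemma nn_integral_powr_substitution:
  fixes F :: "real \<Rightarrow> real"
  assumes F [measurable]: "F \<in> borel_measurable borel" and nonneg: "\<And>t. 0 \<le> F t"
    and int: "integrable lborel F" and q: "q \<noteq> 0"
  shows "(\<integral>\<^sup>+t. ennreal (indicator {0<..} t * F t) \<partial>lborel)
      = (\<integral>\<^sup>+x. ennreal (indicator {0<..} x * (\<bar>q * x powr (q - 1)\<bar> * F (x powr q))) \<partial>lborel)"
proof -
  have img: "(\<lambda>x. x powr q) ` {0<..} = {0::real<..}"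
  proof (intro equalityI subsetI)
    fix y :: real assume "y \<in> {0<..}"
    then show "y \<in> (\<lambda>x. x powr q) ` {0<..}"
      using q by (intro image_eqI[of _ _ "y powr (1 / q)"]) (auto simp: powr_powr)
  qed auto
  have "integrable lborel (\<lambda>t. indicator {0<..} t *\<^sub>R F t)"
    by (rule Bochner_Integration.integrable_bound[OF int]) (auto simp: indicator_def)
  then have "F absolutely_integrable_on {0<..}"
    unfolding set_integrable_def by (rule integrable_completion[THEN iffD2, rotated]) measurable
  then have A: "F absolutely_integrable_on (\<lambda>x. x powr q) ` {0<..}" unfolding img .
  define J where "J = integral {0<..} F"
  have B: "(\<lambda>x. \<bar>q * x powr (q - 1)\<bar> * F (x powr q)) absolutely_integrable_on {0<..} \<and>
      integral {0<..} (\<lambda>x. \<bar>q * x powr (q - 1)\<bar> * F (x powr q)) = J"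
  proof (rule has_absolute_integral_change_of_variables_1'[where g = "\<lambda>x. x powr q" and f = F, THEN iffD2])
    show "inj_on (\<lambda>x. x powr q) {0<..}"
    proof (rule inj_onI)
      fix x y :: real assume xy: "x \<in> {0<..}" "y \<in> {0<..}" "x powr q = y powr q"
      have "z = (z powr q) powr (1 / q)" if "0 < z" for z using that q by (simp add: powr_powr)
      then show "x = y" using xy by (metis greaterThan_iff)
    qed
    show "((\<lambda>x. x powr q) has_real_derivative q * x powr (q - 1)) (at x within {0<..})" if "x \<in> {0<..}" for x
      using that has_real_derivative_powr[of x q] by (auto intro: has_field_derivative_at_within)
    show "F absolutely_integrable_on (\<lambda>x. x powr q) ` {0<..} \<and> integral ((\<lambda>x. x powr q) ` {0<..}) F = J"
      using A by (simp add: img J_def)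
  qed simp
  have restrict: "(\<integral>\<^sup>+t. ennreal (indicator {0<..} t * G t) \<partial>lborel) = ennreal (integral {0<..} G)"
    if G [measurable]: "G \<in> borel_measurable borel" and "\<And>t. 0 \<le> G t" and "G absolutely_integrable_on {0<..}" for G :: "real \<Rightarrow> real"
  proof (rule nn_integral_has_integral_lborel)
    have "(G has_integral integral {0<..} G) {0<..}"
      using that(3) by (intro integrable_integral set_lebesgue_integral_eq_integral(1))
    then have "((\<lambda>x. if x \<in> {0<..} then G x else 0) has_integral integral {0<..} G) UNIV"
      by (simp only: has_integral_restrict_UNIV)
    then show "((\<lambda>x. indicator {0<..} x * G x) has_integral integral {0<..} G) UNIV"
      by (rule has_integral_eq[rotated]) (simp add: indicator_def)
  qed (use that(2) in auto)
  show ?thesis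
    using A B by (subst (1 2) restrict) (auto simp: nonneg img J_def)
qed

text \<open>
  Symmetry folds the negative half line onto the positive one, which is the origin of the factor
  2.
\<close>

lemma distr_abs_powr:
  fixes f :: "real \<Rightarrow> real" and C :: "'a \<Rightarrow> real"
  assumes D: "distributed M lborel C (\<lambda>t. ennreal (f t))" and "prob_space M"
    and f [measurable]: "f \<in> borel_measurable borel" and nonneg: "\<And>t. 0 \<le> f t"
    and even: "\<And>t. f (- t) = f t" and q: "q \<noteq> 0"
  shows "distr M borel (\<lambda>\<omega>. \<bar>C \<omega>\<bar> powr q)
      = density lborel (\<lambda>x. ennreal (indicator {0<..} x * (2 * \<bar>1 / q * x powr (1 / q - 1)\<bar> * f (x powr (1 / q)))))"
proof (rule measure_eqI)
  interpret prob_space M by fact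
  have C [measurable]: "C \<in> borel_measurable M" using D by (simp add: distributed_def)
  have law: "distr M lborel C = density lborel (\<lambda>t. ennreal (f t))" using D by (simp add: distributed_def)
  have "(\<integral>\<^sup>+t. ennreal (f t) \<partial>lborel) = emeasure (distr M lborel C) UNIV"
    by (simp add: law emeasure_density)
  also have "\<dots> = 1" by (subst emeasure_distr) (auto simp: emeasure_space_1)
  finally have int: "integrable lborel f"
    using nonneg by (intro integrableI_nonneg) auto
  fix A assume "A \<in> sets (distr M borel (\<lambda>\<omega>. \<bar>C \<omega>\<bar> powr q))"
  then have A [measurable]: "A \<in> sets borel" by simp
  define F where "F t = indicator A (t powr q) * f t" for t
  have F [measurable]: "F \<in> borel_measurable borel" unfolding F_def by measurable
  have F0: "0 \<le> F t" for t using nonneg by (simp add: F_def)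
  have F_int: "integrable lborel F"
    by (rule Bochner_Integration.integrable_bound[OF int]) (auto simp: F_def indicator_def)
  have "emeasure (distr M borel (\<lambda>\<omega>. \<bar>C \<omega>\<bar> powr q)) A = emeasure (distr M lborel C) ((\<lambda>t. \<bar>t\<bar> powr q) -` A)"
  proof -
    have "(\<lambda>t :: real. \<bar>t\<bar> powr q) -` A \<in> sets borel"
      by (rule measurable_sets_borel[OF _ A]) measurable
    then show ?thesis by (simp add: emeasure_distr vimage_def)
  qed
  also have "\<dots> = (\<integral>\<^sup>+t. ennreal (f t) * indicator ((\<lambda>t. \<bar>t\<bar> powr q) -` A) t \<partial>lborel)"
  proof -
    have "(\<lambda>t :: real. \<bar>t\<bar> powr q) -` A \<in> sets borel"
      by (rule measurable_sets_borel[OF _ A]) measurable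
    then show ?thesis unfolding law by (intro emeasure_density) auto
  qed
  also have "\<dots> = (\<integral>\<^sup>+t. ennreal (indicator {0<..} t * F t) + ennreal (indicator {0<..} (- t) * F (- t)) \<partial>lborel)"
  proof (rule nn_integral_cong_AE)
    show "AE t in lborel. ennreal (f t) * indicator ((\<lambda>t. \<bar>t\<bar> powr q) -` A) t
        = ennreal (indicator {0<..} t * F t) + ennreal (indicator {0<..} (- t) * F (- t))"
      using AE_lborel_singleton[of "0 :: real"]
      by eventually_elim (auto simp: F_def even indicator_def abs_if)
  qed
  also have "\<dots> = (\<integral>\<^sup>+t. ennreal (indicator {0<..} t * F t) \<partial>lborel) + (\<integral>\<^sup>+t. ennreal (indicator {0<..} (- t) * F (- t)) \<partial>lborel)"
    by (rule nn_integral_add) auto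
  also have "(\<integral>\<^sup>+t. ennreal (indicator {0<..} (- t) * F (- t)) \<partial>lborel) = (\<integral>\<^sup>+t. ennreal (indicator {0<..} t * F t) \<partial>lborel)"
    using nn_integral_real_affine[of "\<lambda>t. ennreal (indicator {0<..} t * F t)" "-1" 0] by simp
  also have "(\<integral>\<^sup>+t. ennreal (indicator {0<..} t * F t) \<partial>lborel)
      = (\<integral>\<^sup>+x. ennreal (indicator {0<..} x * (\<bar>1 / q * x powr (1 / q - 1)\<bar> * F (x powr (1 / q)))) \<partial>lborel)"
    using q by (intro nn_integral_powr_substitution F F0 F_int) simp
  finally have "emeasure (distr M borel (\<lambda>\<omega>. \<bar>C \<omega>\<bar> powr q)) A
      = 2 * (\<integral>\<^sup>+x. ennreal (indicator {0<..} x * (\<bar>1 / q * x powr (1 / q - 1)\<bar> * F (x powr (1 / q)))) \<partial>lborel)"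
    by (simp only: mult_2)
  also have "\<dots> = (\<integral>\<^sup>+x. 2 * ennreal (indicator {0<..} x * (\<bar>1 / q * x powr (1 / q - 1)\<bar> * F (x powr (1 / q)))) \<partial>lborel)"
    by (rule nn_integral_cmult[symmetric]) measurable
  also have "\<dots> = (\<integral>\<^sup>+x. ennreal (indicator {0<..} x * (2 * \<bar>1 / q * x powr (1 / q - 1)\<bar> * f (x powr (1 / q)))) * indicator A x \<partial>lborel)"
  proof (rule nn_integral_cong)
    fix x :: real
    show "2 * ennreal (indicator {0<..} x * (\<bar>1 / q * x powr (1 / q - 1)\<bar> * F (x powr (1 / q))))
        = ennreal (indicator {0<..} x * (2 * \<bar>1 / q * x powr (1 / q - 1)\<bar> * f (x powr (1 / q)))) * indicator A x"
      using q by (cases "0 < x"; cases "x \<in> A")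
        (auto simp: F_def powr_powr ennreal_mult'[of 2, symmetric] simp flip: ennreal_numeral intro!: arg_cong[of _ _ ennreal])
  qed
  also have "\<dots> = emeasure (density lborel (\<lambda>x. ennreal (indicator {0<..} x * (2 * \<bar>1 / q * x powr (1 / q - 1)\<bar> * f (x powr (1 / q)))))) A"
    by (subst emeasure_density) auto
  finally show "emeasure (distr M borel (\<lambda>\<omega>. \<bar>C \<omega>\<bar> powr q)) A = \<dots>" .
qed simp

section \<open>Powers of alpha-Cauchy variables\<close>

text \<open>
  Here \<open>g x = c * (x powr (- d) / (1 + x powr r))\<close> with \<open>d = 2 - b\<close>, and the two hypotheses on \<open>b\<close>
  are the inequalities \<open>2 - r \<le> d\<close> and \<open>r - 1 \<le> d\<close> under which this is completely monotone.
\<close>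

lemma infinitely_divisible_powr_density:
  assumes \<mu>: "real_distribution \<mu>"
    and \<mu>_eq: "\<mu> = density lborel (\<lambda>x. ennreal (indicator {0<..} x * (c * x powr (b - 1) / (1 + x powr r))))"
    and c: "0 < c" and r: "0 < r" "r \<le> 2" and b: "b \<le> r" "b + r \<le> 3"
  shows "infinitely_divisible_law \<mu>"
proof -
  define g where "g x = c * (x powr (- (2 - b)) / (1 + x powr r))" for x
  have g_eq: "indicator {0<..} x * (c * x powr (b - 1) / (1 + x powr r)) = indicator {0<..} x * (x * g x)" for x :: real
  proof (cases "0 < x")
    case True
    then have "x * x powr (- (2 - b)) = x powr (b - 1)"
      using powr_add[of x 1 "- (2 - b)"] by simp
    then show ?thesis using True by (simp add: g_def)
  qed simp
  have \<mu>_g: "\<mu> = density lborel (\<lambda>x. ennreal (indicator {0<..} x * (x * g x)))"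
    unfolding \<mu>_eq g_eq ..
  have one_plus: "1 + x powr r \<noteq> 0" for x
    using powr_ge_zero[of x r] by linarith
  have cont: "continuous_on {0<..} g"
    unfolding g_def by (intro continuous_intros) (auto simp: one_plus)
  have g_meas: "(\<lambda>x. ennreal (indicator {0<..} x * (x * g x))) \<in> borel_measurable lborel"
    unfolding g_def by measurable
  interpret real_distribution \<mu> by (rule \<mu>)
  show ?thesis
  proof (rule infinitely_divisible_gamma2_mixture[OF _ cont _ _ \<mu> \<mu>_g])
    show "comp_mono g"
      unfolding g_def using c r b
      by (intro comp_mono_mult comp_mono_const comp_mono_powr_div_one_plus_powr) auto
    show "0 < g x" if "0 < x" for x
      unfolding g_def using c that by (intro mult_pos_pos divide_pos_pos add_pos_nonneg) auto
    have "(\<integral>\<^sup>+x. ennreal (indicator {0<..} x * (x * g x)) \<partial>lborel) = emeasure \<mu> UNIV"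
      unfolding \<mu>_g by (subst emeasure_density[OF g_meas]) auto
    then show "(\<integral>\<^sup>+x. ennreal (indicator {0<..} x * (x * g x)) \<partial>lborel) = 1"
      using emeasure_space_1 by simp
  qed
qed

theorem theorem1p6:
  fixes M :: "'a measure" and C :: "'a \<Rightarrow> real" and \<alpha> \<epsilon> p :: real
  assumes "prob_space M"
    and "\<alpha> > 1"
    and "distributed M lborel C (\<lambda>t. ennreal (alpha_cauchy_density \<alpha> t))"
    and "\<epsilon> \<in> {1, -1}"
    and "p \<ge> (if \<epsilon> = 1
               then (if \<alpha> \<le> 2 then (\<alpha> + 1) / 3 else \<alpha> / 2)
               else (if \<alpha> \<le> 2 then \<alpha> / 2 else (2 * \<alpha> - 1) / 3))"
  shows "infinitely_divisible M (\<lambda>\<omega>. \<bar>C \<omega>\<bar> powr (\<epsilon> * p))"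
proof -
  interpret prob_space M by fact
  note D = assms(3)
  have C [measurable]: "C \<in> borel_measurable M" using D by (simp add: distributed_def)
  have \<alpha>: "1 < \<alpha>" by fact
  have p: "0 < p" "\<alpha> / 2 \<le> p" using assms by (auto split: if_splits)
  define K where "K = sin (pi / \<alpha>) / (2 * pi / \<alpha>)"
  have "0 < sin (pi / \<alpha>)" using \<alpha> by (intro sin_gt_zero) (auto simp: field_simps)
  then have K: "0 < K" using \<alpha> by (simp add: K_def)
  have dens: "alpha_cauchy_density \<alpha> t = K / (1 + \<bar>t\<bar> powr \<alpha>)" for t
    by (simp add: alpha_cauchy_density_def K_def)
  have f: "alpha_cauchy_density \<alpha> \<in> borel_measurable borel" "0 \<le> alpha_cauchy_density \<alpha> t"
      "alpha_cauchy_density \<alpha> (- t) = alpha_cauchy_density \<alpha> t" for t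
    using K unfolding dens by (auto simp: add_nonneg_nonneg intro!: divide_nonneg_nonneg)
  have q: "\<epsilon> * p \<noteq> 0" using assms(4) p by auto
  define \<mu> where "\<mu> = distr M borel (\<lambda>\<omega>. \<bar>C \<omega>\<bar> powr (\<epsilon> * p))"
  have \<mu>: "real_distribution \<mu>" unfolding \<mu>_def by (rule real_distribution_distr) measurable
  define r where "r = \<alpha> / p"
  have r: "0 < r" "r \<le> 2" using p \<alpha> by (auto simp: r_def field_simps)
  define b where "b = (if \<epsilon> = 1 then 1 / p else (\<alpha> - 1) / p)"
  have b: "b \<le> r" "b + r \<le> 3"
  proof -
    define B where "B = (if \<epsilon> = 1 then 1 else \<alpha> - 1)"
    have "B \<le> \<alpha>" "B + \<alpha> \<le> 3 * p"
      using assms(4,5) \<alpha> by (auto simp: B_def split: if_splits)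
    moreover have "b = B / p" by (simp add: b_def B_def)
    ultimately show "b \<le> r" "b + r \<le> 3"
      using p by (auto simp: r_def divide_right_mono pos_divide_le_eq simp flip: add_divide_distrib)
  qed
  have "\<mu> = density lborel (\<lambda>x. ennreal (indicator {0<..} x * ((2 * K / p) * x powr (b - 1) / (1 + x powr r))))"
    unfolding \<mu>_def distr_abs_powr[OF D \<open>prob_space M\<close> f q]
  proof (intro arg_cong[of _ _ "density lborel"] ext arg_cong[of _ _ ennreal])
    fix x :: real
    show "indicator {0<..} x * (2 * \<bar>1 / (\<epsilon> * p) * x powr (1 / (\<epsilon> * p) - 1)\<bar> * alpha_cauchy_density \<alpha> (x powr (1 / (\<epsilon> * p))))
        = indicator {0<..} x * ((2 * K / p) * x powr (b - 1) / (1 + x powr r))"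
    proof (cases "0 < x")
      case x: True
      consider "\<epsilon> = 1" | "\<epsilon> = -1" using assms(4) by auto
      then show ?thesis
      proof cases
        case 1
        then show ?thesis using x p by (simp add: dens powr_powr b_def r_def abs_mult)
      next
        case 2
        \<comment> \<open>\<open>1 / (1 + x powr (- r)) = x powr r / (1 + x powr r)\<close> restores the form with a positive exponent.\<close>
        have nz: "1 + x powr r \<noteq> 0" "1 + x powr (- r) \<noteq> 0"
          using powr_ge_zero[of x r] powr_ge_zero[of x "- r"] by linarith+
        have "x powr (b - 1) * (1 + x powr (- r)) = x powr (- (1 / p) - 1) * (1 + x powr r)"
        proof -
          have "b - 1 = (- (1 / p) - 1) + r" "(b - 1) + - r = - (1 / p) - 1"
            using 2 by (simp_all add: b_def r_def diff_divide_distrib)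
          then have "x powr (b - 1) = x powr (- (1 / p) - 1) * x powr r"
              "x powr (b - 1) * x powr (- r) = x powr (- (1 / p) - 1)"
            by (simp_all only: powr_add[symmetric])
          then show ?thesis by (simp add: distrib_left)
        qed
        then have "x powr (- (1 / p) - 1) / (1 + x powr (- r)) = x powr (b - 1) / (1 + x powr r)"
          using nz by (simp add: frac_eq_eq)
        then have "(2 * K / p) * (x powr (- (1 / p) - 1) / (1 + x powr (- r))) = (2 * K / p) * (x powr (b - 1) / (1 + x powr r))"
          by simp
        then show ?thesis using x p 2 by (simp add: dens powr_powr r_def abs_mult mult_ac)
      qed
    qed simp
  qed
  from infinitely_divisible_powr_density[OF \<mu> this _ r b] have "infinitely_divisible_law \<mu>"
    using K p by simp
  then show ?thesis by (simp add: infinitely_divisible_def \<mu>_def)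
qed

end
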